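(* The following decision problem is NP-hard: given a finite set $G$ of matrices in $\mathrm{SL}(2,\mathbb{Z})$, generating the multiplicative semigroup $S$, decide whether $S$ is not free, i.e. whether some element of $S$ has more than one factorization over $G$.
   Context: $\mathrm{SL}(2,\mathbb{Z})$ is the group of $2\times2$ integer matrices with determinant $1$. For a finite set $G$ of matrices, $S=\langle G\rangle$ denotes the semigroup of all finite nonempty products of elements of $G$. A factorization of $M\in S$ over $G$ is a finite nonempty sequence $(A_1,\dots,A_t)$ of elements of $G$ with $A_1A_2\cdots A_t=M$; two factorizations are different if they are different sequences. $S$ is free (with respect to $G$) if every element of $S$ has exactly one factorization over $G$. *)

theory Defs
  imports "HOL-Analysis.Determinants" "HOL-Computational_Algebra.Polynomial"
begin

section \<open>Turing machines\<close>

text \<open>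
  Machines have one or more two-way infinite tapes and are possibly nondeterministic. States and
  tape symbols are natural numbers; since a machine is a finite set of instructions, it uses only
  finitely many of them. An instruction \<open>(q, rs, q', as)\<close> applies in state \<open>q\<close> when
  the heads read the symbols \<open>rs\<close>; it moves to state \<open>q'\<close> and, on each tape, writes
  a symbol and then moves the head according to \<open>as\<close>.
\<close>

datatype dir = Left | Stay | Right

record tm =
  tapes :: nat
  start :: nat
  accept :: nat
  instrs :: "(nat \<times> nat list \<times> nat \<times> (nat \<times> dir) list) set"

definition wf_tm :: "tm \<Rightarrow> bool" where
  "wf_tm M \<longleftrightarrow> tapes M \<ge> 1 \<and> finite (instrs M) \<and>
     (\<forall>(q, rs, q', as) \<in> instrs M. length rs = tapes M \<and> length as = tapes M)"

definition deterministic :: "tm \<Rightarrow> bool" where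
  "deterministic M \<longleftrightarrow>
     (\<forall>q rs q1 as1 q2 as2. (q, rs, q1, as1) \<in> instrs M \<longrightarrow> (q, rs, q2, as2) \<in> instrs M
        \<longrightarrow> q1 = q2 \<and> as1 = as2)"

text \<open>A tape is given by the contents of its cells and the position of the head.\<close>

type_synonym tape = "(int \<Rightarrow> nat) \<times> int"

type_synonym config = "nat \<times> tape list"

fun displacement :: "dir \<Rightarrow> int" where
  "displacement Left = -1"
| "displacement Stay = 0"
| "displacement Right = 1"

fun read :: "tape \<Rightarrow> nat" where
  "read (c, h) = c h"

fun act :: "nat \<times> dir \<Rightarrow> tape \<Rightarrow> tape" where
  "act (s, d) (c, h) = (c(h := s), h + displacement d)"

definition step :: "tm \<Rightarrow> config \<Rightarrow> config \<Rightarrow> bool" where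
  "step M = (\<lambda>(q, ts) (q', ts').
     \<exists>as. (q, map read ts, q', as) \<in> instrs M \<and> ts' = map2 act as ts)"

definition halted :: "tm \<Rightarrow> config \<Rightarrow> bool" where
  "halted M c \<longleftrightarrow> (\<nexists>c'. step M c c')"

definition blank :: nat where
  "blank = 0"

definition bit_sym :: "bool \<Rightarrow> nat" where
  "bit_sym b = (if b then 2 else 1)"

definition input_tape :: "bool list \<Rightarrow> tape" where
  "input_tape x =
     (\<lambda>i. if 0 \<le> i \<and> nat i < length x then bit_sym (x ! nat i) else blank, 0)"

definition init :: "tm \<Rightarrow> bool list \<Rightarrow> config" where
  "init M x = (start M, input_tape x # replicate (tapes M - 1) (input_tape []))"

text \<open>
  The output is the word on the first tape that starts at the head and extends to the first blank;
  everything else on the tapes is ignored.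
\<close>

fun tape_word :: "tape \<Rightarrow> bool list \<Rightarrow> bool" where
  "tape_word (c, h) w \<longleftrightarrow>
     (\<forall>i < length w. c (h + int i) = bit_sym (w ! i)) \<and> c (h + int (length w)) = blank"

definition has_output :: "config \<Rightarrow> bool list \<Rightarrow> bool" where
  "has_output c w \<longleftrightarrow> tape_word (hd (snd c)) w"


section \<open>Polynomial time, NP, and NP-hardness\<close>

definition poly_time_computable :: "(bool list \<Rightarrow> bool list) \<Rightarrow> bool" where
  "poly_time_computable f \<longleftrightarrow>
     (\<exists>M (p :: nat poly). wf_tm M \<and> deterministic M \<and>
        (\<forall>x. \<exists>t \<le> poly p (length x). \<exists>c.
           (step M ^^ t) (init M x) c \<and> halted M c \<and> has_output c (f x)))"

definition accepts_in :: "tm \<Rightarrow> bool list \<Rightarrow> nat \<Rightarrow> bool" where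
  "accepts_in M x t \<longleftrightarrow> (\<exists>c. (step M ^^ t) (init M x) c \<and> fst c = accept M)"

text \<open>
  The running time of a nondeterministic machine on an accepted word is the length of a shortest
  accepting computation; no bound is imposed on other computations.
\<close>

definition NP :: "bool list set set" where
  "NP = {A. \<exists>M (p :: nat poly). wf_tm M \<and> A = {x. \<exists>t. accepts_in M x t} \<and>
          (\<forall>x \<in> A. \<exists>t \<le> poly p (length x). accepts_in M x t)}"

definition poly_reducible :: "bool list set \<Rightarrow> bool list set \<Rightarrow> bool" where
  "poly_reducible A B \<longleftrightarrow> (\<exists>f. poly_time_computable f \<and> (\<forall>x. x \<in> A \<longleftrightarrow> f x \<in> B))"

definition NP_hard :: "bool list set \<Rightarrow> bool" where
  "NP_hard B \<longleftrightarrow> (\<forall>A \<in> NP. poly_reducible A B)"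


section \<open>Matrix semigroups and freeness\<close>

type_synonym mat2 = "int^2^2"

definition SL2Z :: "mat2 set" where
  "SL2Z = {A. det A = 1}"

definition mat_prod :: "mat2 list \<Rightarrow> mat2" where
  "mat_prod As = foldr (**) As (mat 1)"

definition gen_semigroup :: "mat2 set \<Rightarrow> mat2 set" where
  "gen_semigroup G = {mat_prod As | As. As \<noteq> [] \<and> set As \<subseteq> G}"

definition factorization :: "mat2 set \<Rightarrow> mat2 \<Rightarrow> mat2 list \<Rightarrow> bool" where
  "factorization G M As \<longleftrightarrow> As \<noteq> [] \<and> set As \<subseteq> G \<and> mat_prod As = M"

definition free_over :: "mat2 set \<Rightarrow> bool" where
  "free_over G \<longleftrightarrow> (\<forall>M \<in> gen_semigroup G. \<exists>!As. factorization G M As)"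

lemma not_free_over_iff:
  "\<not> free_over G \<longleftrightarrow>
     (\<exists>M \<in> gen_semigroup G. \<exists>As Bs. As \<noteq> Bs \<and> factorization G M As \<and> factorization G M Bs)"
  unfolding free_over_def gen_semigroup_def factorization_def by blast


section \<open>The decision problem as a language\<close>

text \<open>
  Integers are written in sign-magnitude binary, least significant bit first. A bit string is made
  self-delimiting by preceding every bit with \<^const>\<open>True\<close> and ending it with
  \<^const>\<open>False\<close>, so that encoded integers can simply be concatenated.
\<close>

fun binary :: "nat \<Rightarrow> bool list" where
  "binary n = (if n = 0 then [] else odd n # binary (n div 2))"

declare binary.simps [simp del]

fun delimit :: "bool list \<Rightarrow> bool list" where
  "delimit [] = [False]"
| "delimit (b # bs) = True # b # delimit bs"

definition encode_int :: "int \<Rightarrow> bool list" where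
  "encode_int z = delimit ((z < 0) # binary (nat \<bar>z\<bar>))"

definition encode_mat :: "mat2 \<Rightarrow> bool list" where
  "encode_mat A =
     encode_int (A $ 1 $ 1) @ encode_int (A $ 1 $ 2) @ encode_int (A $ 2 $ 1) @ encode_int (A $ 2 $ 2)"

definition encode_mats :: "mat2 list \<Rightarrow> bool list" where
  "encode_mats As = concat (map encode_mat As)"

text \<open>
  A finite set is presented by listing its elements without repetition, in any order. Words that
  do not encode a finite subset of \<^const>\<open>SL2Z\<close> are not in the language.
\<close>

definition SL2Z_nonfreeness :: "bool list set" where
  "SL2Z_nonfreeness =
     {encode_mats As | As. distinct As \<and> set As \<subseteq> SL2Z \<and> \<not> free_over (set As)}"

lemma binary_inject: "binary m = binary n \<Longrightarrow> m = n"
proof (induction m arbitrary: n rule: less_induct)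
  case (less m)
  show ?case
  proof (cases "m = 0 \<or> n = 0")
    case True
    with less.prems show ?thesis
      by (subst (asm) binary.simps, subst (asm) (2) binary.simps) (auto split: if_splits)
  next
    case False
    from less.prems have "odd m = odd n" "binary (m div 2) = binary (n div 2)"
      using False by (simp_all add: binary.simps[of m] binary.simps[of n])
    moreover from this(2) have "m div 2 = n div 2"
      using less.IH[of "m div 2"] False by simp
    ultimately show ?thesis
      by (metis bit_eq_rec)
  qed
qed

lemma delimit_append_inject: "delimit xs @ u = delimit ys @ v \<longleftrightarrow> xs = ys \<and> u = v"
proof (induction xs arbitrary: ys)
  case Nil
  show ?case by (cases ys) auto
next
  case (Cons x xs)
  then show ?case by (cases ys) auto
qed

lemma encode_int_append_inject: "encode_int a @ u = encode_int b @ v \<longleftrightarrow> a = b \<and> u = v"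
  unfolding encode_int_def delimit_append_inject by (auto dest!: binary_inject)

lemma encode_mat_append_inject: "encode_mat A @ u = encode_mat B @ v \<longleftrightarrow> A = B \<and> u = v"
  unfolding encode_mat_def append_assoc encode_int_append_inject
  by (auto simp: vec_eq_iff forall_2)

lemma encode_mat_not_Nil: "encode_mat A \<noteq> []"
  by (simp add: encode_mat_def encode_int_def)

lemma inj_encode_mats: "inj encode_mats"
proof (rule injI)
  fix As Bs show "encode_mats As = encode_mats Bs \<Longrightarrow> As = Bs"
  proof (induction As arbitrary: Bs)
    case Nil
    then show ?case by (cases Bs) (auto simp: encode_mats_def encode_mat_not_Nil)
  next
    case (Cons A As)
    then show ?case
      by (cases Bs) (auto simp: encode_mats_def encode_mat_not_Nil encode_mat_append_inject)
  qed
qed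

end

theory Submission imports Defs begin

text \<open>
  Let \<open>a\<close> and \<open>b\<close> be the elementary matrices with off-diagonal entry 2, which generate a free group. The
  generators are \<open>b ^ (2 ^ m) * a ^ n * b ^ (- (2 ^ (m + 1)))\<close>. In a product of them, neighbours with
  consecutive \<open>m\<close> telescope and add up their weights \<open>n\<close>, and by the ping-pong argument nothing else
  cancels. So the semigroup is free unless two different paths \<open>m, m + 1, \<dots>\<close> with the same start have
  the same total weight.

  An accepting computation is a tiling: item \<open>m\<close> of a long list of items is given a tile, which
  exchanges a colour with the items \<open>m - 1\<close> and \<open>m + 1\<close> and a letter with the items \<open>m - W\<close> and \<open>m + W\<close>.
  Each tile yields two generators, whose weights share a digit identifying the tile. One of them
  contributes the colour and letter that the tile produces, the other those that it consumes. Hence two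
  different paths of the same weight use the same tiles, and where they differ, one path produces and
  the other one consumes. Comparing the digits of the colours, this propagates to all items, and then
  equality of the weights says that the tiles form a tiling.
\<close>

section \<open>Paths in the free group\<close>

text \<open>NP-hardness is stated for concrete Turing machines, so a machine must run the reduction
  itself, and this shapes the construction. The ping-pong argument only needs pairwise different
  exponents of \<open>b\<close>; they are \<open>2 ^ m\<close> rather than \<open>m\<close> because
  the binary notation of \<open>2 ^ m\<close> is a block of zeros counted by the items already
  passed. Likewise the base of the weights is a power of two, so multiplying by
  \<open>B ^ (3 * m)\<close> or \<open>B ^ (3 * W)\<close> only inserts zeros. Every matrix is thus
  printed by concatenating fixed words, words repeated \<open>m\<close> times and words repeated
  \<open>W\<close> times, without any arithmetic, and its size stays polynomial. The tiles of an
  item depend only on its symbol, one of nine. For a fixed nondeterministic machine the printing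
  program is therefore a finite table, and the input enters only through the list of items. Colour 0
  occurs only at the two outer ends of the list; this is what forces two different paths of equal
  weight to cover all items. Digits never carry: where two contributions can meet, each is below
  half the base.\<close>

definition mk :: "int \<Rightarrow> int \<Rightarrow> int \<Rightarrow> int \<Rightarrow> mat2" where
  "mk a b c d = vector [vector [a, b], vector [c, d]]"

lemma mk_nth [simp]:
  "mk a b c d $ 1 $ 1 = a" "mk a b c d $ 1 $ 2 = b"
  "mk a b c d $ 2 $ 1 = c" "mk a b c d $ 2 $ 2 = d"
  by (simp_all add: mk_def)

lemma mk_mult:
  "mk a b c d ** mk a' b' c' d' =
     mk (a * a' + b * c') (a * b' + b * d') (c * a' + d * c') (c * b' + d * d')"
  by (simp add: vec_eq_iff forall_2 matrix_matrix_mult_def sum_2)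

lemma mk_one: "mat 1 = mk 1 0 0 1"
  by (simp add: vec_eq_iff forall_2 mat_def)

lemma mk_eq_iff: "mk a b c d = mk a' b' c' d' \<longleftrightarrow> a = a' \<and> b = b' \<and> c = c' \<and> d = d'"
  by (auto simp: vec_eq_iff forall_2)

lemma det_mk: "det (mk a b c d) = a * d - b * c"
  by (simp add: det_2)

definition lo :: "int \<Rightarrow> mat2" where "lo i = mk 1 0 (2 * i) 1"
definition up :: "int \<Rightarrow> mat2" where "up n = mk 1 (2 * n) 0 1"

lemma lo_add: "lo i ** lo j = lo (i + j)"
  and up_add: "up i ** up j = up (i + j)"
  and lo_0: "lo 0 = mat 1" and up_0: "up 0 = mat 1"
  by (simp_all add: lo_def up_def mk_mult mk_eq_iff mk_one algebra_simps)

text \<open>Taking the closed form as the definition, with the product derived in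
  \<open>edge_eq\<close>, exposes the signs and the binary shapes of the four entries. Here
  \<open>a\<close> is \<open>up 1\<close> and \<open>b\<close> is \<open>lo 1\<close>.\<close>

definition edge :: "nat \<Rightarrow> nat \<Rightarrow> mat2" where
  "edge m n = mk (1 - int n * 2 ^ (m + 3)) (2 * int n)
     (- (2 ^ (m + 1) + int n * 2 ^ (2 * m + 4))) (1 + int n * 2 ^ (m + 2))"

lemma pow_double: "(2::int) ^ (2 * m + 4) = 16 * (2 ^ m * 2 ^ m)"
  by (simp add: power_add power_mult power2_eq_square mult.commute flip: power_mult_distrib)

lemma edge_eq: "edge m n = lo (2 ^ m) ** up (int n) ** lo (- (2 ^ Suc m))"
  unfolding edge_def pow_double
  by (simp add: lo_def up_def mk_mult mk_eq_iff algebra_simps power_add)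

lemma edge_SL2Z: "edge m n \<in> SL2Z"
  by (simp add: SL2Z_def edge_eq det_mul) (simp add: lo_def up_def det_mk)

lemma edge_inject: "edge m n = edge m' n' \<longleftrightarrow> m = m' \<and> n = n'" if "n > 0"
proof
  assume e: "edge m n = edge m' n'"
  then have "n = n'" by (simp add: edge_def mk_eq_iff)
  with e that show "m = m' \<and> n = n'" by (simp add: edge_def mk_eq_iff)
qed simp

fun chain :: "nat \<Rightarrow> nat list \<Rightarrow> (nat \<times> nat) list" where
  "chain s [] = []"
| "chain s (n # ns) = (s, n) # chain (Suc s) ns"

definition path_prod :: "(nat \<times> nat) list \<Rightarrow> mat2" where
  "path_prod es = mat_prod (map (case_prod edge) es)"

lemma mat_prod_append: "mat_prod (xs @ ys) = mat_prod xs ** mat_prod ys"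
  by (induction xs) (simp_all add: mat_prod_def matrix_mul_assoc)

lemma path_prod_Nil [simp]: "path_prod [] = mat 1"
  and path_prod_Cons [simp]: "path_prod ((m, n) # es) = edge m n ** path_prod es"
  and path_prod_append: "path_prod (es @ fs) = path_prod es ** path_prod fs"
  by (simp_all add: path_prod_def mat_prod_append) (simp_all add: mat_prod_def)

text \<open>Telescoping: the trailing \<open>lo (- (2 ^ Suc s))\<close> of an edge cancels the
  leading \<open>lo (2 ^ Suc s)\<close> of its successor, and the powers of \<open>a\<close> in
  between merge.\<close>

lemma path_prod_chain:
  "path_prod (chain s ns) = lo (2 ^ s) ** up (int (sum_list ns)) ** lo (- (2 ^ (s + length ns)))"
proof (induction ns arbitrary: s)
  case Nil
  show ?case by (simp add: up_0 lo_add lo_0)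
next
  case (Cons n ns)
  have "path_prod (chain s (n # ns)) =
      lo (2 ^ s) ** (up (int n) ** (lo (- (2 ^ Suc s)) ** lo (2 ^ Suc s)) ** up (int (sum_list ns)))
        ** lo (- (2 ^ (Suc s + length ns)))"
    by (simp add: Cons edge_eq matrix_mul_assoc)
  also have "\<dots> = lo (2 ^ s) ** up (int (sum_list (n # ns))) ** lo (- (2 ^ (s + length (n # ns))))"
    by (simp add: lo_add lo_0 up_add)
  finally show ?case .
qed

section \<open>Ping-pong on the second column\<close>

definition lower :: "int \<Rightarrow> int \<times> int \<Rightarrow> int \<times> int" where
  "lower i v = (fst v, snd v + 2 * i * fst v)"
definition upper :: "int \<Rightarrow> int \<times> int \<Rightarrow> int \<times> int" where
  "upper n v = (fst v + 2 * n * snd v, snd v)"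
text \<open>The image of the vector (0, 1), which is tall. Following this single vector is enough to
  tell the products apart.\<close>

definition col2 :: "mat2 \<Rightarrow> int \<times> int" where
  "col2 A = (A $ 1 $ 2, A $ 2 $ 2)"

lemma col2_lo: "col2 (lo i ** A) = lower i (col2 A)"
  and col2_up: "col2 (up n ** A) = upper n (col2 A)"
  and col2_one: "col2 (mat 1) = (0, 1)"
  by (simp_all add: col2_def lo_def up_def lower_def upper_def matrix_matrix_mult_def sum_2 mat_def)

definition wide :: "int \<times> int \<Rightarrow> bool" where "wide v \<longleftrightarrow> \<bar>fst v\<bar> > \<bar>snd v\<bar>"
definition tall :: "int \<times> int \<Rightarrow> bool" where "tall v \<longleftrightarrow> \<bar>fst v\<bar> < \<bar>snd v\<bar>"

lemma tall_not_wide: "tall v \<Longrightarrow> \<not> wide v"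
  by (simp add: wide_def tall_def)

text \<open>This is where the entry 2 is used: the added term has absolute value at least twice that
  of \<open>x\<close>, and \<open>y\<close> can take away less than one of the two.\<close>

lemma shear_abs:
  fixes x y i :: int
  assumes "\<bar>x\<bar> > \<bar>y\<bar>" "i \<noteq> 0"
  shows "\<bar>y + 2 * i * x\<bar> > \<bar>x\<bar>"
proof -
  have "1 * \<bar>x\<bar> \<le> \<bar>i\<bar> * \<bar>x\<bar>" using assms by (intro mult_right_mono) auto
  then have "\<bar>2 * i * x\<bar> \<ge> 2 * \<bar>x\<bar>" by (simp add: abs_mult)
  with assms show ?thesis by linarith
qed

lemma tall_lower: "wide v \<Longrightarrow> i \<noteq> 0 \<Longrightarrow> tall (lower i v)"
  and wide_upper: "tall v \<Longrightarrow> n \<noteq> 0 \<Longrightarrow> wide (upper n v)"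
  by (auto simp: wide_def tall_def lower_def upper_def intro: shear_abs)

lemma lower_add: "lower i (lower j v) = lower (i + j) v"
  and upper_add: "upper i (upper j v) = upper (i + j) v"
  and lower_0: "lower 0 v = v" and upper_0: "upper 0 v = v"
  by (simp_all add: lower_def upper_def algebra_simps)

text \<open>Maximality of the initial chain keeps the exponent of \<open>b\<close> at the junction
  with the rest nonzero.\<close>

lemma maximal_chain:
  assumes "es \<noteq> []"
  obtains ns rest where "ns \<noteq> []" "es = chain (fst (hd es)) ns @ rest"
    "rest = [] \<or> fst (hd rest) \<noteq> fst (hd es) + length ns"
proof -
  have "\<exists>ns rest. ns \<noteq> [] \<and> es = chain (fst (hd es)) ns @ rest \<and>
      (rest = [] \<or> fst (hd rest) \<noteq> fst (hd es) + length ns)"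
    using assms
  proof (induction es)
    case (Cons e es)
    obtain s n where e: "e = (s, n)" by force
    show ?case
    proof (cases "es = [] \<or> fst (hd es) \<noteq> Suc s")
      case True
      then show ?thesis by (intro exI[of _ "[n]"] exI[of _ es]) (auto simp: e)
    next
      case False
      with Cons.IH obtain ns rest where "ns \<noteq> []" "es = chain (Suc s) ns @ rest"
        "rest = [] \<or> fst (hd rest) \<noteq> Suc s + length ns" by auto
      then show ?thesis by (intro exI[of _ "n # ns"] exI[of _ rest]) (auto simp: e)
    qed
  qed simp
  with that show ?thesis by blast
qed

lemma sum_list_pos_nat: "ns \<noteq> [] \<Longrightarrow> (\<And>n. n \<in> set ns \<Longrightarrow> n > (0::nat)) \<Longrightarrow> sum_list ns > 0"
  by (cases ns) auto

lemma map_snd_chain: "map snd (chain s ns) = ns"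
  by (induction ns arbitrary: s) auto

lemma set_chain_snd: "snd ` set (chain s ns) = set ns"
  by (induction ns arbitrary: s) auto

text \<open>Induction from chain to chain. At a junction the exponents of \<open>b\<close> combine
  to \<open>2 ^ s' - 2 ^ (s + length ns)\<close>, which is nonzero, so the wide vector left by the
  next chain becomes tall; at the very end (0, 1) is fixed by \<open>lower\<close> and is tall
  anyway.\<close>

lemma col2_chain_append:
  assumes "ns \<noteq> []" "es = chain s ns @ rest" "rest = [] \<or> fst (hd rest) \<noteq> s + length ns"
    and "\<And>e. e \<in> set es \<Longrightarrow> snd e > 0"
  shows "\<exists>w. tall w \<and> col2 (path_prod es) = lower (2 ^ s) (upper (int (sum_list ns)) w)"
  using assms
proof (induction "length es" arbitrary: es s ns rest rule: less_induct)
  case less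
  define e :: int where "e = 2 ^ (s + length ns)"
  have eq: "col2 (path_prod es) = lower (2 ^ s) (upper (int (sum_list ns)) (lower (- e) (col2 (path_prod rest))))"
    by (simp add: less.prems(2) path_prod_append path_prod_chain e_def col2_lo col2_up
        flip: matrix_mul_assoc)
  have "tall (lower (- e) (col2 (path_prod rest)))"
  proof (cases "rest = []")
    case True
    then show ?thesis by (simp add: col2_one lower_def tall_def)
  next
    case False
    define s' where "s' = fst (hd rest)"
    obtain ns' rest' where c: "ns' \<noteq> []" "rest = chain s' ns' @ rest'"
      "rest' = [] \<or> fst (hd rest') \<noteq> s' + length ns'"
      unfolding s'_def using maximal_chain[OF False] by metis
    have "length rest < length es" using less.prems by (cases ns) auto
    from less.hyps[OF this c] less.prems(2,4) obtain w where
      w: "tall w" "col2 (path_prod rest) = lower (2 ^ s') (upper (int (sum_list ns')) w)"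
      by auto
    have "set ns' \<subseteq> snd ` set es" using c(2) less.prems(2) set_chain_snd[of s' ns'] by auto
    then have "sum_list ns' > 0"
      using less.prems(4) by (intro sum_list_pos_nat[OF c(1)]) auto
    then have "int (sum_list ns') \<noteq> 0" by linarith
    with w(1) have "wide (upper (int (sum_list ns')) w)" by (rule wide_upper)
    moreover have "s' \<noteq> s + length ns" using less.prems(3) False by (simp add: s'_def)
    then have "- e + 2 ^ s' \<noteq> 0" unfolding e_def by (simp add: power_inject_exp)
    ultimately show ?thesis by (simp add: w(2) lower_add tall_lower)
  qed
  with eq show ?case by blast
qed

section \<open>Unique decoding and freeness\<close>

definition unambiguous :: "(nat \<times> nat) set \<Rightarrow> bool" where
  "unambiguous E \<longleftrightarrow> (\<forall>s ns ns'. ns \<noteq> [] \<longrightarrow> ns' \<noteq> [] \<longrightarrow> set (chain s ns) \<subseteq> E \<longrightarrow>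
     set (chain s ns') \<subseteq> E \<longrightarrow> sum_list ns = sum_list ns' \<longrightarrow> ns = ns')"

text \<open>Different starts would make a nonzero \<open>lower\<close> map a wide vector to a wide
  one; once the starts agree, different weights would make a nonzero \<open>upper\<close> map a tall
  vector to a tall one. The lengths of the two chains are not determined, which is why
  \<open>unambiguous\<close> also compares chains of different lengths.\<close>

lemma path_prod_decode:
  assumes "es \<noteq> []" "fs \<noteq> []" "path_prod es = path_prod fs"
    and pos: "\<And>e. e \<in> set es \<union> set fs \<Longrightarrow> snd e > 0"
  obtains s ns ns' rest rest' where "ns \<noteq> []" "ns' \<noteq> []" "es = chain s ns @ rest"
    "fs = chain s ns' @ rest'" "sum_list ns = sum_list ns'"
proof -
  define s where "s = fst (hd es)"
  define s' where "s' = fst (hd fs)"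
  obtain ns rest where c: "ns \<noteq> []" "es = chain s ns @ rest"
    "rest = [] \<or> fst (hd rest) \<noteq> s + length ns"
    unfolding s_def using maximal_chain[OF assms(1)] by metis
  obtain ns' rest' where c': "ns' \<noteq> []" "fs = chain s' ns' @ rest'"
    "rest' = [] \<or> fst (hd rest') \<noteq> s' + length ns'"
    unfolding s'_def using maximal_chain[OF assms(2)] by metis
  obtain w where w: "tall w" "col2 (path_prod es) = lower (2 ^ s) (upper (int (sum_list ns)) w)"
    using col2_chain_append[OF c] pos by blast
  obtain w' where w': "tall w'" "col2 (path_prod es) = lower (2 ^ s') (upper (int (sum_list ns')) w')"
    using col2_chain_append[OF c'] pos assms(3) by auto
  let ?x = "upper (int (sum_list ns)) w" and ?x' = "upper (int (sum_list ns')) w'"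
  have "sum_list ns > 0" "sum_list ns' > 0"
    using c c' pos set_chain_snd[of s ns] set_chain_snd[of s' ns']
    by (fastforce intro!: sum_list_pos_nat)+
  then have "int (sum_list ns) \<noteq> 0" "int (sum_list ns') \<noteq> 0" by linarith+
  then have wide: "wide ?x" "wide ?x'"
    using w(1) w'(1) wide_upper by blast+
  have "lower (- (2 ^ s')) (lower (2 ^ s) ?x) = lower (- (2 ^ s')) (lower (2 ^ s') ?x')"
    using w w' by simp
  then have x: "lower (- (2 ^ s') + 2 ^ s) ?x = ?x'" by (simp add: lower_add lower_0)
  have "s = s'"
  proof (rule ccontr)
    assume "s \<noteq> s'"
    then have "- (2 ^ s') + 2 ^ s \<noteq> (0 :: int)" by simp
    from tall_lower[OF wide(1) this] wide(2) show False
      unfolding x by (simp add: tall_not_wide)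
  qed
  with x have "?x = ?x'" by (simp add: lower_0)
  then have "upper (- int (sum_list ns')) ?x = upper (- int (sum_list ns')) ?x'" by simp
  then have y: "upper (- int (sum_list ns') + int (sum_list ns)) w = w'"
    by (simp add: upper_add upper_0)
  have "sum_list ns = sum_list ns'"
  proof (rule ccontr)
    assume "sum_list ns \<noteq> sum_list ns'"
    then have "- int (sum_list ns') + int (sum_list ns) \<noteq> 0" by simp
    from wide_upper[OF w(1) this] w'(1) show False
      unfolding y by (simp add: tall_not_wide)
  qed
  with that c c' \<open>s = s'\<close> show ?thesis by blast
qed

text \<open>Excludes that one word is a proper prefix of another word with the same product.\<close>

lemma path_prod_not_one:
  assumes "es \<noteq> []" and pos: "\<And>e. e \<in> set es \<Longrightarrow> snd e > 0"
  shows "path_prod es \<noteq> mat 1"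
proof
  assume one: "path_prod es = mat 1"
  define s where "s = fst (hd es)"
  obtain ns rest where c: "ns \<noteq> []" "es = chain s ns @ rest"
    "rest = [] \<or> fst (hd rest) \<noteq> s + length ns"
    unfolding s_def using maximal_chain[OF assms(1)] by metis
  obtain w where w: "tall w" "col2 (path_prod es) = lower (2 ^ s) (upper (int (sum_list ns)) w)"
    using col2_chain_append[OF c] pos by blast
  have "sum_list ns > 0"
    using c pos set_chain_snd[of s ns] by (fastforce intro!: sum_list_pos_nat)
  then have "int (sum_list ns) \<noteq> 0" by linarith
  with w(1) have "wide (upper (int (sum_list ns)) w)" by (rule wide_upper)
  then have "fst (col2 (path_prod es)) \<noteq> 0" unfolding w(2) by (auto simp: lower_def wide_def)
  with one show False by (simp add: col2_one)
qed

lemma edge_cancel: "edge m n ** A = edge m n ** B \<Longrightarrow> A = B"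
proof -
  have inv: "(lo (2 ^ Suc m) ** up (- int n) ** lo (- (2 ^ m))) ** edge m n = mat 1"
  proof -
    have "(lo (2 ^ Suc m) ** up (- int n) ** lo (- (2 ^ m))) ** edge m n =
      lo (2 ^ Suc m) ** (up (- int n) ** (lo (- (2 ^ m)) ** lo (2 ^ m)) ** up (int n)) ** lo (- (2 ^ Suc m))"
      by (simp add: edge_eq matrix_mul_assoc)
    then show ?thesis by (simp add: lo_add up_add lo_0 up_0)
  qed
  assume "edge m n ** A = edge m n ** B"
  then have "(lo (2 ^ Suc m) ** up (- int n) ** lo (- (2 ^ m))) ** (edge m n ** A) =
    (lo (2 ^ Suc m) ** up (- int n) ** lo (- (2 ^ m))) ** (edge m n ** B)" by simp
  then show "A = B" by (simp only: matrix_mul_assoc inv matrix_mul_lid)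
qed

text \<open>Unambiguity identifies the two decoded initial chains, but only their common first edge
  is cancelled before the induction continues.\<close>

lemma path_prod_inject:
  assumes "unambiguous E" and pos: "\<And>e. e \<in> E \<Longrightarrow> snd e > 0"
  shows "set es \<subseteq> E \<Longrightarrow> set fs \<subseteq> E \<Longrightarrow> path_prod es = path_prod fs \<Longrightarrow> es = fs"
proof (induction es arbitrary: fs)
  case Nil
  moreover have "snd e > 0" if "e \<in> set fs" for e using that pos Nil by blast
  ultimately show ?case using path_prod_not_one[of fs] by (metis path_prod_Nil)
next
  case (Cons e es)
  have ne: "fs \<noteq> []"
  proof
    assume "fs = []"
    then have "path_prod (e # es) = mat 1" using Cons.prems(3) by (simp del: path_prod_Cons)
    moreover have "snd e' > 0" if "e' \<in> set (e # es)" for e' using that pos Cons.prems(1) by blast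
    ultimately show False using path_prod_not_one[of "e # es"] by blast
  qed
  have pos': "\<And>e'. e' \<in> set (e # es) \<union> set fs \<Longrightarrow> snd e' > 0" using Cons.prems pos by blast
  obtain s ns ns' rest rest' where c: "ns \<noteq> []" "ns' \<noteq> []" "e # es = chain s ns @ rest"
    "fs = chain s ns' @ rest'" "sum_list ns = sum_list ns'"
    using path_prod_decode[OF list.distinct(2) ne Cons.prems(3) pos'] .
  have "set (chain s ns) \<subseteq> E" "set (chain s ns') \<subseteq> E" using c Cons.prems by auto
  then have "ns = ns'" using assms(1) c(1,2,5) unfolding unambiguous_def by blast
  with c(1,3,4) obtain fs' where fs: "fs = e # fs'" by (cases ns) auto
  obtain m n where "e = (m, n)" by force
  with Cons.prems fs have "path_prod es = path_prod fs'" by (auto dest: edge_cancel)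
  with Cons.IH[of fs'] Cons.prems fs show ?case by simp
qed

lemma unambiguous_imp_free:
  assumes "unambiguous E" and pos: "\<And>e. e \<in> E \<Longrightarrow> snd e > 0"
  shows "free_over (case_prod edge ` E)"
proof -
  have "As = Bs" if "factorization (case_prod edge ` E) M As" "factorization (case_prod edge ` E) M Bs" for M As Bs
  proof -
    have "As \<in> map (case_prod edge) ` lists E" "Bs \<in> map (case_prod edge) ` lists E"
      using that by (auto simp: factorization_def simp flip: lists_image)
    then obtain es fs where "set es \<subseteq> E" "As = map (case_prod edge) es"
      "set fs \<subseteq> E" "Bs = map (case_prod edge) fs"
      by (auto simp: lists_eq_set)
    with path_prod_inject[OF assms, of es fs] that show ?thesis
      by (auto simp: factorization_def path_prod_def)
  qed
  then show ?thesis using not_free_over_iff by blast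
qed

text \<open>The lengths must agree because the product of a chain also depends on its end point
  \<open>s + length ns\<close>.\<close>

lemma ambiguous_imp_not_free:
  assumes "ns \<noteq> []" "set (chain s ns) \<subseteq> E" "set (chain s ns') \<subseteq> E"
    and "sum_list ns = sum_list ns'" "length ns = length ns'" "ns \<noteq> ns'"
    and pos: "\<And>e. e \<in> E \<Longrightarrow> snd e > 0"
  shows "\<not> free_over (case_prod edge ` E)"
proof -
  let ?G = "case_prod edge ` E"
  let ?As = "map (case_prod edge) (chain s ns)" and ?Bs = "map (case_prod edge) (chain s ns')"
  have inj: "inj_on (case_prod edge) E"
    using pos by (auto intro!: inj_onI simp: edge_inject)
  have "chain s ns \<noteq> chain s ns'"
    using assms(6) by (metis map_snd_chain)
  then have "?As \<noteq> ?Bs"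
    using map_inj_on[of "case_prod edge" "chain s ns" "chain s ns'"] inj_on_subset[OF inj] assms(2,3)
    by blast
  moreover have "mat_prod ?As = mat_prod ?Bs"
    using path_prod_chain[of s ns] path_prod_chain[of s ns'] assms(4,5) by (simp add: path_prod_def)
  moreover have "?As \<noteq> []" "?Bs \<noteq> []" using assms(1,5) by (cases ns; cases ns'; simp)+
  moreover have "set ?As \<subseteq> ?G" "set ?Bs \<subseteq> ?G" using assms(2,3) by auto
  ultimately show ?thesis
    unfolding not_free_over_iff factorization_def gen_semigroup_def by blast
qed

section \<open>Stack programs\<close>

datatype com =
    Skip
  | Push nat nat
  | Pop nat
  | Seq com com (infixr ";;" 60)
  | Test nat nat com com
  | Loop nat com

text \<open>Programs for machines whose tapes are used as stacks. \<open>Test i a c c'\<close> branches on whether \<open>a\<close> is on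
  top of stack \<open>i\<close>; \<open>Loop i c\<close> repeats \<open>c\<close> until stack \<open>i\<close> is empty. The symbol 0 is the blank and must
  not be pushed.\<close>

type_synonym store = "nat \<Rightarrow> nat list"

definition topsym :: "nat list \<Rightarrow> nat" where
  "topsym xs = (if xs = [] then 0 else hd xs)"

text \<open>The number is the exact number of steps of the compiled machine: a push moves and then
  writes, a successful test also pays for the jump over the other branch, and a loop iteration pays
  for the test and the jump back.\<close>

inductive exec :: "com \<Rightarrow> store \<Rightarrow> nat \<Rightarrow> store \<Rightarrow> bool" where
  Skip: "exec Skip \<sigma> 0 \<sigma>"
| Push: "exec (Push i a) \<sigma> 2 (\<sigma>(i := a # \<sigma> i))"
| Pop: "exec (Pop i) \<sigma> 1 (\<sigma>(i := tl (\<sigma> i)))"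
| Seq: "exec c \<sigma> t \<sigma>' \<Longrightarrow> exec c' \<sigma>' t' \<sigma>'' \<Longrightarrow> exec (c ;; c') \<sigma> (t + t') \<sigma>''"
| TestT: "topsym (\<sigma> i) = a \<Longrightarrow> exec c \<sigma> t \<sigma>' \<Longrightarrow> exec (Test i a c c') \<sigma> (t + 2) \<sigma>'"
| TestF: "topsym (\<sigma> i) \<noteq> a \<Longrightarrow> exec c' \<sigma> t \<sigma>' \<Longrightarrow> exec (Test i a c c') \<sigma> (t + 1) \<sigma>'"
| LoopF: "topsym (\<sigma> i) = 0 \<Longrightarrow> exec (Loop i c) \<sigma> 1 \<sigma>"
| LoopT: "topsym (\<sigma> i) \<noteq> 0 \<Longrightarrow> exec c \<sigma> t \<sigma>' \<Longrightarrow> exec (Loop i c) \<sigma>' t' \<sigma>'' \<Longrightarrow>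
    exec (Loop i c) \<sigma> (t + t' + 2) \<sigma>''"

lemma exec_length: "exec c \<sigma> t \<sigma>' \<Longrightarrow> length (\<sigma>' k) \<le> length (\<sigma> k) + t"
  by (induction rule: exec.induct) auto

section \<open>Compilation to a deterministic machine\<close>

type_synonym instr_fun = "nat list \<Rightarrow> nat \<times> (nat \<times> dir) list"

definition keep :: "nat list \<Rightarrow> (nat \<times> dir) list" where
  "keep rs = map (\<lambda>s. (s, Stay)) rs"

fun clen :: "com \<Rightarrow> nat" where
  "clen Skip = 0"
| "clen (Push i a) = 2"
| "clen (Pop i) = 1"
| "clen (c ;; c') = clen c + clen c'"
| "clen (Test i a c c') = clen c + clen c' + 2"
| "clen (Loop i c) = clen c + 2"

text \<open>The state is a program counter: the code of \<open>c\<close> is placed at address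
  \<open>n\<close>, and control leaves it at address \<open>n + clen c\<close>.\<close>

fun code :: "com \<Rightarrow> nat \<Rightarrow> instr_fun list" where
  "code Skip n = []"
| "code (Push i a) n = [\<lambda>rs. (n + 1, (keep rs)[i := (rs ! i, Left)]), \<lambda>rs. (n + 2, (keep rs)[i := (a, Stay)])]"
| "code (Pop i) n = [\<lambda>rs. (n + 1, (keep rs)[i := (rs ! i, Right)])]"
| "code (c ;; c') n = code c n @ code c' (n + clen c)"
| "code (Test i a c c') n =
     (\<lambda>rs. (if rs ! i = a then n + 1 else n + clen c + 2, keep rs)) # code c (n + 1) @
     (\<lambda>rs. (n + clen c + clen c' + 2, keep rs)) # code c' (n + clen c + 2)"
| "code (Loop i c) n =
     (\<lambda>rs. (if rs ! i = 0 then n + clen c + 2 else n + 1, keep rs)) # code c (n + 1) @ [\<lambda>rs. (n, keep rs)]"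

lemma length_code [simp]: "length (code c n) = clen c"
  by (induction c arbitrary: n) auto

text \<open>One number bounds both stack indices and pushed symbols, so it fixes the number of tapes
  and the alphabet of the machine.\<close>

fun ok :: "nat \<Rightarrow> com \<Rightarrow> bool" where
  "ok N Skip \<longleftrightarrow> True"
| "ok N (Push i a) \<longleftrightarrow> i \<le> N \<and> a \<le> N"
| "ok N (Pop i) \<longleftrightarrow> i \<le> N"
| "ok N (c ;; c') \<longleftrightarrow> ok N c \<and> ok N c'"
| "ok N (Test i a c c') \<longleftrightarrow> i \<le> N \<and> ok N c \<and> ok N c'"
| "ok N (Loop i c) \<longleftrightarrow> i \<le> N \<and> ok N c"

lemma ok_mono: "ok N c \<Longrightarrow> N \<le> N' \<Longrightarrow> ok N' c"
  by (induction c) auto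

lemma ex_ok: "\<exists>N \<ge> 2. ok N c"
proof (induction c)
  case (Push i a)
  show ?case by (rule exI[of _ "i + a + 2"]) auto
next
  case (Pop i)
  show ?case by (rule exI[of _ "i + 2"]) auto
next
  case (Seq c c')
  then obtain N N' where "N \<ge> 2" "ok N c" "ok N' c'" by auto
  then show ?case by (intro exI[of _ "N + N'"]) (auto intro: ok_mono)
next
  case (Test i a c c')
  then obtain N N' where "N \<ge> 2" "ok N c" "ok N' c'" by auto
  then show ?case by (intro exI[of _ "i + N + N'"]) (auto intro: ok_mono)
next
  case (Loop i c)
  then obtain N where "N \<ge> 2" "ok N c" by auto
  then show ?case by (intro exI[of _ "i + N"]) (auto intro: ok_mono)
qed auto

text \<open>Tabulating the instruction functions over the bounded alphabet makes the instruction set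
  finite. State \<open>length P\<close> gets no entry, so a finished program halts.\<close>

definition machine :: "nat \<Rightarrow> instr_fun list \<Rightarrow> tm" where
  "machine N P = \<lparr>tapes = N + 1, start = 0, accept = 0,
     instrs = (\<lambda>(q, rs). (q, rs, (P ! q) rs)) ` ({..<length P} \<times> {rs. set rs \<subseteq> {..N} \<and> length rs = N + 1})\<rparr>"

text \<open>A stack occupies the cells from the head to the right; the cells to the left of the head may
  contain anything and are overwritten by the next push.\<close>

fun tape_rep :: "nat \<Rightarrow> tape \<Rightarrow> nat list \<Rightarrow> bool" where
  "tape_rep N (c, h) xs \<longleftrightarrow>
     (\<forall>j. c (h + int j) = (if j < length xs then xs ! j else 0)) \<and> (\<forall>z. c z \<le> N)"

definition rep :: "nat \<Rightarrow> tape list \<Rightarrow> store \<Rightarrow> bool" where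
  "rep N ts \<sigma> \<longleftrightarrow> length ts = N + 1 \<and> (\<forall>i \<le> N. tape_rep N (ts ! i) (\<sigma> i))"

lemma read_tape_rep:
  assumes "tape_rep N t xs"
  shows "read t = topsym xs" and read_tape_rep_le: "read t \<le> N"
proof -
  obtain c h where t: "t = (c, h)" by force
  from assms have "c (h + int 0) = (if 0 < length xs then xs ! 0 else 0)" "c h \<le> N"
    unfolding t tape_rep.simps by blast+
  then show "read t = topsym xs" "read t \<le> N" by (auto simp: t topsym_def hd_conv_nth)
qed

lemma tape_rep_pop: "tape_rep N t xs \<Longrightarrow> tape_rep N (act (read t, Right) t) (tl xs)"
proof (cases t)
  case (Pair c h)
  assume "tape_rep N t xs"
  then have r: "\<And>j. c (h + int j) = (if j < length xs then xs ! j else 0)" "\<And>z. c z \<le> N"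
    unfolding Pair tape_rep.simps by blast+
  have "c (h + 1 + int j) = (if j < length (tl xs) then tl xs ! j else 0)" for j
    using r(1)[of "Suc j"] by (auto simp: nth_tl ac_simps)
  then show ?thesis using r(2) by (simp add: Pair)
qed

lemma tape_rep_push:
  assumes "tape_rep N t xs" "a \<le> N"
  shows "tape_rep N (act (a, Stay) (act (read t, Left) t)) (a # xs)"
proof -
  obtain c h where t: "t = (c, h)" by force
  then have r: "\<And>j. c (h + int j) = (if j < length xs then xs ! j else 0)" "\<And>z. c z \<le> N"
    using assms(1) by auto
  have "(c(h - 1 := a)) (h - 1 + int j) = (if j < length (a # xs) then (a # xs) ! j else 0)" for j
    using r(1)[of "j - 1"] by (cases j) auto
  then show ?thesis using r(2) assms(2) by (simp add: t)
qed

lemma map2_act_keep: "map2 act (keep (map read ts)) ts = ts"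
proof -
  have "act (read t, Stay) t = t" for t by (cases t) auto
  then show ?thesis by (simp add: keep_def list_eq_iff_nth_eq)
qed

lemma map2_act_update:
  "map2 act ((keep (map read ts))[i := x]) ts = (if i < length ts then ts[i := act x (ts ! i)] else ts)"
proof -
  have "act (read t, Stay) t = t" for t by (cases t) auto
  then show ?thesis by (auto simp: keep_def list_eq_iff_nth_eq nth_list_update)
qed

lemma machine_step:
  assumes "q < length P" "rep N ts \<sigma>" "(P ! q) (map read ts) = (q', as)"
  shows "step (machine N P) (q, ts) (q', map2 act as ts)"
proof -
  have "set (map read ts) \<subseteq> {..N}" "length (map read ts) = N + 1"
    using assms(2) read_tape_rep_le
    by (simp_all add: rep_def subset_eq) (metis in_set_conv_nth less_Suc_eq_le)
  then have "(q, map read ts, q', as) \<in> instrs (machine N P)"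
    using assms(1,3) by (auto simp: machine_def image_iff intro!: bexI[of _ "(q, map read ts)"])
  then show ?thesis by (auto simp: step_def)
qed

lemma rep_update:
  "rep N ts \<sigma> \<Longrightarrow> tape_rep N t xs \<Longrightarrow> rep N (ts[i := t]) (\<sigma>(i := xs))"
  by (auto simp: rep_def nth_list_update)

lemma rep_read: "rep N ts \<sigma> \<Longrightarrow> i \<le> N \<Longrightarrow> map read ts ! i = topsym (\<sigma> i)"
  using read_tape_rep by (simp add: rep_def) metis

lemma relpowp_comp:
  fixes R :: "'a \<Rightarrow> 'a \<Rightarrow> bool"
  shows "(R ^^ s) x y \<Longrightarrow> (R ^^ t) y z \<Longrightarrow> (R ^^ (s + t)) x z"
  by (auto simp: relpowp_add)

text \<open>The code may stand between arbitrary \<open>pre\<close> and \<open>post\<close>, so that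
  the induction hypotheses apply to subprograms, whose code is a segment of the same
  \<open>P\<close>.\<close>

lemma code_simulates:
  assumes "exec c \<sigma> t \<sigma>'"
  shows "ok N c \<Longrightarrow> rep N ts \<sigma> \<Longrightarrow> P = pre @ code c n @ post \<Longrightarrow> length pre = n \<Longrightarrow>
    \<exists>ts'. (step (machine N P) ^^ t) (n, ts) (n + clen c, ts') \<and> rep N ts' \<sigma>'"
  using assms
proof (induction arbitrary: ts pre n post rule: exec.induct)
  case (Skip \<sigma>)
  then show ?case by auto
next
  case (Push i a \<sigma>)
  let ?x = "(read (ts ! i), Left)"
  define ts1 where "ts1 = ts[i := act ?x (ts ! i)]"
  define ts2 where "ts2 = ts1[i := act (a, Stay) (ts1 ! i)]"
  have i: "i < length ts" and a: "a \<le> N" and tr: "tape_rep N (ts ! i) (\<sigma> i)"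
    using Push by (auto simp: rep_def)
  have "step (machine N P) (n, ts) (n + 1, map2 act ((keep (map read ts))[i := ?x]) ts)"
    using Push i by (intro machine_step) auto
  then have s1: "(step (machine N P) ^^ 1) (n, ts) (n + 1, ts1)"
    by (simp only: relpowp_1 map2_act_update i if_True ts1_def)
  obtain c h where ti: "ts ! i = (c, h)" by force
  \<comment> \<open>Between the two instructions of a push the head is on an arbitrary cell. Its
    content is treated as if it had been pushed, so that \<open>machine_step\<close> knows all
    symbols read to be in the alphabet.\<close>
  have "tape_rep N (act ?x (ts ! i)) (c (h - 1) # \<sigma> i)"
  proof -
    have "act (c (h - 1), Stay) (act ?x (ts ! i)) = act ?x (ts ! i)"
      by (auto simp: ti)
    then show ?thesis using tape_rep_push[OF tr, of "c (h - 1)"] tr by (auto simp: ti)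
  qed
  then have r1: "rep N ts1 (\<sigma>(i := c (h - 1) # \<sigma> i))"
    unfolding ts1_def by (rule rep_update[OF Push(2)])
  have "step (machine N P) (n + 1, ts1) (n + 2, map2 act ((keep (map read ts1))[i := (a, Stay)]) ts1)"
    using Push by (intro machine_step[OF _ r1]) (auto simp: nth_append)
  then have s2: "(step (machine N P) ^^ 1) (n + 1, ts1) (n + 2, ts2)"
    using i by (simp only: relpowp_1 map2_act_update if_True ts2_def ts1_def length_list_update)
  have "ts2 = ts[i := act (a, Stay) (act ?x (ts ! i))]"
    using i by (simp add: ts1_def ts2_def)
  then have "rep N ts2 (\<sigma>(i := a # \<sigma> i))"
    using rep_update[OF Push(2) tape_rep_push[OF tr a]] by simp
  with relpowp_comp[OF s1 s2] show ?case
    unfolding one_add_one clen.simps by blast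
next
  case (Pop i \<sigma>)
  let ?x = "(read (ts ! i), Right)"
  have i: "i < length ts" and tr: "tape_rep N (ts ! i) (\<sigma> i)"
    using Pop by (auto simp: rep_def)
  have "step (machine N P) (n, ts) (n + 1, map2 act ((keep (map read ts))[i := ?x]) ts)"
    using Pop i by (intro machine_step) auto
  then have "(step (machine N P) ^^ 1) (n, ts) (n + 1, ts[i := act ?x (ts ! i)])"
    by (simp only: relpowp_1 map2_act_update i if_True)
  with rep_update[OF Pop(2) tape_rep_pop[OF tr]] show ?case unfolding clen.simps by blast
next
  case (Seq c \<sigma> t \<sigma>' c' t' \<sigma>'')
  obtain ts1 where 1: "(step (machine N P) ^^ t) (n, ts) (n + clen c, ts1)" "rep N ts1 \<sigma>'"
    using Seq.IH(1)[of ts pre n "code c' (n + clen c) @ post"] Seq.prems by auto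
  obtain ts2 where 2: "(step (machine N P) ^^ t') (n + clen c, ts1) (n + clen c + clen c', ts2)" "rep N ts2 \<sigma>''"
    using Seq.IH(2)[of ts1 "pre @ code c n" "n + clen c" post] Seq.prems 1 by auto
  from relpowp_comp[OF 1(1) 2(1)] 2(2) show ?case by (auto simp: add.assoc)
next
  case (TestT \<sigma> i a c t \<sigma>' c')
  have "step (machine N P) (n, ts) (n + 1, map2 act (keep (map read ts)) ts)"
    using TestT.prems TestT.hyps rep_read[OF TestT.prems(2), of i] by (intro machine_step) auto
  then have 1: "(step (machine N P) ^^ 1) (n, ts) (n + 1, ts)"
    by (simp only: relpowp_1 map2_act_keep)
  let ?post = "(\<lambda>rs. (n + clen c + clen c' + 2, keep rs)) # code c' (n + clen c + 2) @ post"
  obtain f where f: "P = (pre @ [f]) @ code c (n + 1) @ ?post" using TestT.prems by auto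
  obtain ts2 where 2: "(step (machine N P) ^^ t) (n + 1, ts) (n + 1 + clen c, ts2)" "rep N ts2 \<sigma>'"
    using TestT.IH[OF _ _ f] TestT.prems by auto
  have "step (machine N P) (n + 1 + clen c, ts2) (n + clen c + clen c' + 2, map2 act (keep (map read ts2)) ts2)"
    using TestT.prems by (intro machine_step[OF _ 2(2)]) (auto simp: nth_append)
  then have 3: "(step (machine N P) ^^ 1) (n + 1 + clen c, ts2) (n + clen (Test i a c c'), ts2)"
    by (simp only: relpowp_1 map2_act_keep clen.simps add.assoc)
  from relpowp_comp[OF relpowp_comp[OF 1 2(1)] 3] 2(2) show ?case by (auto simp: add.commute)
next
  case (TestF \<sigma> i a c' t \<sigma>' c)
  have "step (machine N P) (n, ts) (n + clen c + 2, map2 act (keep (map read ts)) ts)"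
    using TestF.prems TestF.hyps rep_read[OF TestF.prems(2), of i] by (intro machine_step) auto
  then have 1: "(step (machine N P) ^^ 1) (n, ts) (n + clen c + 2, ts)"
    by (simp only: relpowp_1 map2_act_keep)
  obtain f g where f: "P = (pre @ f # code c (n + 1) @ [g]) @ code c' (n + clen c + 2) @ post"
    using TestF.prems by auto
  obtain ts2 where 2: "(step (machine N P) ^^ t) (n + clen c + 2, ts) (n + clen c + 2 + clen c', ts2)" "rep N ts2 \<sigma>'"
    using TestF.IH[OF _ _ f] TestF.prems by auto
  from relpowp_comp[OF 1 2(1)] 2(2) show ?case by (auto simp: algebra_simps)
next
  case (LoopF \<sigma> i c)
  have "step (machine N P) (n, ts) (n + clen c + 2, map2 act (keep (map read ts)) ts)"
    using LoopF rep_read[OF LoopF.prems(2), of i] by (intro machine_step) auto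
  then have "(step (machine N P) ^^ 1) (n, ts) (n + clen (Loop i c), ts)"
    by (simp only: relpowp_1 map2_act_keep clen.simps add.assoc)
  then show ?case using LoopF.prems by blast
next
  case (LoopT \<sigma> i c t \<sigma>' t' \<sigma>'')
  have "step (machine N P) (n, ts) (n + 1, map2 act (keep (map read ts)) ts)"
    using LoopT.prems LoopT.hyps rep_read[OF LoopT.prems(2), of i] by (intro machine_step) auto
  then have 1: "(step (machine N P) ^^ 1) (n, ts) (n + 1, ts)"
    by (simp only: relpowp_1 map2_act_keep)
  obtain f where f: "P = (pre @ [f]) @ code c (n + 1) @ (\<lambda>rs. (n, keep rs)) # post" using LoopT.prems by auto
  obtain ts2 where 2: "(step (machine N P) ^^ t) (n + 1, ts) (n + 1 + clen c, ts2)" "rep N ts2 \<sigma>'"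
    using LoopT.IH(1)[OF _ _ f] LoopT.prems by auto
  have "step (machine N P) (n + 1 + clen c, ts2) (n, map2 act (keep (map read ts2)) ts2)"
    using LoopT.prems by (intro machine_step[OF _ 2(2)]) (auto simp: nth_append)
  then have 3: "(step (machine N P) ^^ 1) (n + 1 + clen c, ts2) (n, ts2)"
    by (simp only: relpowp_1 map2_act_keep)
  obtain ts3 where 4: "(step (machine N P) ^^ t') (n, ts2) (n + clen (Loop i c), ts3)" "rep N ts3 \<sigma>''"
    using LoopT.IH(2)[OF LoopT.prems(1) 2(2) LoopT.prems(3,4)] by auto
  from relpowp_comp[OF relpowp_comp[OF relpowp_comp[OF 1 2(1)] 3] 4(1)] 4(2) show ?case
    by (auto simp: algebra_simps)
qed

definition input_store :: "bool list \<Rightarrow> store" where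
  "input_store x = (\<lambda>i. if i = 0 then map bit_sym x else [])"

lemma poly_time_computableI:
  assumes "\<And>x. \<exists>t \<le> poly p (length x). \<exists>\<sigma>. exec c (input_store x) t \<sigma> \<and> \<sigma> 0 = map bit_sym (f x)"
  shows "poly_time_computable f"
proof -
  \<comment> \<open>The bound 2 puts the symbols 1 and 2 of the input bits into the
    alphabet.\<close>
  obtain N where N: "N \<ge> 2" "ok N c" using ex_ok by blast
  define P where "P = code c 0"
  define M where "M = machine N P"
  have acts: "length (snd (g rs)) = length rs" if "g \<in> set (code c n)" for g rs n
    using that by (induction c arbitrary: n) (auto simp: keep_def)
  have "wf_tm M"
    unfolding wf_tm_def
  proof (intro conjI ballI)
    show "finite (instrs M)"
      by (simp add: M_def machine_def finite_lists_length_eq)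
    fix z assume "z \<in> instrs M"
    then obtain q rs where "z = (q, rs, (P ! q) rs)" "q < length P" "length rs = N + 1"
      by (auto simp: M_def machine_def)
    then show "case z of (q, rs, q', as) \<Rightarrow> length rs = tapes M \<and> length as = tapes M"
      using acts[of "P ! q" 0 rs] by (auto simp: M_def machine_def P_def split: prod.splits)
  qed (simp add: M_def machine_def)
  moreover have "deterministic M"
    unfolding deterministic_def M_def machine_def tm.simps by (smt (verit) Pair_inject imageE case_prod_conv surj_pair)
  moreover have "\<exists>t \<le> poly p (length x). \<exists>c. (step M ^^ t) (init M x) c \<and> halted M c \<and> has_output c (f x)" for x
  proof -
    obtain t \<sigma> where t: "t \<le> poly p (length x)" "exec c (input_store x) t \<sigma>" "\<sigma> 0 = map bit_sym (f x)"
      using assms by blast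
    define ts where "ts = input_tape x # replicate N (input_tape [])"
    have "tape_rep N (input_tape x) (map bit_sym x)" for x
      using N(1) by (auto simp: input_tape_def blank_def bit_sym_def)
    then have "rep N ts (input_store x)"
      using \<open>tape_rep N (input_tape []) (map bit_sym [])\<close>
      by (auto simp: rep_def ts_def input_store_def nth_Cons split: nat.splits)
    from code_simulates[OF t(2) N(2) this, of P "[]" 0 "[]"] obtain ts' where
      ts': "(step M ^^ t) (0, ts) (clen c, ts')" "rep N ts' \<sigma>"
      by (auto simp: P_def M_def)
    have "init M x = (0, ts)"
      by (simp add: init_def M_def machine_def ts_def)
    moreover have "halted M (clen c, ts')"
      by (auto simp: halted_def step_def M_def machine_def P_def)
    moreover have "has_output (clen c, ts') (f x)"
    proof -
      obtain u us where "ts' = u # us" using ts'(2) by (cases ts') (auto simp: rep_def)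
      moreover then have "tape_rep N u (map bit_sym (f x))" using ts'(2) t(3) by (auto simp: rep_def)
      ultimately show ?thesis
        by (cases u) (simp add: has_output_def blank_def)
    qed
    ultimately show ?thesis using t(1) ts'(1) by metis
  qed
  ultimately show ?thesis unfolding poly_time_computable_def by blast
qed

section \<open>Time bounds and programs that append to an output stack\<close>

definition run :: "com \<Rightarrow> store \<Rightarrow> store \<Rightarrow> nat \<Rightarrow> bool" where
  "run c \<sigma> \<sigma>' T \<longleftrightarrow> (\<exists>t \<le> T. exec c \<sigma> t \<sigma>')"

lemma run_mono: "run c \<sigma> \<sigma>' T \<Longrightarrow> T \<le> T' \<Longrightarrow> run c \<sigma> \<sigma>' T'"
  unfolding run_def by (meson order_trans)

lemma run_Skip: "run Skip \<sigma> \<sigma> 0"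
  and run_Push: "run (Push i a) \<sigma> (\<sigma>(i := a # \<sigma> i)) 2"
  and run_Pop: "run (Pop i) \<sigma> (\<sigma>(i := tl (\<sigma> i))) 1"
  unfolding run_def using exec.Skip exec.Push exec.Pop by blast+

lemma run_Seq: "run c \<sigma> \<sigma>' T \<Longrightarrow> run c' \<sigma>' \<sigma>'' T' \<Longrightarrow> run (c ;; c') \<sigma> \<sigma>'' (T + T')"
  unfolding run_def by (meson exec.Seq add_mono)

lemma run_Loop_end: "\<sigma> i = [] \<Longrightarrow> run (Loop i c) \<sigma> \<sigma> 1"
  unfolding run_def using exec.LoopF[of \<sigma> i c] by (auto simp: topsym_def)

lemma run_Loop_step:
  assumes "topsym (\<sigma> i) \<noteq> 0" "run c \<sigma> \<sigma>' T" "run (Loop i c) \<sigma>' \<sigma>'' T'"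
  shows "run (Loop i c) \<sigma> \<sigma>'' (T + T' + 2)"
  using assms unfolding run_def by (meson exec.LoopT add_le_mono order_refl)

fun switch :: "nat \<Rightarrow> nat \<Rightarrow> (nat \<Rightarrow> com) \<Rightarrow> com" where
  "switch i 0 f = Skip"
| "switch i (Suc n) f = Test i (Suc n) (f (Suc n)) (switch i n f)"

lemma run_switch:
  assumes "topsym (\<sigma> i) = a" "1 \<le> a" "a \<le> n" "run (f a) \<sigma> \<sigma>' T"
  shows "run (switch i n f) \<sigma> \<sigma>' (T + n + 2)"
  using assms
proof (induction n)
  case (Suc n)
  show ?case
  proof (cases "a = Suc n")
    case True
    obtain t where "t \<le> T" "exec (f a) \<sigma> t \<sigma>'" using Suc.prems unfolding run_def by blast
    then have "exec (switch i (Suc n) f) \<sigma> (t + 2) \<sigma>'"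
      using Suc.prems True unfolding switch.simps by (intro exec.TestT) auto
    with \<open>t \<le> T\<close> show ?thesis unfolding run_def by (intro exI[of _ "t + 2"]) auto
  next
    case False
    with Suc obtain t where t: "t \<le> T + n + 2" "exec (switch i n f) \<sigma> t \<sigma>'"
      unfolding run_def by auto
    then have "exec (switch i (Suc n) f) \<sigma> (t + 1) \<sigma>'"
      using Suc.prems False unfolding switch.simps by (intro exec.TestF) auto
    with t show ?thesis unfolding run_def by (intro exI[of _ "t + 1"]) auto
  qed
qed simp

text \<open>The output stack may hold anything before, and all other stacks are restored. Hence the
  words of consecutive programs concatenate; \<open>rev\<close> appears because the symbol pushed
  last is on top.\<close>

definition emits :: "nat \<Rightarrow> com \<Rightarrow> store \<Rightarrow> nat list \<Rightarrow> nat \<Rightarrow> bool" where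
  "emits r c \<sigma> w T \<longleftrightarrow> (\<forall>ys. run c (\<sigma>(r := ys)) (\<sigma>(r := rev w @ ys)) T)"

lemma emits_mono: "emits r c \<sigma> w T \<Longrightarrow> T \<le> T' \<Longrightarrow> emits r c \<sigma> w T'"
  unfolding emits_def by (meson run_mono)

lemma emits_Skip: "emits r Skip \<sigma> [] 0"
  unfolding emits_def by (simp add: run_Skip)

lemma emits_Push: "emits r (Push r a) \<sigma> [a] 2"
  unfolding emits_def
proof
  fix ys show "run (Push r a) (\<sigma>(r := ys)) (\<sigma>(r := rev [a] @ ys)) 2"
    using run_Push[of r a "\<sigma>(r := ys)"] by simp
qed

lemma emits_Seq:
  assumes "emits r c \<sigma> w T" "emits r c' \<sigma> w' T'"
  shows "emits r (c ;; c') \<sigma> (w @ w') (T + T')"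
  unfolding emits_def
proof
  fix ys
  have "run c' (\<sigma>(r := rev w @ ys)) (\<sigma>(r := rev w' @ rev w @ ys)) T'"
    using assms(2) unfolding emits_def by blast
  then show "run (c ;; c') (\<sigma>(r := ys)) (\<sigma>(r := rev (w @ w') @ ys)) (T + T')"
    using assms(1) run_Seq unfolding emits_def by fastforce
qed

text \<open>A step lengthens a stack by at most one symbol. This bounds the length of the output,
  and thus the time of the final loop that copies it.\<close>

lemma emits_length: "emits r c \<sigma> w T \<Longrightarrow> length w \<le> T"
proof -
  assume "emits r c \<sigma> w T"
  then obtain t where "t \<le> T" "exec c (\<sigma>(r := [])) t (\<sigma>(r := rev w))"
    unfolding emits_def run_def by (metis append_Nil2)
  from this(1) exec_length[OF this(2), of r] show ?thesis by simp
qed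

definition seqs :: "com list \<Rightarrow> com" where
  "seqs cs = foldr Seq cs Skip"

lemma emits_seqs:
  "(\<And>x. x \<in> set xs \<Longrightarrow> emits r (F x) \<sigma> (g x) B) \<Longrightarrow>
    emits r (seqs (map F xs)) \<sigma> (concat (map g xs)) (length xs * B)"
proof (induction xs)
  case Nil
  then show ?case by (simp add: seqs_def emits_Skip)
next
  case (Cons x xs)
  have "emits r (F x ;; seqs (map F xs)) \<sigma> (g x @ concat (map g xs)) (B + length xs * B)"
    by (intro emits_Seq Cons) auto
  then show ?case by (simp add: seqs_def)
qed

definition pushes :: "nat \<Rightarrow> nat list \<Rightarrow> com" where
  "pushes r w = seqs (map (Push r) w)"

lemma emits_pushes: "emits r (pushes r w) \<sigma> w (length w * 2)"
proof -
  have "emits r (seqs (map (Push r) w)) \<sigma> (concat (map (\<lambda>a. [a]) w)) (length w * 2)"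
    by (rule emits_seqs) (rule emits_Push)
  then show ?thesis by (simp add: pushes_def)
qed

text \<open>While the body runs, stack \<open>i\<close> holds the symbols still to come and stack \<open>j\<close> the reversed list of
  those already treated.\<close>

definition foreach :: "nat \<Rightarrow> nat \<Rightarrow> nat \<Rightarrow> (nat \<Rightarrow> com) \<Rightarrow> com" where
  "foreach i j n f =
     Loop i (switch i n (\<lambda>a. Pop i ;; f a ;; Push j a)) ;;
     Loop j (switch j n (\<lambda>a. Pop j ;; Push i a))"

text \<open>The body is described in the store of iteration \<open>k\<close>, so what it emits may
  depend on the number of symbols already moved to stack \<open>j\<close>. The second loop restores
  both stacks. Each of the two loops has an overhead of \<open>n + 7\<close> steps per
  symbol.\<close>

lemma emits_foreach:
  assumes ne: "i \<noteq> j" "i \<noteq> r" "j \<noteq> r" and \<sigma>: "\<sigma> i = xs" "\<sigma> j = []"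
    and sym: "\<And>a. a \<in> set xs \<Longrightarrow> 1 \<le> a \<and> a \<le> n"
    and body: "\<And>k. k < length xs \<Longrightarrow>
      emits r (f (xs ! k)) (\<sigma>(i := drop (Suc k) xs, j := rev (take k xs))) (w k) B"
  shows "emits r (foreach i j n f) \<sigma> (concat (map w [0..<length xs])) (length xs * (B + 2 * n + 14) + 2)"
proof -
  have fwd: "run (Loop i (switch i n (\<lambda>a. Pop i ;; f a ;; Push j a)))
      (\<sigma>(i := v, j := rev u, r := ys))
      (\<sigma>(i := [], j := rev xs, r := rev (concat (map w [length u..<length xs])) @ ys))
      (length v * (B + n + 7) + 1)" if "xs = u @ v" for u v ys
    using that
  proof (induction v arbitrary: u ys)
    case Nil
    have "(\<sigma>(i := [], j := rev u, r := ys)) i = []" using ne by simp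
    from run_Loop_end[of "\<sigma>(i := [], j := rev u, r := ys)" i, OF this] Nil show ?case by (simp del: fun_upd_apply)
  next
    case (Cons a v)
    let ?s = "\<sigma>(i := a # v, j := rev u, r := ys)"
    let ?s1 = "\<sigma>(i := v, j := rev u, r := ys)"
    let ?ys = "rev (w (length u)) @ ys"
    have a: "1 \<le> a" "a \<le> n" using sym[of a] Cons.prems by auto
    have "run (Pop i) ?s ?s1 1" using run_Pop[of i ?s] ne by (simp add: fun_upd_twist)
    moreover have "run (f a) ?s1 (\<sigma>(i := v, j := rev u, r := ?ys)) B"
      using body[of "length u"] Cons.prems by (simp add: emits_def)
    moreover have "run (Push j a) (\<sigma>(i := v, j := rev u, r := ?ys)) (\<sigma>(i := v, j := rev (u @ [a]), r := ?ys)) 2"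
      using run_Push[of j a "\<sigma>(i := v, j := rev u, r := ?ys)"] ne by (simp add: fun_upd_twist)
    ultimately have "run (Pop i ;; f a ;; Push j a) ?s (\<sigma>(i := v, j := rev (u @ [a]), r := ?ys)) (1 + (B + 2))"
      by (meson run_Seq)
    then have 1: "run (switch i n (\<lambda>a. Pop i ;; f a ;; Push j a)) ?s
        (\<sigma>(i := v, j := rev (u @ [a]), r := ?ys)) (1 + (B + 2) + n + 2)"
      using a ne by (intro run_switch[of _ _ a]) (auto simp: topsym_def)
    have e: "[length u..<length xs] = length u # [Suc (length u)..<length xs]"
      using Cons.prems by (intro upt_conv_Cons) simp
    have 2: "run (Loop i (switch i n (\<lambda>a. Pop i ;; f a ;; Push j a)))
        (\<sigma>(i := v, j := rev (u @ [a]), r := ?ys))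
        (\<sigma>(i := [], j := rev xs, r := rev (concat (map w [length u..<length xs])) @ ys))
        (length v * (B + n + 7) + 1)"
      using Cons.IH[of "u @ [a]" ?ys] unfolding e
      by (simp add: Cons.prems length_append_singleton del: fun_upd_apply upt_Suc length_append)
    have "topsym (?s i) \<noteq> 0" using a ne by (simp add: topsym_def)
    from run_Loop_step[of ?s i, OF this 1 2] show ?case by (rule run_mono) simp
  qed
  have bwd: "run (Loop j (switch j n (\<lambda>a. Pop j ;; Push i a)))
      (\<sigma>(i := v, j := u, r := ys)) (\<sigma>(i := rev u @ v, j := [], r := ys))
      (length u * (n + 7) + 1)" if "set u \<subseteq> set xs" for u v ys
    using that
  proof (induction u arbitrary: v)
    case Nil
    have "(\<sigma>(i := v, j := [], r := ys)) j = []" using ne by simp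
    from run_Loop_end[of "\<sigma>(i := v, j := [], r := ys)" j, OF this] show ?case by (simp del: fun_upd_apply)
  next
    case (Cons a u)
    let ?s = "\<sigma>(i := v, j := a # u, r := ys)"
    have a: "1 \<le> a" "a \<le> n" using sym[of a] Cons.prems by auto
    have "run (Pop j) ?s (\<sigma>(i := v, j := u, r := ys)) 1"
      using run_Pop[of j ?s] ne by (simp add: fun_upd_twist)
    moreover have "run (Push i a) (\<sigma>(i := v, j := u, r := ys)) (\<sigma>(i := a # v, j := u, r := ys)) 2"
      using run_Push[of i a "\<sigma>(i := v, j := u, r := ys)"] ne by (simp add: fun_upd_twist)
    ultimately have "run (Pop j ;; Push i a) ?s (\<sigma>(i := a # v, j := u, r := ys)) (1 + 2)"
      by (rule run_Seq)
    then have 1: "run (switch j n (\<lambda>a. Pop j ;; Push i a)) ?s (\<sigma>(i := a # v, j := u, r := ys)) (1 + 2 + n + 2)"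
      using a ne by (intro run_switch[of _ _ a]) (auto simp: topsym_def)
    have 2: "run (Loop j (switch j n (\<lambda>a. Pop j ;; Push i a))) (\<sigma>(i := a # v, j := u, r := ys))
        (\<sigma>(i := rev (a # u) @ v, j := [], r := ys)) (length u * (n + 7) + 1)"
      using Cons.IH[of "a # v"] Cons.prems by (simp del: fun_upd_apply)
    have "topsym (?s j) \<noteq> 0" using a ne by (simp add: topsym_def)
    from run_Loop_step[of ?s j, OF this 1 2] show ?case by (rule run_mono) simp
  qed
  show ?thesis
    unfolding emits_def
  proof
    fix ys
    let ?w = "concat (map w [0..<length xs])"
    have eq: "\<sigma>(i := xs, j := [], r := zs) = \<sigma>(r := zs)" for zs
      using \<sigma> by (metis fun_upd_triv)
    have "run (Loop i (switch i n (\<lambda>a. Pop i ;; f a ;; Push j a))) (\<sigma>(r := ys))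
        (\<sigma>(i := [], j := rev xs, r := rev ?w @ ys)) (length xs * (B + n + 7) + 1)"
      using fwd[of "[]" xs ys] unfolding eq rev.simps append_Nil list.size by blast
    moreover have "run (Loop j (switch j n (\<lambda>a. Pop j ;; Push i a)))
      (\<sigma>(i := [], j := rev xs, r := rev ?w @ ys)) (\<sigma>(r := rev ?w @ ys)) (length xs * (n + 7) + 1)"
      using bwd[of "rev xs" "[]" "rev ?w @ ys"] unfolding eq rev_rev_ident append_Nil2 length_rev set_rev
      by blast
    ultimately have "run (foreach i j n f) (\<sigma>(r := ys)) (\<sigma>(r := rev ?w @ ys))
        (length xs * (B + n + 7) + 1 + (length xs * (n + 7) + 1))"
      unfolding foreach_def by (rule run_Seq)
    then show "run (foreach i j n f) (\<sigma>(r := ys)) (\<sigma>(r := rev ?w @ ys)) (length xs * (B + 2 * n + 14) + 2)"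
      by (rule run_mono) (simp add: algebra_simps)
  qed
qed

section \<open>Binary representation of the generators\<close>

fun val :: "bool list \<Rightarrow> nat" where
  "val [] = 0"
| "val (b # bs) = of_bool b + 2 * val bs"

lemma val_append: "val (xs @ ys) = val xs + 2 ^ length xs * val ys"
  by (induction xs) (auto simp: algebra_simps)

lemma val_replicate_False: "val (replicate k False) = 0"
  by (induction k) auto

lemma val_replicate_True: "val (replicate k True) + 1 = 2 ^ k"
  by (induction k) auto

lemma val_binary: "val (binary n) = n"
proof (induction n rule: less_induct)
  case (less n)
  show ?case
    using less[of "n div 2"] by (subst binary.simps) (auto simp: of_bool_def)
qed

lemma last_binary: "n > 0 \<Longrightarrow> binary n \<noteq> [] \<and> last (binary n)"
proof (induction n rule: less_induct)
  case (less n)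
  show ?case
  proof (cases "n div 2 = 0")
    case True
    with less.prems have "n = 1" by auto
    then show ?thesis by (simp add: binary.simps)
  next
    case False
    with less.prems less.IH[of "n div 2"] show ?thesis
      by (subst (1 2) binary.simps) auto
  qed
qed

lemma val_pos: "bs \<noteq> [] \<Longrightarrow> last bs \<Longrightarrow> val bs > 0"
  by (induction bs) (auto split: if_splits)

text \<open>A bit list whose most significant bit is 1 is canonical. The variable parts of the
  output are arranged to end with \<open>True\<close> for this reason.\<close>

lemma binary_val: "bs \<noteq> [] \<Longrightarrow> last bs \<Longrightarrow> binary (val bs) = bs"
proof (induction bs)
  case (Cons b bs)
  show ?case
  proof (cases "bs = []")
    case True
    with Cons.prems show ?thesis by (simp add: binary.simps)
  next
    case False
    with Cons have "binary (val bs) = bs" "val bs > 0" by (auto intro: val_pos)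
    then show ?thesis by (subst binary.simps) auto
  qed
qed simp

lemma length_binary_le: "n < 2 ^ k \<Longrightarrow> length (binary n) \<le> k"
proof (induction k arbitrary: n)
  case 0
  then show ?case by (simp add: binary.simps)
next
  case (Suc k)
  show ?case using Suc.IH[of "n div 2"] Suc.prems by (subst binary.simps) auto
qed

definition pad :: "nat \<Rightarrow> nat \<Rightarrow> bool list" where
  "pad k n = binary n @ replicate (k - length (binary n)) False"

lemma val_pad: "val (pad k n) = n"
  by (simp add: pad_def val_append val_binary val_replicate_False)

lemma length_pad: "n < 2 ^ k \<Longrightarrow> length (pad k n) = k"
  using length_binary_le[of n k] by (simp add: pad_def)

text \<open>Templates for bit strings: a fixed word, a word repeated once for each preceding item,
  and a word repeated as often as a row is wide. Each can be printed by one simple loop.\<close>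

datatype piece = Const "bool list" | PerItem "bool list" | PerWidth "bool list"

fun expand :: "nat \<Rightarrow> nat \<Rightarrow> piece \<Rightarrow> bool list" where
  "expand m W (Const w) = w"
| "expand m W (PerItem w) = concat (replicate m w)"
| "expand m W (PerWidth w) = concat (replicate W w)"

definition expands :: "nat \<Rightarrow> nat \<Rightarrow> piece list \<Rightarrow> bool list" where
  "expands m W ps = concat (map (expand m W) ps)"

lemma expands_simps [simp]:
  "expands m W [] = []"
  "expands m W (p # ps) = expand m W p @ expands m W ps"
  "expands m W (ps @ qs) = expands m W ps @ expands m W qs"
  by (simp_all add: expands_def)

text \<open>Unlike \<open>delimit\<close>, this has no terminator, so it distributes over
  concatenation and repetition and can be applied piece by piece.\<close>

definition mark :: "bool list \<Rightarrow> bool list" where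
  "mark w = concat (map (\<lambda>b. [True, b]) w)"

fun mark_piece :: "piece \<Rightarrow> piece" where
  "mark_piece (Const w) = Const (mark w)"
| "mark_piece (PerItem w) = PerItem (mark w)"
| "mark_piece (PerWidth w) = PerWidth (mark w)"

definition int_pieces :: "bool \<Rightarrow> piece list \<Rightarrow> piece list" where
  "int_pieces neg ps = map mark_piece (Const [neg] # ps) @ [Const [False]]"

lemma delimit_mark: "delimit w = mark w @ [False]"
  by (induction w) (auto simp: mark_def)

lemma mark_append: "mark (v @ w) = mark v @ mark w"
  by (simp add: mark_def)

lemma expand_mark_piece: "expand m W (mark_piece p) = mark (expand m W p)"
proof -
  have "concat (replicate k (mark w)) = mark (concat (replicate k w))" for k w
    by (induction k) (auto simp: mark_def)
  then show ?thesis by (cases p) auto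
qed

lemma expands_int_pieces: "expands m W (int_pieces neg ps) = delimit (neg # expands m W ps)"
proof -
  have "expands m W (map mark_piece qs) = mark (expands m W qs)" for qs
    by (induction qs) (auto simp: expand_mark_piece mark_append, simp add: mark_def)
  then show ?thesis by (simp add: int_pieces_def delimit_mark mark_append[symmetric] expand_mark_piece del: mark_piece.simps)
qed

lemma encode_int_pos: "encode_int (int n) = delimit (False # binary n)"
  by (simp add: encode_int_def)

lemma encode_int_neg: "n > 0 \<Longrightarrow> encode_int (- int n) = delimit (True # binary n)"
  by (simp add: encode_int_def)

text \<open>Templates for the four entries when the weight is
  \<open>2 ^ (c * m) * (1 + 2 * val r)\<close> and \<open>R\<close> expands to \<open>r\<close>. The
  magnitude of the first entry is \<open>n * 2 ^ (m + 3) - 1\<close>: the borrow turns the trailing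
  zeros into ones and the lowest 1 into 0. In the other entries the summands do not overlap in
  binary, so blocks of zeros separate their bits.\<close>

definition edge_pieces :: "nat \<Rightarrow> piece list \<Rightarrow> piece list" where
  "edge_pieces c R =
     int_pieces True ([PerItem [True], Const [True, True, True], PerItem (replicate c True), Const [False]] @ R) @
     int_pieces False ([Const [False], PerItem (replicate c False), Const [True]] @ R) @
     int_pieces True ([PerItem [False], Const [False, True], PerItem [False], Const [False, False],
       PerItem (replicate c False), Const [True]] @ R) @
     int_pieces False ([Const [True], PerItem [False], Const [False],
       PerItem (replicate c False), Const [True]] @ R)"

lemma concat_replicate_replicate: "concat (replicate m (replicate c x)) = replicate (c * m) x"
  by (induction m) (auto simp: replicate_add[symmetric])

lemma concat_replicate_single: "concat (replicate m [x]) = replicate m x"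
  by (induction m) auto

lemma expands_edge_pieces:
  assumes "r = expands m W R" "r \<noteq> []" "last r"
  shows "expands m W (edge_pieces c R) = encode_mat (edge m (2 ^ (c * m) * (1 + 2 * val r)))"
proof -
  define k where "k = c * m"
  define n where "n = 2 ^ k * (1 + 2 * val r)"
  have bits: "binary (val (u @ r)) = u @ r" "val (u @ r) > 0" for u
    using assms(2,3) by (auto intro!: binary_val val_pos)
  have F: "val (replicate j False @ w) = 2 ^ j * val w" for j w
    by (simp add: val_append val_replicate_False)
  have T: "val (replicate j True @ w) + 1 = 2 ^ j * (val w + 1)" for j w
    using val_replicate_True[of j] by (simp add: val_append algebra_simps)
  let ?b1 = "replicate (m + 3 + k) True @ [False] @ r"
  let ?b2 = "(False # replicate k False @ [True]) @ r"
  let ?b3 = "(replicate (m + 1) False @ [True] @ replicate (m + 2 + k) False @ [True]) @ r"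
  let ?b4 = "([True] @ replicate (m + 1 + k) False @ [True]) @ r"
  have v1: "val ?b1 + 1 = n * 2 ^ (m + 3)"
    unfolding T n_def by (simp add: power_add algebra_simps)
  have v2: "val ?b2 = 2 * n"
    unfolding n_def using F[of k "True # r"] by simp
  have v3: "val ?b3 = 2 ^ (m + 1) + n * 2 ^ (2 * m + 4)"
  proof -
    have "val ?b3 = 2 ^ (m + 1) * (1 + 2 * (2 ^ (m + 2 + k) * (1 + 2 * val r)))"
      unfolding append_assoc F by (simp add: F)
    also have "\<dots> = 2 ^ (m + 1) + 2 ^ (m + 1 + 1 + (m + 2 + k)) * (1 + 2 * val r)"
      by (simp add: power_add distrib_left)
    also have "m + 1 + 1 + (m + 2 + k) = (2 * m + 4) + k" by simp
    also have "2 ^ (2 * m + 4 + k) * (1 + 2 * val r) = n * 2 ^ (2 * m + 4)"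
      by (simp only: n_def power_add mult_ac)
    finally show ?thesis .
  qed
  have v4: "val ?b4 = 1 + n * 2 ^ (m + 2)"
    unfolding n_def append_assoc by (simp add: F power_add algebra_simps)
  have "encode_int (edge m n $ 1 $ 1) = delimit (True # ?b1)"
  proof -
    have "int (val ?b1) + 1 = int n * 2 ^ (m + 3)"
      using arg_cong[OF v1, of int] by simp
    then have "edge m n $ 1 $ 1 = - int (val ?b1)" by (simp add: edge_def)
    then show ?thesis using encode_int_neg[of "val ?b1"] bits[of "replicate (m + 3 + k) True @ [False]"] by simp
  qed
  moreover have "encode_int (edge m n $ 1 $ 2) = delimit (False # ?b2)"
  proof -
    have "edge m n $ 1 $ 2 = int (val ?b2)" unfolding v2 by (simp add: edge_def)
    then show ?thesis using encode_int_pos[of "val ?b2"] bits(1) by metis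
  qed
  moreover have "encode_int (edge m n $ 2 $ 1) = delimit (True # ?b3)"
  proof -
    have "edge m n $ 2 $ 1 = - int (val ?b3)" unfolding v3 by (simp add: edge_def)
    then show ?thesis using encode_int_neg[of "val ?b3"] bits by metis
  qed
  moreover have "encode_int (edge m n $ 2 $ 2) = delimit (False # ?b4)"
  proof -
    have "edge m n $ 2 $ 2 = int (val ?b4)" unfolding v4 by (simp add: edge_def)
    then show ?thesis using encode_int_pos[of "val ?b4"] bits(1) by metis
  qed
  moreover have "expands m W (edge_pieces c R) =
      delimit (True # ?b1) @ delimit (False # ?b2) @ delimit (True # ?b3) @ delimit (False # ?b4)"
  proof -
    have "replicate (m + 3 + k) True = replicate m True @ [True, True, True] @ replicate k True"
      by (simp only: replicate_add numeral_3_eq_3 replicate.simps append_assoc)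
    moreover have "replicate (m + 1) False = replicate m False @ [False]"
      by (simp only: replicate_add One_nat_def replicate.simps)
    moreover have "replicate (m + 2 + k) False = replicate m False @ [False, False] @ replicate k False"
      by (simp only: replicate_add numeral_2_eq_2 replicate.simps append_assoc)
    moreover have "replicate (m + 1 + k) False = replicate m False @ [False] @ replicate k False"
      by (simp only: replicate_add One_nat_def replicate.simps append_assoc)
    ultimately show ?thesis
      by (simp only: edge_pieces_def expands_int_pieces expands_simps expand.simps concat_replicate_replicate
          concat_replicate_single assms(1) k_def append_assoc append_Cons append_Nil)
  qed
  ultimately show ?thesis by (simp only: encode_mat_def n_def k_def)
qed

section \<open>Weights of tiles\<close>

lemma digits_unique:
  fixes f g :: "nat \<Rightarrow> nat"
  assumes "\<And>p. f p < B" "\<And>p. g p < B" "(\<Sum>p<P. f p * B ^ p) = (\<Sum>p<P. g p * B ^ p)" "p < P"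
  shows "f p = g p"
  using assms
proof (induction P arbitrary: f g p)
  case (Suc P)
  have split: "(\<Sum>p<Suc P. h p * B ^ p) = h 0 + B * (\<Sum>p<P. h (Suc p) * B ^ p)" for h :: "nat \<Rightarrow> nat"
    by (subst sum.lessThan_Suc_shift) (simp add: sum_distrib_left ac_simps)
  have "f 0 + B * (\<Sum>p<P. f (Suc p) * B ^ p) = g 0 + B * (\<Sum>p<P. g (Suc p) * B ^ p)"
    using Suc.prems(3) unfolding split .
  moreover from this have "f 0 = g 0"
    using Suc.prems(1)[of 0] Suc.prems(2)[of 0] by (metis mod_mult_self2 mod_less)
  moreover have "B > 0" using Suc.prems(1)[of 0] by simp
  ultimately have "(\<Sum>p<P. f (Suc p) * B ^ p) = (\<Sum>p<P. g (Suc p) * B ^ p)" by simp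
  from Suc.IH[OF _ _ this] Suc.prems(1,2) have "f (Suc q) = g (Suc q)" if "q < P" for q
    using that by blast
  with \<open>f 0 = g 0\<close> Suc.prems(4) show ?case by (cases p) auto
qed simp

type_synonym tile = "nat \<times> nat \<times> nat \<times> nat"

fun lft :: "tile \<Rightarrow> nat" where "lft (l, t, r, d) = l"
fun tp :: "tile \<Rightarrow> nat" where "tp (l, t, r, d) = t"
fun rgt :: "tile \<Rightarrow> nat" where "rgt (l, t, r, d) = r"
fun btm :: "tile \<Rightarrow> nat" where "btm (l, t, r, d) = d"

text \<open>Odd, so that the odd factor of a weight begins with a known bit 1; at least 3, so that
  further bits remain when this bit is split off.\<close>

definition tag :: "tile \<Rightarrow> nat" where "tag \<tau> = 2 * to_nat \<tau> + 3"

lemma tag_inject [simp]: "tag \<tau> = tag \<tau>' \<longleftrightarrow> \<tau> = \<tau>'"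
  and tag_pos [simp]: "tag \<tau> > 0"
  by (simp_all add: tag_def)

text \<open>In base \<open>B\<close>, digit \<open>3 * m\<close> identifies the tile of item \<open>m\<close>, digit \<open>3 * m + 1\<close> holds the colour
  between the items \<open>m - 1\<close> and \<open>m\<close>, and digit \<open>3 * m + 5\<close> the letter that item \<open>m\<close> receives from item
  \<open>m - W\<close>. The flag \<open>out\<close> selects whether a tile contributes what it produces or what it consumes; the
  value 0 stands for no colour or letter.\<close>

definition weight :: "nat \<Rightarrow> nat \<Rightarrow> bool \<Rightarrow> nat \<Rightarrow> tile \<Rightarrow> nat" where
  "weight B W out m \<tau> = B ^ (3 * m) * (tag \<tau> +
     (if out then rgt \<tau> * B ^ 4 + btm \<tau> * B ^ (5 + 3 * W) else lft \<tau> * B + tp \<tau> * B ^ 5))"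

text \<open>Residues modulo 3 separate tags, colours and letters. A letter is consumed at
  \<open>3 * m + 5\<close>, not at \<open>3 * m + 2\<close>: then the tag and the colour that a tile
  produces lie in the five lowest digits, and exactly \<open>3 * W\<close> zero digits separate them
  from the letter it produces, which is what a piece repeated \<open>W\<close> times can
  print.\<close>

definition digit :: "nat \<Rightarrow> bool \<Rightarrow> nat \<Rightarrow> tile \<Rightarrow> nat \<Rightarrow> nat" where
  "digit W out m \<tau> p = (if p = 3 * m then tag \<tau> else 0) +
     ((if out \<and> p = 3 * m + 4 then rgt \<tau> else 0) + (if out \<and> p = 3 * m + 5 + 3 * W then btm \<tau> else 0) +
     ((if \<not> out \<and> p = 3 * m + 1 then lft \<tau> else 0) + (if \<not> out \<and> p = 3 * m + 5 then tp \<tau> else 0)))"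

lemma weight_eq_digits:
  assumes "3 * m + 5 + 3 * W < P"
  shows "weight B W out m \<tau> = (\<Sum>p<P. digit W out m \<tau> p * B ^ p)"
proof -
  have d': "(\<Sum>p<P. (if p = k then x else 0) * B ^ p) = x * B ^ k" if "k < P" for k x
    using that by (simp add: if_distrib if_distribR sum.delta cong: if_cong)
  show ?thesis
    unfolding weight_def digit_def distrib_right sum.distrib
    using assms by (cases out; simp add: d'; simp add: power_add algebra_simps)
qed

definition path_digit :: "nat \<Rightarrow> nat \<Rightarrow> nat \<Rightarrow> (nat \<Rightarrow> bool) \<Rightarrow> (nat \<Rightarrow> tile) \<Rightarrow> nat \<Rightarrow> nat" where
  "path_digit W s e out \<tau> p = (\<Sum>m\<in>{s..<e}. digit W (out m) m (\<tau> m) p)"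

lemma sum_weight_eq_digits:
  assumes "3 * e + 5 + 3 * W \<le> P"
  shows "(\<Sum>m\<in>{s..<e}. weight B W (out m) m (\<tau> m)) = (\<Sum>p<P. path_digit W s e out \<tau> p * B ^ p)"
proof -
  have "(\<Sum>m\<in>{s..<e}. weight B W (out m) m (\<tau> m)) = (\<Sum>m\<in>{s..<e}. \<Sum>p<P. digit W (out m) m (\<tau> m) p * B ^ p)"
    using assms by (intro sum.cong weight_eq_digits) auto
  also have "\<dots> = (\<Sum>p<P. \<Sum>m\<in>{s..<e}. digit W (out m) m (\<tau> m) p * B ^ p)"
    by (rule sum.swap)
  finally show ?thesis by (simp add: path_digit_def sum_distrib_right)
qed

lemma sum_cond_delta:
  "(\<Sum>m\<in>{s..<e}. if b m \<and> (q::nat) = m + k then f m else 0) =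
    (if k \<le> q \<and> s \<le> q - k \<and> q - k < e \<and> b (q - k) then f (q - k) else (0::nat))"
proof (cases "k \<le> q")
  case True
  then have "(\<Sum>m\<in>{s..<e}. if b m \<and> q = m + k then f m else 0) =
      (\<Sum>m\<in>{s..<e}. if m = q - k then (if b m then f m else 0) else 0)"
    by (intro sum.cong) auto
  then show ?thesis using True by (simp add: sum.delta)
next
  case False
  then show ?thesis by (auto intro!: sum.neutral)
qed

lemma path_digit_0:
  "path_digit W s e out \<tau> (3 * q) = (if s \<le> q \<and> q < e then tag (\<tau> q) else 0)"
proof -
  have "path_digit W s e out \<tau> (3 * q) = (\<Sum>m\<in>{s..<e}. if True \<and> q = m + 0 then tag (\<tau> m) else 0)"
    unfolding path_digit_def digit_def by (intro sum.cong) (auto; presburger)+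
  then show ?thesis by (simp only: sum_cond_delta) simp
qed

text \<open>Only item \<open>q - 1\<close>, by producing, and item \<open>q\<close>, by consuming,
  can reach this digit.\<close>

lemma path_digit_1:
  "path_digit W s e out \<tau> (3 * q + 1) =
     (if 1 \<le> q \<and> s \<le> q - 1 \<and> q - 1 < e \<and> out (q - 1) then rgt (\<tau> (q - 1)) else 0) +
     (if s \<le> q \<and> q < e \<and> \<not> out q then lft (\<tau> q) else 0)"
proof -
  have "path_digit W s e out \<tau> (3 * q + 1) =
     (\<Sum>m\<in>{s..<e}. if out m \<and> q = m + 1 then rgt (\<tau> m) else 0) +
     (\<Sum>m\<in>{s..<e}. if \<not> out m \<and> q = m + 0 then lft (\<tau> m) else 0)"
    unfolding path_digit_def digit_def sum.distrib[symmetric] by (intro sum.cong) (auto; presburger)+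
  then show ?thesis by (simp only: sum_cond_delta) simp
qed

text \<open>Item \<open>m\<close> consumes at \<open>3 * (m + 1) + 2\<close> and produces at
  \<open>3 * (m + W + 1) + 2\<close>, hence the offsets 1 and \<open>W + 1\<close>.\<close>

lemma path_digit_2:
  "path_digit W s e out \<tau> (3 * q + 2) =
     (if W + 1 \<le> q \<and> s \<le> q - (W + 1) \<and> q - (W + 1) < e \<and> out (q - (W + 1)) then btm (\<tau> (q - (W + 1))) else 0) +
     (if 1 \<le> q \<and> s \<le> q - 1 \<and> q - 1 < e \<and> \<not> out (q - 1) then tp (\<tau> (q - 1)) else 0)"
proof -
  have "path_digit W s e out \<tau> (3 * q + 2) =
     (\<Sum>m\<in>{s..<e}. if out m \<and> q = m + (W + 1) then btm (\<tau> m) else 0) +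
     (\<Sum>m\<in>{s..<e}. if \<not> out m \<and> q = m + 1 then tp (\<tau> m) else 0)"
    unfolding path_digit_def digit_def sum.distrib[symmetric] by (intro sum.cong) (auto; presburger)+
  then show ?thesis by (simp only: sum_cond_delta)
qed

lemma mod3_cases:
  fixes p :: nat
  obtains q where "p = 3 * q" | q where "p = 3 * q + 1" | q where "p = 3 * q + 2"
proof -
  have "p = 3 * (p div 3) \<or> p = 3 * (p div 3) + 1 \<or> p = 3 * (p div 3) + 2" by presburger
  with that show ?thesis by blast
qed

text \<open>By \<open>lft_0\<close> and \<open>rgt_0\<close> a path that starts or ends inside the
  list leaves a nonzero colour at its end. By \<open>btm_0\<close> no letter leaves the list at the
  bottom. The factors 2 in \<open>bound\<close> exclude carries in digits with two
  contributions.\<close>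

locale tile_system =
  fixes K W B :: nat and Ts :: "nat \<Rightarrow> tile set"
  assumes K: "K \<ge> 2" and B: "B > 0"
    and lft_0: "m < K \<Longrightarrow> \<tau> \<in> Ts m \<Longrightarrow> lft \<tau> = 0 \<longleftrightarrow> m = 0"
    and rgt_0: "m < K \<Longrightarrow> \<tau> \<in> Ts m \<Longrightarrow> rgt \<tau> = 0 \<longleftrightarrow> m = K - 1"
    and btm_0: "m < K \<Longrightarrow> K \<le> m + W \<Longrightarrow> \<tau> \<in> Ts m \<Longrightarrow> btm \<tau> = 0"
    and bound: "m < K \<Longrightarrow> \<tau> \<in> Ts m \<Longrightarrow>
      tag \<tau> < B \<and> 2 * lft \<tau> < B \<and> 2 * tp \<tau> < B \<and> 2 * rgt \<tau> < B \<and> 2 * btm \<tau> < B"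
begin

definition tiling :: "(nat \<Rightarrow> tile) \<Rightarrow> bool" where
  "tiling \<tau> \<longleftrightarrow> (\<forall>m < K. \<tau> m \<in> Ts m) \<and> (\<forall>m. Suc m < K \<longrightarrow> rgt (\<tau> m) = lft (\<tau> (Suc m))) \<and>
     (\<forall>m < K. tp (\<tau> m) = (if W \<le> m then btm (\<tau> (m - W)) else 0))"

definition edges :: "(nat \<times> nat) set" where
  "edges = {(m, weight B W out m \<tau>) | m out \<tau>. m < K \<and> \<tau> \<in> Ts m}"

lemma path_digit_bound:
  assumes "e \<le> K" "\<And>m. s \<le> m \<Longrightarrow> m < e \<Longrightarrow> \<tau> m \<in> Ts m"
  shows "path_digit W s e out \<tau> p < B"
proof -
  have b: "tag (\<tau> m) < B" "2 * lft (\<tau> m) < B" "2 * tp (\<tau> m) < B" "2 * rgt (\<tau> m) < B" "2 * btm (\<tau> m) < B"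
    if "s \<le> m" "m < e" for m
    using bound[of m "\<tau> m"] assms that by auto
  have add: "x + y < B" if "2 * x < B" "2 * y < B" for x y using that by linarith
  show ?thesis
  proof (cases p rule: mod3_cases)
    case (1 q)
    show ?thesis unfolding 1 path_digit_0 using b(1) B by auto
  next
    case (2 q)
    show ?thesis unfolding 2 path_digit_1 using b B by (intro add) auto
  next
    case (3 q)
    show ?thesis unfolding 3 path_digit_2 using b B by (intro add) auto
  qed
qed

lemma paths_digits_eq:
  assumes "e \<le> K" "\<And>m. s \<le> m \<Longrightarrow> m < e \<Longrightarrow> \<tau> m \<in> Ts m"
    and "e' \<le> K" "\<And>m. s \<le> m \<Longrightarrow> m < e' \<Longrightarrow> \<tau>' m \<in> Ts m"
    and eq: "(\<Sum>m\<in>{s..<e}. weight B W (out m) m (\<tau> m)) = (\<Sum>m\<in>{s..<e'}. weight B W (out' m) m (\<tau>' m))"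
  shows "path_digit W s e out \<tau> p = path_digit W s e' out' \<tau>' p"
proof -
  define P where "P = 3 * e + 3 * e' + 5 + 3 * W + p + 1"
  have "(\<Sum>p<P. path_digit W s e out \<tau> p * B ^ p) = (\<Sum>p<P. path_digit W s e' out' \<tau>' p * B ^ p)"
    using eq sum_weight_eq_digits[of e W P B out \<tau> s] sum_weight_eq_digits[of e' W P B out' \<tau>' s]
    by (simp add: P_def)
  from digits_unique[OF _ _ this, of p] path_digit_bound assms(1-4) show ?thesis
    by (auto simp: P_def)
qed

text \<open>A comparison of paths with one item: different flags would mean that the tile has no
  colour on either side, which \<open>K \<ge> 2\<close> excludes.\<close>

lemma weight_inject:
  assumes "m < K" "\<tau> \<in> Ts m" "\<tau>' \<in> Ts m" "weight B W out m \<tau> = weight B W out' m \<tau>'"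
  shows "\<tau> = \<tau>' \<and> out = out'"
proof -
  have eq: "path_digit W m (Suc m) (\<lambda>_. out) (\<lambda>_. \<tau>) p = path_digit W m (Suc m) (\<lambda>_. out') (\<lambda>_. \<tau>') p" for p
    using assms by (intro paths_digits_eq) (auto simp: less_Suc_eq_le)
  have "\<tau> = \<tau>'" using eq[of "3 * m"] unfolding path_digit_0 by simp
  moreover have "out = out'"
  proof (rule ccontr)
    assume "out \<noteq> out'"
    then have "lft \<tau> = 0"
      using eq[of "3 * m + 1"] unfolding path_digit_1 \<open>\<tau> = \<tau>'\<close> by (auto split: if_splits)
    moreover have "rgt \<tau> = 0"
      using \<open>out \<noteq> out'\<close> eq[of "3 * (m + 1) + 1"] unfolding path_digit_1 \<open>\<tau> = \<tau>'\<close>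
      by (auto split: if_splits)
    ultimately show False using lft_0[of m \<tau>] rgt_0[of m \<tau>] assms K by auto
  qed
  ultimately show ?thesis by simp
qed

lemma paths_eq_or_tiling:
  assumes se: "s < e" "e \<le> K" "s < e'" "e' \<le> K"
    and T: "\<And>m. s \<le> m \<Longrightarrow> m < e \<Longrightarrow> \<tau> m \<in> Ts m" "\<And>m. s \<le> m \<Longrightarrow> m < e' \<Longrightarrow> \<tau>' m \<in> Ts m"
    and eq: "(\<Sum>m\<in>{s..<e}. weight B W (out m) m (\<tau> m)) = (\<Sum>m\<in>{s..<e'}. weight B W (out' m) m (\<tau>' m))"
    and no: "\<nexists>\<tau>. tiling \<tau>"
  shows "e = e' \<and> (\<forall>m. s \<le> m \<longrightarrow> m < e \<longrightarrow> \<tau> m = \<tau>' m \<and> out m = out' m)"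
proof -
  have D: "path_digit W s e out \<tau> p = path_digit W s e' out' \<tau>' p" for p
    using assms by (intro paths_digits_eq) auto
  have tags: "(if s \<le> q \<and> q < e then tag (\<tau> q) else 0) = (if s \<le> q \<and> q < e' then tag (\<tau>' q) else 0)" for q
    using D[of "3 * q"] unfolding path_digit_0 .
  have "e = e'"
    using tags[of e] tags[of e'] se tag_pos[of "\<tau> e'"] tag_pos[of "\<tau>' e"]
    by (cases e e' rule: linorder_cases) auto
  have \<tau>: "\<tau>' m = \<tau> m" if "s \<le> m" "m < e" for m
    using tags[of m] that \<open>e = e'\<close> by simp
  \<comment> \<open>Stated for two flag functions on the same tiles, since either of the two paths
    can be the producing one.\<close>
  have main: False
    if j: "s \<le> j" "j < e" "o1 j" "\<not> o2 j"
      and D: "\<And>p. path_digit W s e o1 \<tau> p = path_digit W s e o2 \<tau> p" for j o1 o2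
  proof -
    note h = D[of "3 * _ + 1", unfolded path_digit_1]
    note v = D[of "3 * _ + 2", unfolded path_digit_2]
    \<comment> \<open>At the digit between \<open>q\<close> and \<open>Suc q\<close> the first path
      has at least the nonzero \<open>rgt (\<tau> q)\<close>, whereas item \<open>q\<close> gives
      the second path nothing. Checking the flags at \<open>Suc q\<close> leaves only producing
      against consuming.\<close>
    have up: "o1 (Suc q) \<and> \<not> o2 (Suc q)" if "s \<le> q" "Suc q < e" "o1 q" "\<not> o2 q" for q
      using h[of "Suc q"] that rgt_0[of q "\<tau> q"] T(1)[of q] se by (auto split: if_splits)
    have down: "o1 q \<and> \<not> o2 q" if "s \<le> q" "Suc q < e" "o1 (Suc q)" "\<not> o2 (Suc q)" for q
      using h[of "Suc q"] that lft_0[of "Suc q" "\<tau> (Suc q)"] T(1)[of "Suc q"] se by (auto split: if_splits)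
    have up': "o1 m \<and> \<not> o2 m" if "j \<le> m" "m < e" for m
      using that(1,2) by (induction m rule: dec_induct) (use j up in auto)
    have down': "o1 m \<and> \<not> o2 m" if "m \<le> j" "s \<le> m" for m
      using that(1,2) by (induction m rule: inc_induct) (use j down in auto)
    have all: "o1 m \<and> \<not> o2 m" if "s \<le> m" "m < e" for m
      using up'[of m] down'[of m] that by linarith
    \<comment> \<open>At the digit to the left of item \<open>s\<close> the producing path has 0 and
      the consuming path has \<open>lft (\<tau> s)\<close>.\<close>
    have "s = 0"
      using h[of s] all[of s] se lft_0[of s "\<tau> s"] T(1)[of s] by (auto split: if_splits)
    have "e = K"
    proof -
      have "rgt (\<tau> (e - 1)) = 0"
        using h[of e] all[of "e - 1"] se by (auto split: if_splits)
      moreover have "e - 1 < K" "s \<le> e - 1" "e - 1 < e" using se by linarith+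
      ultimately have "e - 1 = K - 1" using rgt_0[of "e - 1" "\<tau> (e - 1)"] T(1)[of "e - 1"] by blast
      then show ?thesis using se by linarith
    qed
    have "tiling \<tau>"
      unfolding tiling_def
    proof (intro conjI allI impI)
      fix m assume "m < K"
      then show "\<tau> m \<in> Ts m" using T(1)[of m] \<open>s = 0\<close> \<open>e = K\<close> by simp
      show "tp (\<tau> m) = (if W \<le> m then btm (\<tau> (m - W)) else 0)"
        using v[of "Suc m"] all[of m] all[of "m - W"] \<open>m < K\<close> \<open>s = 0\<close> \<open>e = K\<close> by (auto split: if_splits)
    next
      fix m assume "Suc m < K"
      then show "rgt (\<tau> m) = lft (\<tau> (Suc m))"
        using h[of "Suc m"] all[of m] all[of "Suc m"] \<open>s = 0\<close> \<open>e = K\<close> by auto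
    qed
    with no show False by blast
  qed
  have D': "path_digit W s e out' \<tau>' p = path_digit W s e out' \<tau> p" for p
    unfolding path_digit_def using \<tau> by (intro sum.cong) auto
  have "out m = out' m" if "s \<le> m" "m < e" for m
    using main[of m out out'] main[of m out' out] that D D' \<open>e = e'\<close> by metis
  with \<tau> \<open>e = e'\<close> show ?thesis by metis
qed

lemma chain_edges:
  assumes "set (chain s ns) \<subseteq> edges"
  obtains out \<tau> where "\<And>m. s \<le> m \<Longrightarrow> m < s + length ns \<Longrightarrow> m < K \<and> \<tau> m \<in> Ts m \<and> ns ! (m - s) = weight B W (out m) m (\<tau> m)"
    "sum_list ns = (\<Sum>m\<in>{s..<s + length ns}. weight B W (out m) m (\<tau> m))"
proof -
  have nth: "(s + j, ns ! j) \<in> set (chain s ns)" if "j < length ns" for j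
    using that
  proof (induction ns arbitrary: s j)
    case (Cons n ns)
    then show ?case using Cons.IH[of "j - 1" "Suc s"] by (cases j) auto
  qed simp
  have "\<exists>out \<tau>. m < K \<and> \<tau> \<in> Ts m \<and> ns ! (m - s) = weight B W out m \<tau>" if "s \<le> m" "m < s + length ns" for m
    using nth[of "m - s"] assms that by (fastforce simp: edges_def)
  then obtain out \<tau> where *: "\<And>m. s \<le> m \<Longrightarrow> m < s + length ns \<Longrightarrow> m < K \<and> \<tau> m \<in> Ts m \<and> ns ! (m - s) = weight B W (out m) m (\<tau> m)"
    by metis
  have "sum_list ns = (\<Sum>j<length ns. ns ! j)" by (simp add: sum_list_sum_nth atLeast0LessThan)
  also have "\<dots> = (\<Sum>m\<in>{s..<s + length ns}. ns ! (m - s))"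
    by (rule sum.reindex_bij_witness[of _ "\<lambda>m. m - s" "\<lambda>j. j + s"]) auto
  also have "\<dots> = (\<Sum>m\<in>{s..<s + length ns}. weight B W (out m) m (\<tau> m))"
    using * by (intro sum.cong) auto
  finally show ?thesis using that * by blast
qed

lemma chain_map_upt: "chain s (map f [s..<e]) = map (\<lambda>m. (m, f m)) [s..<e]"
proof (induction "e - s" arbitrary: s)
  case (Suc d)
  then have "[s..<e] = s # [Suc s..<e]" by (intro upt_conv_Cons) auto
  with Suc show ?case by simp
qed simp

lemma unambiguous_edges: "unambiguous edges" if no: "\<nexists>\<tau>. tiling \<tau>"
  unfolding unambiguous_def
proof (intro allI impI)
  fix s ns ns'
  assume ne: "ns \<noteq> []" "ns' \<noteq> []" and E: "set (chain s ns) \<subseteq> edges" "set (chain s ns') \<subseteq> edges"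
    and eq: "sum_list ns = sum_list ns'"
  let ?e = "s + length ns" and ?e' = "s + length ns'"
  obtain out \<tau> where 1: "\<And>m. s \<le> m \<Longrightarrow> m < ?e \<Longrightarrow> m < K \<and> \<tau> m \<in> Ts m \<and> ns ! (m - s) = weight B W (out m) m (\<tau> m)"
    "sum_list ns = (\<Sum>m\<in>{s..<?e}. weight B W (out m) m (\<tau> m))"
    using chain_edges[OF E(1)] by blast
  obtain out' \<tau>' where 2: "\<And>m. s \<le> m \<Longrightarrow> m < ?e' \<Longrightarrow> m < K \<and> \<tau>' m \<in> Ts m \<and> ns' ! (m - s) = weight B W (out' m) m (\<tau>' m)"
    "sum_list ns' = (\<Sum>m\<in>{s..<?e'}. weight B W (out' m) m (\<tau>' m))"
    using chain_edges[OF E(2)] by blast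
  have lt: "s < ?e" "s < ?e'" using ne by auto
  have "s \<le> ?e - 1" "?e - 1 < ?e" "s \<le> ?e' - 1" "?e' - 1 < ?e'" using lt by linarith+
  then have "?e - 1 < K" "?e' - 1 < K" using 1(1) 2(1) by blast+
  then have le: "?e \<le> K" "?e' \<le> K" by linarith+
  have same: "?e = ?e' \<and> (\<forall>m. s \<le> m \<longrightarrow> m < ?e \<longrightarrow> \<tau> m = \<tau>' m \<and> out m = out' m)"
    using 1 2 eq by (intro paths_eq_or_tiling[OF lt(1) le(1) lt(2) le(2) _ _ _ no]) auto
  then have "length ns = length ns'" by simp
  moreover have "ns ! j = ns' ! j" if "j < length ns" for j
    using 1(1)[of "s + j"] 2(1)[of "s + j"] that same by auto
  ultimately show "ns = ns'" by (metis nth_equalityI)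
qed

text \<open>Every colour or letter is produced and consumed at the same digit. At the borders, the
  first \<open>lft\<close>, the last \<open>rgt\<close>, the \<open>tp\<close> of the first
  \<open>W\<close> items and the \<open>btm\<close> of the last \<open>W\<close> items are 0, so
  nothing is left over.\<close>

lemma tiling_sums:
  assumes "tiling \<tau>"
  shows "(\<Sum>m\<in>{0..<K}. weight B W True m (\<tau> m)) = (\<Sum>m\<in>{0..<K}. weight B W False m (\<tau> m))"
proof -
  note T = assms[unfolded tiling_def]
  have "path_digit W 0 K (\<lambda>_. True) \<tau> p = path_digit W 0 K (\<lambda>_. False) \<tau> p" for p
  proof (cases p rule: mod3_cases)
    case (1 q)
    show ?thesis unfolding 1 path_digit_0 ..
  next
    case (2 q)
    show ?thesis
    proof (cases q)
      case 0
      then show ?thesis unfolding 2 path_digit_1 using T lft_0[of 0 "\<tau> 0"] K by auto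
    next
      case (Suc q')
      show ?thesis
      proof (cases "Suc q' = K")
        case True
        then show ?thesis unfolding 2 path_digit_1 Suc using T rgt_0[of q' "\<tau> q'"] by auto
      next
        case False
        then show ?thesis unfolding 2 path_digit_1 Suc using T by auto
      qed
    qed
  next
    case (3 q)
    show ?thesis
    proof (cases "1 \<le> q \<and> q - 1 < K")
      case True
      then have "W + 1 \<le> q \<longleftrightarrow> W \<le> q - 1" "q - (W + 1) = q - 1 - W" by auto
      then show ?thesis unfolding 3 path_digit_2 using T True by auto
    next
      case False
      then show ?thesis unfolding 3 path_digit_2 using T btm_0[of "q - (W + 1)" "\<tau> (q - (W + 1))"] by auto
    qed
  qed
  then show ?thesis
    by (simp only: sum_weight_eq_digits[OF order_refl, where out = "\<lambda>_. True"]
        sum_weight_eq_digits[OF order_refl, where out = "\<lambda>_. False"])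
qed

lemma weight_pos: "weight B W out m \<tau> > 0"
  using B by (simp add: weight_def)

lemma ambiguous_edges:
  assumes "tiling \<tau>"
  shows "\<not> free_over (case_prod edge ` edges)"
proof (rule ambiguous_imp_not_free)
  let ?f = "\<lambda>out m. weight B W out m (\<tau> m)"
  have T: "\<tau> m \<in> Ts m" if "m < K" for m using assms that by (simp add: tiling_def)
  show "map (?f True) [0..<K] \<noteq> []" using K by simp
  show "set (chain 0 (map (?f True) [0..<K])) \<subseteq> edges" "set (chain 0 (map (?f False) [0..<K])) \<subseteq> edges"
    unfolding chain_map_upt edges_def using T by fastforce+
  show "sum_list (map (?f True) [0..<K]) = sum_list (map (?f False) [0..<K])"
    using tiling_sums[OF assms] by (simp add: sum_set_upt_conv_sum_list_nat[symmetric] atLeast0LessThan)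
  show "map (?f True) [0..<K] \<noteq> map (?f False) [0..<K]"
  proof
    assume "map (?f True) [0..<K] = map (?f False) [0..<K]"
    then have "?f True 0 = ?f False 0" using K by (auto simp: map_eq_conv)
    with weight_inject[of 0 "\<tau> 0" "\<tau> 0" True False] T[of 0] K show False by auto
  qed
  show "snd e > 0" if "e \<in> edges" for e using that weight_pos by (auto simp: edges_def)
qed simp

lemma not_free_iff_tiling: "\<not> free_over (case_prod edge ` edges) \<longleftrightarrow> (\<exists>\<tau>. tiling \<tau>)"
proof -
  have "snd e > 0" if "e \<in> edges" for e using that weight_pos by (auto simp: edges_def)
  then show ?thesis using ambiguous_edges unambiguous_imp_free[OF unambiguous_edges] by blast
qed

end

section \<open>Computations as tilings\<close>

instance dir :: countable
  by countable_datatype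

type_synonym instr = "nat \<times> nat list \<times> nat \<times> (nat \<times> dir) list"

fun src :: "instr \<Rightarrow> nat" where "src (q, rs, q', as) = q"
fun rds :: "instr \<Rightarrow> nat list" where "rds (q, rs, q', as) = rs"
fun tgt :: "instr \<Rightarrow> nat" where "tgt (q, rs, q', as) = q'"
fun acs :: "instr \<Rightarrow> (nat \<times> dir) list" where "acs (q, rs, q', as) = as"

text \<open>A \<open>Cell\<close> holds the head mark and one symbol for each tape. The colours
  \<open>I0\<close> and \<open>I1\<close> run through the initial row before and after the head
  column: tiles depend only on the symbol of an item, so a colour has to tell the first input cell,
  which gets the mark, from the later ones.\<close>

datatype letter = Hash | Cell bool "nat list"
datatype color = I0 | I1 | Run instr "nat list" | Fin

instance letter :: countable by countable_datatype
instance color :: countable by countable_datatype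

text \<open>Here \<open>l\<close> and \<open>r\<close> are the symbols carried across the left and
  right border of a cell, \<open>x\<close> is its old and \<open>b\<close> its new content. If a
  head moves right, its tape moves left past it: the cell gives \<open>x\<close> away at its left
  border and receives \<open>r\<close>.\<close>

fun shift :: "dir \<Rightarrow> nat \<Rightarrow> nat \<Rightarrow> nat \<Rightarrow> nat \<Rightarrow> bool" where
  "shift Right l x r b \<longleftrightarrow> l = x \<and> b = r"
| "shift Left l x r b \<longleftrightarrow> r = x \<and> b = l"
| "shift Stay l x r b \<longleftrightarrow> b = x"

definition view :: "int \<Rightarrow> tape \<Rightarrow> nat" where
  "view p t = fst t (snd t + p)"

text \<open>The tape after writing but before moving; by \<open>view_act\<close> the move is then a
  mere displacement.\<close>

definition written :: "nat \<times> dir \<Rightarrow> int \<Rightarrow> tape \<Rightarrow> nat" where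
  "written a p t = (if p = 0 then fst a else view p t)"

lemma view_act: "view p (act a t) = written a (p + displacement (snd a)) t"
  by (cases a; cases t) (auto simp: view_def written_def algebra_simps)

lemma read_view: "read t = view 0 t"
  by (cases t) (simp add: view_def)

type_synonym ttile = "color option \<times> letter option \<times> color option \<times> letter option"

locale simulation =
  fixes M :: tm and S :: nat
  assumes wf: "wf_tm M" and S: "S \<ge> 2"
    and bound: "i \<in> instrs M \<Longrightarrow> set (rds i) \<subseteq> {..S} \<and> fst ` set (acs i) \<subseteq> {..S}"
begin

definition words :: "nat list set" where
  "words = {xs. set xs \<subseteq> {..S} \<and> length xs = tapes M}"

definition letters :: "letter set" where
  "letters = insert Hash (case_prod Cell ` (UNIV \<times> words))"

definition colors :: "color set" where
  "colors = {I0, I1, Fin} \<union> case_prod Run ` (instrs M \<times> words)"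

lemma finite_words: "finite words"
  unfolding words_def by (rule finite_lists_length_eq) simp

lemma finite_letters: "finite letters" and finite_colors: "finite colors"
  using wf finite_words by (auto simp: letters_def colors_def wf_tm_def)

text \<open>Rows follow each other in one list, so the last colour of a row is the first colour of
  the next. This passes on the state.\<close>

definition row_state :: "color \<Rightarrow> nat \<Rightarrow> bool" where
  "row_state l q \<longleftrightarrow> (l = I1 \<and> q = start M) \<or> (\<exists>i \<in> instrs M. \<exists>ys \<in> words. l = Run i ys \<and> q = tgt i)"

text \<open>A row lists the tape cells from left to right, as seen from the heads, after a leading \<^const>\<open>Hash\<close>.
  Instead of moving the heads, a step shifts every tape. The colour passed along a row holds the
  instruction and, for each tape, the symbol that is shifted from one cell into the next.\<close>

definition hash_tile :: "color \<Rightarrow> color \<Rightarrow> bool" where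
  "hash_tile l r \<longleftrightarrow> (\<exists>q. row_state l q \<and> (r = Fin \<and> q = accept M \<or>
     (\<exists>i \<in> instrs M. \<exists>ys \<in> words. src i = q \<and> r = Run i ys)))"

definition overwrite :: "instr \<Rightarrow> bool \<Rightarrow> nat list \<Rightarrow> nat list" where
  "overwrite i hm xs = (if hm then map fst (acs i) else xs)"

definition cell_tile :: "color \<Rightarrow> letter \<Rightarrow> color \<Rightarrow> letter \<Rightarrow> bool" where
  "cell_tile l t r d \<longleftrightarrow> (\<exists>i \<in> instrs M. \<exists>ls \<in> words. \<exists>rs \<in> words. \<exists>xs \<in> words. \<exists>bs \<in> words. \<exists>hm.
     l = Run i ls \<and> r = Run i rs \<and> t = Cell hm xs \<and> d = Cell hm bs \<and> (hm \<longrightarrow> xs = rds i) \<and>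
     (\<forall>j < tapes M. shift (snd (acs i ! j)) (ls ! j) (overwrite i hm xs ! j) (rs ! j) (bs ! j)))"

text \<open>Under \<open>Fin\<close> a row is merely copied, so a computation that accepts early can
  be padded to the fixed number of rows.\<close>

definition step_tile :: "color \<Rightarrow> letter \<Rightarrow> color \<Rightarrow> letter \<Rightarrow> bool" where
  "step_tile l t r d \<longleftrightarrow> (l = Fin \<and> r = Fin \<and> t = d \<and> t \<in> letters) \<or>
     (t = Hash \<and> d = Hash \<and> hash_tile l r) \<or> cell_tile l t r d"

lemma step_tile_mem: "step_tile l t r d \<Longrightarrow> l \<in> colors \<and> t \<in> letters \<and> r \<in> colors \<and> d \<in> letters"
  unfolding step_tile_def hash_tile_def row_state_def cell_tile_def letters_def colors_def by auto

definition cell0 :: "bool \<Rightarrow> nat \<Rightarrow> letter" where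
  "cell0 hm a = Cell hm (a # replicate (tapes M - 1) 0)"

text \<open>Item symbols 1 and 2 are the input bits, 3 is a blank to the right of the input, 4 a blank to its
  left, 5 the first column of the initial row; 6 and 9 open and close the whole sequence of items,
  7 stands for the rows of the computation, and 8 for the last row.\<close>

definition tiles :: "nat \<Rightarrow> ttile set" where
  "tiles a =
     (if a = 6 then {(None, None, Some I0, None)}
      else if a = 5 then {(Some I0, None, Some I0, Some Hash)}
      else if a = 4 then {(Some I0, None, Some I0, Some (cell0 False 0))}
      else if a \<in> {1, 2, 3} then
        {(Some I0, None, Some I1, Some (cell0 True (a mod 3))), (Some I1, None, Some I1, Some (cell0 False (a mod 3)))}
      else if a = 7 then {(Some l, Some t, Some r, Some d) | l t r d. step_tile l t r d}
      else if a = 8 then {(Some Fin, Some t, Some Fin, None) | t. t \<in> letters}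
      else if a = 9 then {(Some Fin, None, None, None)}
      else {})"

lemma finite_tiles: "finite (tiles a)"
proof -
  have "{(Some l, Some t, Some r, Some d) | l t r d. step_tile l t r d} \<subseteq>
      Some ` colors \<times> Some ` letters \<times> Some ` colors \<times> Some ` letters"
    using step_tile_mem by auto
  then have "finite {(Some l, Some t, Some r, Some d) | l t r d. step_tile l t r d}"
    by (rule finite_subset) (simp add: finite_letters finite_colors)
  then show ?thesis unfolding tiles_def by (auto simp: finite_letters)
qed

end

text \<open>A column for \<open>Hash\<close> and the input with a margin of \<open>T\<close> blanks
  on both sides. Wrong symbols enter only at the ends of a row and advance one column per step, so
  the margins suffice for fewer than \<open>T\<close> steps.\<close>

definition width :: "nat \<Rightarrow> bool list \<Rightarrow> nat" where
  "width T x = 1 + T + length x + T"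

definition items :: "nat \<Rightarrow> bool list \<Rightarrow> nat list" where
  "items T x = [6] @ ([5] @ replicate T 4 @ map bit_sym x @ replicate T 3) @
     replicate (T * width T x) 7 @ replicate (width T x) 8 @ [9]"

lemma length_items: "length (items T x) = 2 + (T + 2) * width T x"
  by (simp add: items_def width_def)

lemma items_0: "items T x ! 0 = 6"
  by (simp add: items_def)

lemma items_last: "items T x ! (1 + (T + 2) * width T x) = 9"
proof -
  have "items T x = ([6] @ ([5] @ replicate T 4 @ map bit_sym x @ replicate T 3) @
     replicate (T * width T x) 7 @ replicate (width T x) 8) @ [9]" by (simp add: items_def)
  moreover have "length ([6] @ ([5] @ replicate T 4 @ map bit_sym x @ replicate T 3) @
     replicate (T * width T x) 7 @ replicate (width T x) (8::nat)) = 1 + (T + 2) * width T x"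
    by (simp add: width_def)
  ultimately show ?thesis by (metis nth_append_length)
qed

lemma items_init:
  assumes "c < width T x"
  shows "items T x ! (1 + c) = (if c = 0 then 5 else if c \<le> T then 4
     else if c \<le> T + length x then bit_sym (x ! (c - T - 1)) else 3)"
proof -
  define A where "A = [5] @ replicate T 4 @ map bit_sym x @ replicate T 3"
  have A: "length A = width T x" by (simp add: A_def width_def)
  have "items T x = 6 # A @ (replicate (T * width T x) 7 @ replicate (width T x) 8 @ [9])"
    by (simp add: items_def A_def)
  then have "items T x ! (1 + c) = A ! c"
    using assms A by (simp add: nth_append)
  then show ?thesis
    using assms by (auto simp: A_def width_def nth_append nth_Cons' diff_diff_eq)
qed

lemma items_row:
  assumes "c < width T x" "1 \<le> \<rho>" "\<rho> \<le> T + 1"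
  shows "items T x ! (1 + \<rho> * width T x + c) = (if \<rho> \<le> T then 7 else 8)"
proof -
  define W where "W = width T x"
  let ?pre = "[6] @ ([5] @ replicate T 4 @ map bit_sym x @ replicate T (3::nat))"
  have l: "length ?pre = 1 + W" by (simp add: W_def width_def)
  obtain r where r: "\<rho> = Suc r" using assms(2) by (cases \<rho>) auto
  have "items T x ! (1 + \<rho> * W + c) = (?pre @ replicate (T * W) 7 @ replicate W 8 @ [9]) ! (length ?pre + (r * W + c))"
    unfolding l by (simp add: items_def W_def r ac_simps)
  also have "\<dots> = (replicate (T * W) 7 @ replicate W 8 @ [9]) ! (r * W + c)"
    by (simp only: nth_append_length_plus)
  also have "\<dots> = (if \<rho> \<le> T then 7 else 8)"
  proof (cases "r < T")
    case True
    then have "Suc r * W \<le> T * W" by (intro mult_right_mono) auto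
    then have "r * W + c < T * W" using assms(1) by (simp add: W_def)
    then show ?thesis using True r by (simp add: nth_append)
  next
    case False
    then have "r = T" using assms(3) r by simp
    then show ?thesis using assms(1) r by (simp add: nth_append W_def)
  qed
  finally show ?thesis by (simp add: W_def)
qed

section \<open>From tilings to accepting computations\<close>

context simulation
begin

text \<open>The functions \<open>h\<close> and \<open>v\<close> give the colours at the borders of
  items and the letters handed down, so the matching of neighbours is built in.\<close>

definition typed_tiling :: "nat \<Rightarrow> bool list \<Rightarrow> (nat \<Rightarrow> color option) \<Rightarrow> (nat \<Rightarrow> letter option) \<Rightarrow> bool" where
  "typed_tiling T x h v \<longleftrightarrow> (\<forall>m < length (items T x).
     (h m, if width T x \<le> m then v (m - width T x) else None, h (Suc m), v m) \<in> tiles (items T x ! m))"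

definition views :: "int \<Rightarrow> tape list \<Rightarrow> nat list" where
  "views p ts = map (view p) ts"

lemma map_read: "map read ts = views 0 ts"
  unfolding views_def by (intro map_cong refl read_view)

lemma init_views:
  assumes "init M x = (q, ts)"
  shows "length ts = tapes M" "q = start M"
    "views p ts = (if 0 \<le> p \<and> nat p < length x then bit_sym (x ! nat p) else 0) # replicate (tapes M - 1) 0"
proof -
  have "tapes M \<ge> 1" using wf by (simp add: wf_tm_def)
  then show "length ts = tapes M" "q = start M" using assms by (auto simp: init_def)
  have "view p (input_tape x) = (if 0 \<le> p \<and> nat p < length x then bit_sym (x ! nat p) else 0)" for x
    by (simp add: view_def input_tape_def blank_def)
  then show "views p ts = (if 0 \<le> p \<and> nat p < length x then bit_sym (x ! nat p) else 0) # replicate (tapes M - 1) 0"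
    using assms by (auto simp: init_def views_def)
qed

lemma acs_length: "i \<in> instrs M \<Longrightarrow> length (acs i) = tapes M \<and> length (rds i) = tapes M"
  using wf by (cases i) (auto simp: wf_tm_def)

lemma views_step:
  assumes "length ts = tapes M" "i \<in> instrs M" "j < tapes M"
  shows "views p (map2 act (acs i) ts) ! j =
    written (acs i ! j) (p + displacement (snd (acs i ! j))) (ts ! j)"
  using assms acs_length[of i] by (simp add: views_def view_act)

text \<open>After \<open>\<rho>\<close> steps the row agrees with the configuration only up to distance \<open>T - 1 - \<rho>\<close> from the
  head, since arbitrary symbols may be shifted in at the ends of a row.\<close>

definition agrees :: "nat \<Rightarrow> nat \<Rightarrow> (nat \<Rightarrow> letter) \<Rightarrow> tape list \<Rightarrow> bool" where
  "agrees T \<rho> V ts \<longleftrightarrow> length ts = tapes M \<and>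
     (\<forall>p. \<bar>p\<bar> \<le> int T - 1 - int \<rho> \<longrightarrow> V (nat (1 + int T + p)) = Cell (p = 0) (views p ts))"

text \<open>The \<open>Hash\<close> tile chooses an instruction for the state, the colours carry it
  unchanged through the row, and the head column checks the symbols read. Acceptance is an
  alternative because the \<open>Hash\<close> tile may then switch to \<open>Fin\<close>.\<close>

lemma row_step:
  assumes W: "2 * T < W" and \<rho>: "Suc \<rho> \<le> T"
    and tile: "\<And>c. c < W \<Longrightarrow> step_tile (H c) (V c) (H (Suc c)) (V' c)"
    and kind: "V 0 = Hash" "\<And>c. 1 \<le> c \<Longrightarrow> c < W \<Longrightarrow> V c \<noteq> Hash"
    and state: "row_state (H 0) q"
    and ag: "agrees T \<rho> V ts"
  shows "q = accept M \<or> (\<exists>q' ts'. step M (q, ts) (q', ts') \<and> row_state (H W) q' \<and> agrees T (Suc \<rho>) V' ts')"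
proof (rule disjCI)
  assume nacc: "\<not> (\<exists>q' ts'. step M (q, ts) (q', ts') \<and> row_state (H W) q' \<and> agrees T (Suc \<rho>) V' ts')"
  show "q = accept M"
  proof (rule ccontr)
    assume q: "q \<noteq> accept M"
    have unique: "q' = q" if "row_state (H 0) q'" for q' using state that by (auto simp: row_state_def)
    have "H 0 \<noteq> Fin" using state by (auto simp: row_state_def)
    then have "hash_tile (H 0) (H 1)" using tile[of 0] W kind(1) by (auto simp: step_tile_def cell_tile_def)
    then obtain i ys where i: "i \<in> instrs M" "ys \<in> words" "src i = q" "H 1 = Run i ys"
      using unique q unfolding hash_tile_def by auto
    have cell: "cell_tile (H c) (V c) (H (Suc c)) (V' c)" if "1 \<le> c" "c < W" "H c \<noteq> Fin" for c
      using tile[of c] kind(2)[of c] that by (auto simp: step_tile_def)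
    have H: "\<exists>ys \<in> words. H c = Run i ys" if "1 \<le> c" "c \<le> W" for c
      using that
    proof (induction c rule: dec_induct)
      case base
      then show ?case using i by auto
    next
      case (step c)
      then show ?case using cell[of c] by (auto simp: cell_tile_def)
    qed
    then obtain L where L: "\<And>c. 1 \<le> c \<Longrightarrow> c \<le> W \<Longrightarrow> L c \<in> words \<and> H c = Run i (L c)" by metis
    have "\<exists>hm xs bs. V c = Cell hm xs \<and> V' c = Cell hm bs \<and> bs \<in> words \<and> (hm \<longrightarrow> xs = rds i) \<and>
       (\<forall>j < tapes M. shift (snd (acs i ! j)) (L c ! j) (overwrite i hm xs ! j) (L (Suc c) ! j) (bs ! j))"
      if "1 \<le> c" "c < W" for c
    proof -
      have Hc: "H c = Run i (L c)" "H (Suc c) = Run i (L (Suc c))" using L that by auto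
      then have "cell_tile (H c) (V c) (H (Suc c)) (V' c)" using cell[OF that] by simp
      then obtain i' ls rs xs bs hm where c: "bs \<in> words" "H c = Run i' ls" "H (Suc c) = Run i' rs"
        "V c = Cell hm xs" "V' c = Cell hm bs" "hm \<longrightarrow> xs = rds i'"
        "\<forall>j < tapes M. shift (snd (acs i' ! j)) (ls ! j) (overwrite i' hm xs ! j) (rs ! j) (bs ! j)"
        unfolding cell_tile_def by blast
      from c(2,3) Hc have "i' = i" "ls = L c" "rs = L (Suc c)" by auto
      with c show ?thesis by blast
    qed
    then obtain hm xs bs where row: "\<And>c. 1 \<le> c \<Longrightarrow> c < W \<Longrightarrow> V c = Cell (hm c) (xs c) \<and>
       V' c = Cell (hm c) (bs c) \<and> bs c \<in> words \<and> (hm c \<longrightarrow> xs c = rds i) \<and>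
       (\<forall>j < tapes M. shift (snd (acs i ! j)) (L c ! j) (overwrite i (hm c) (xs c) ! j) (L (Suc c) ! j) (bs c ! j))"
      by metis
    have len: "length ts = tapes M" using ag by (simp add: agrees_def)
    define col where "col p = nat (1 + int T + p)" for p
    have col: "1 \<le> col p" "col p < W" "col (p + 1) = Suc (col p)" if "\<bar>p\<bar> < int T" for p
      using that W by (auto simp: col_def)
    have V: "V (col p) = Cell (p = 0) (views p ts)" if "\<bar>p\<bar> \<le> int T - 1 - int \<rho>" for p
      using ag that by (simp add: agrees_def col_def)
    have hx: "hm (col p) = (p = 0)" "xs (col p) = views p ts" if "\<bar>p\<bar> \<le> int T - 1 - int \<rho>" for p
      using V[OF that] row[of "col p"] col[of p] that by auto
    have ow: "overwrite i (hm (col p)) (xs (col p)) ! j = written (acs i ! j) p (ts ! j)"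
      if "\<bar>p\<bar> \<le> int T - 1 - int \<rho>" "j < tapes M" for p j
      using hx[OF that(1)] that(2) len acs_length[OF i(1)]
      by (auto simp: overwrite_def written_def views_def)
    have "map read ts = rds i"
      using hx[of 0] row[of "col 0"] col[of 0] \<rho> by (simp add: map_read)
    then have st: "step M (q, ts) (tgt i, map2 act (acs i) ts)"
      using i(1,3) by (cases i) (auto simp: step_def)
    have "row_state (H W) (tgt i)" using L[of W] W i(1) by (auto simp: row_state_def)
    moreover have "agrees T (Suc \<rho>) V' (map2 act (acs i) ts)"
      unfolding agrees_def col_def[symmetric]
    proof (intro conjI allI impI)
      show "length (map2 act (acs i) ts) = tapes M" using len acs_length[OF i(1)] by simp
      fix p :: int assume p: "\<bar>p\<bar> \<le> int T - 1 - int (Suc \<rho>)"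
      have c: "1 \<le> col p" "col p < W" "col (p + 1) = Suc (col p)" "1 \<le> col (p - 1)" "col (p - 1) < W" "Suc (col (p - 1)) = col p"
        "1 \<le> col (p + 1)" "col (p + 1) < W"
        using col[of p] col[of "p - 1"] col[of "p + 1"] p by auto
      have "bs (col p) ! j = views p (map2 act (acs i) ts) ! j" if j: "j < tapes M" for j
      proof -
        let ?p = "p + displacement (snd (acs i ! j))"
        have "bs (col p) ! j = written (acs i ! j) ?p (ts ! j)"
        proof (cases "snd (acs i ! j)")
          case Right
          have "bs (col p) ! j = L (col (p + 1)) ! j"
            using row[of "col p"] c j Right by auto
          also have "\<dots> = overwrite i (hm (col (p + 1))) (xs (col (p + 1))) ! j"
            using row[of "col (p + 1)"] c j Right by auto
          finally show ?thesis using ow[of "p + 1" j] p j Right by simp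
        next
          case Left
          have "bs (col p) ! j = L (col p) ! j"
            using row[of "col p"] c j Left by auto
          also have "\<dots> = overwrite i (hm (col (p - 1))) (xs (col (p - 1))) ! j"
            using row[of "col (p - 1)"] c j Left by auto
          finally show ?thesis using ow[of "p - 1" j] p j Left by simp
        next
          case Stay
          have "bs (col p) ! j = overwrite i (hm (col p)) (xs (col p)) ! j"
            using row[of "col p"] c j Stay by auto
          then show ?thesis using ow[of p j] p j Stay by simp
        qed
        then show ?thesis using views_step[OF len i(1) j] by simp
      qed
      moreover have "length (bs (col p)) = tapes M" using row[of "col p"] c by (auto simp: words_def)
      moreover have "length (views p (map2 act (acs i) ts)) = tapes M"
        using len acs_length[OF i(1)] by (simp add: views_def)
      ultimately have "bs (col p) = views p (map2 act (acs i) ts)" by (simp add: list_eq_iff_nth_eq)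
      then show "V' (col p) = Cell (p = 0) (views p (map2 act (acs i) ts))"
        using row[of "col p"] c hx(1)[of p] p by auto
    qed
    ultimately show False using nacc st by blast
  qed
qed

lemma typed_tiling_sound:
  assumes T: "T \<ge> 1" and tiling: "typed_tiling T x h v"
  shows "\<exists>t<T. accepts_in M x t"
proof -
  define W where "W = width T x"
  have W: "2 * T < W" "T + length x < W" by (simp_all add: W_def width_def)
  \<comment> \<open>\<open>Hc \<rho> c\<close> is the colour to the left of column \<open>c\<close>
    in row \<open>\<rho>\<close>, and \<open>V \<rho> c\<close> the letter handed down there; the 1
    skips the opening item. Row 0 is the initial one, so step \<open>\<rho>\<close> is made in row
    \<open>Suc \<rho>\<close>.\<close>
  define Hc where "Hc \<rho> c = the (h (1 + \<rho> * W + c))" for \<rho> c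
  define V where "V \<rho> c = the (v (1 + \<rho> * W + c))" for \<rho> c
  have tt: "(h m, if W \<le> m then v (m - W) else None, h (Suc m), v m) \<in> tiles (items T x ! m)"
    if "m < 2 + (T + 2) * W" for m
    using tiling that unfolding typed_tiling_def length_items W_def by blast
  have 0: "h 1 = Some I0" "v 0 = None"
    using tt[of 0] by (simp_all add: items_0 tiles_def)
  have init_tile: "(h (1 + c), None, h (1 + Suc c), v (1 + c)) \<in> tiles (items T x ! (1 + c))" if "c < W" for c
  proof -
    \<comment> \<open>The only item that the initial row could receive a letter from is the opening
      one, which hands down none.\<close>
    have "(if W \<le> 1 + c then v (1 + c - W) else None) = None"
      using that 0 by (cases "1 + c = W") auto
    moreover have "1 + c < 2 + (T + 2) * W" using that by simp
    ultimately show ?thesis using tt[of "1 + c"] by simp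
  qed
  have item: "items T x ! (1 + c) = (if c = 0 then 5 else if c \<le> T then 4
     else if c \<le> T + length x then bit_sym (x ! (c - T - 1)) else 3)" if "c < W" for c
    using items_init[of c T x] that by (simp add: W_def)
  define sym where "sym c = (if T < c \<and> c \<le> T + length x then bit_sym (x ! (c - T - 1)) else 0)" for c
  have input_tile: "tiles (items T x ! (1 + c)) =
      {(Some I0, None, Some I1, Some (cell0 True (sym c))), (Some I1, None, Some I1, Some (cell0 False (sym c)))}"
    if "c < W" "T < c" for c
    using item[of c] that by (auto simp: tiles_def sym_def bit_sym_def)
  \<comment> \<open>Item symbols 5 and 4 keep \<open>I0\<close>. Column \<open>T + 1\<close> is the
    first one with a symbol 1, 2 or 3, so exactly there \<open>I0\<close> turns into
    \<open>I1\<close> and the head mark is set.\<close>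
  have left: "h (1 + c) = Some I0" if "c \<le> T + 1" for c
    using that
  proof (induction c)
    case 0
    then show ?case using \<open>h 1 = Some I0\<close> by simp
  next
    case (Suc c)
    then show ?case using init_tile[of c] item[of c] W by (auto simp: tiles_def split: if_splits)
  qed
  have right: "h (1 + c) = Some I1" if "T + 2 \<le> c" "c \<le> W" for c
    using that
  proof (induction c rule: dec_induct)
    case base
    then show ?case using init_tile[of "T + 1"] input_tile[of "T + 1"] left[of "T + 1"] by auto
  next
    case (step c)
    then show ?case using init_tile[of c] input_tile[of c] by auto
  qed
  have V0: "V 0 c = (if c = 0 then Hash else cell0 (c = T + 1) (sym c))" if "c < W" for c
  proof -
    consider "c = 0" | "1 \<le> c" "c \<le> T" | "c = T + 1" | "T + 2 \<le> c" by linarith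
    then have "v (1 + c) = Some (if c = 0 then Hash else cell0 (c = T + 1) (sym c))"
    proof cases
      case 1
      then show ?thesis using init_tile[of c] item[of c] that by (simp add: tiles_def)
    next
      case 2
      then show ?thesis using init_tile[of c] item[of c] that by (simp add: tiles_def sym_def)
    next
      case 3
      then show ?thesis using init_tile[of c] input_tile[of c] left[of c] that by auto
    next
      case 4
      then show ?thesis using init_tile[of c] input_tile[of c] right[of c] that by auto
    qed
    then show ?thesis by (simp add: V_def)
  qed
  have step_tiles: "step_tile (Hc (Suc \<rho>) c) (V \<rho> c) (Hc (Suc \<rho>) (Suc c)) (V (Suc \<rho>) c)"
    if "\<rho> < T" "c < W" for \<rho> c
  proof -
    let ?m = "1 + Suc \<rho> * W + c"
    have "Suc \<rho> * W \<le> T * W" using that by (intro mult_right_mono) auto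
    then have "?m < 2 + (T + 2) * W" using that by (simp add: algebra_simps)
    moreover have "W \<le> ?m" "?m - W = 1 + \<rho> * W + c" "Suc ?m = 1 + Suc \<rho> * W + Suc c" by auto
    moreover have "items T x ! ?m = 7" using items_row[of c T x "Suc \<rho>"] that by (simp add: W_def)
    ultimately show ?thesis using tt[of ?m] by (auto simp: tiles_def Hc_def V_def)
  qed
  have kind: "(V \<rho> c = Hash) = (c = 0)" if "\<rho> \<le> T" "c < W" for \<rho> c
    using that
  proof (induction \<rho>)
    case 0
    then show ?case using V0[of c] by (auto simp: cell0_def)
  next
    case (Suc \<rho>)
    then show ?case using step_tiles[of \<rho> c] by (auto simp: step_tile_def cell_tile_def)
  qed
  have next_row: "Hc \<rho> W = Hc (Suc \<rho>) 0" for \<rho> by (simp add: Hc_def algebra_simps)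
  have main: "(\<exists>t<\<rho>. accepts_in M x t) \<or> (\<exists>q ts. (step M ^^ \<rho>) (init M x) (q, ts) \<and>
      row_state (Hc (Suc \<rho>) 0) q \<and> agrees T \<rho> (V \<rho>) ts)" if "\<rho> \<le> T" for \<rho>
    using that
  proof (induction \<rho>)
    case 0
    obtain q ts where i: "init M x = (q, ts)" by force
    note iv = init_views[OF i]
    have "agrees T 0 (V 0) ts"
      unfolding agrees_def
    proof (intro conjI allI impI)
      show "length ts = tapes M" by (rule iv)
      fix p :: int assume "\<bar>p\<bar> \<le> int T - 1 - int 0"
      then have p: "- int T < p" "p < int T" by auto
      define c where "c = nat (1 + int T + p)"
      have c: "c < W" "1 \<le> c" "c = T + 1 \<longleftrightarrow> p = 0" using p W by (auto simp: c_def)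
      have "sym c = (if 0 \<le> p \<and> nat p < length x then bit_sym (x ! nat p) else 0)"
      proof (cases "0 \<le> p")
        case True
        then have "c - T - 1 = nat p" "T < c \<and> c \<le> T + length x \<longleftrightarrow> nat p < length x"
          by (auto simp: c_def)
        then show ?thesis using True by (simp add: sym_def)
      next
        case False
        then show ?thesis by (auto simp: sym_def c_def)
      qed
      then have "V 0 c = Cell (p = 0) (views p ts)" using V0[of c] c by (simp add: cell0_def iv(3))
      then show "V 0 (nat (1 + int T + p)) = Cell (p = 0) (views p ts)" by (simp add: c_def)
    qed
    moreover have "row_state (Hc (Suc 0) 0) q"
      using right[of W] W T by (simp add: Hc_def row_state_def iv(2))
    ultimately show ?case using i by auto
  next
    case (Suc \<rho>)
    then consider "\<exists>t<\<rho>. accepts_in M x t" | q ts where "(step M ^^ \<rho>) (init M x) (q, ts)"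
      "row_state (Hc (Suc \<rho>) 0) q" "agrees T \<rho> (V \<rho>) ts" by auto
    then show ?case
    proof cases
      case 1
      then show ?thesis using less_Suc_eq by blast
    next
      case 2
      have "q = accept M \<or> (\<exists>q' ts'. step M (q, ts) (q', ts') \<and> row_state (Hc (Suc \<rho>) W) q' \<and> agrees T (Suc \<rho>) (V (Suc \<rho>)) ts')"
        using Suc.prems kind[of \<rho>] W by (intro row_step[OF W(1) Suc.prems step_tiles _ _ 2(2,3)]) auto
      then show ?thesis
      proof
        assume "q = accept M"
        then have "accepts_in M x \<rho>" using 2(1) by (auto simp: accepts_in_def)
        then show ?thesis by blast
      next
        assume "\<exists>q' ts'. step M (q, ts) (q', ts') \<and> row_state (Hc (Suc \<rho>) W) q' \<and> agrees T (Suc \<rho>) (V (Suc \<rho>)) ts'"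
        then show ?thesis using relpowp_Suc_I[OF 2(1)] unfolding next_row by blast
      qed
    qed
  qed
  \<comment> \<open>The last row admits only \<open>Fin\<close>, which represents no state; this
    refutes the second alternative of \<open>main\<close>.\<close>
  have "Hc (Suc T) 0 = Fin"
  proof -
    let ?m = "1 + Suc T * W + 0"
    have "?m < 2 + (T + 2) * W" by simp
    moreover have "items T x ! ?m = 8" using items_row[of 0 T x "Suc T"] W by (simp add: W_def)
    ultimately show ?thesis using tt[of ?m] by (auto simp: tiles_def Hc_def)
  qed
  then show ?thesis using main[of T] by (auto simp: row_state_def)
qed

section \<open>From accepting computations to tilings\<close>

lemma reachable_bounded:
  assumes "(step M ^^ n) (init M x) c"
  shows "length (snd c) = tapes M \<and> (\<forall>u \<in> set (snd c). \<forall>z. fst u z \<le> S)"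
  using assms
proof (induction n arbitrary: c)
  case 0
  have "fst (input_tape y) z \<le> S" for y z using S by (auto simp: input_tape_def bit_sym_def blank_def)
  moreover have "tapes M \<ge> 1" using wf by (simp add: wf_tm_def)
  moreover have "\<forall>u \<in> set (snd c). \<exists>y. u = input_tape y" using 0 by (auto simp: init_def)
  moreover have "length (snd c) = tapes M"
    using 0 \<open>tapes M \<ge> 1\<close> by (auto simp: init_def)
  ultimately show ?case by metis
next
  case (Suc n)
  then obtain c' where c': "(step M ^^ n) (init M x) c'" "step M c' c" by auto
  obtain q ts q' ts' where c: "c' = (q, ts)" "c = (q', ts')" by (metis surj_pair)
  then obtain as where i: "(q, map read ts, q', as) \<in> instrs M" "ts' = map2 act as ts"
    using c'(2) by (auto simp: step_def)
  have IH: "length ts = tapes M" "\<And>u z. u \<in> set ts \<Longrightarrow> fst u z \<le> S" using Suc.IH[OF c'(1)] c by auto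
  have "length as = tapes M" using acs_length[OF i(1)] by simp
  moreover have "fst u z \<le> S" if u: "u \<in> set ts'" for u z
  proof -
    obtain a w where aw: "(a, w) \<in> set (zip as ts)" "u = act a w" using u i(2) by auto
    then have "a \<in> set as" "w \<in> set ts" by (auto dest: set_zip_leftD set_zip_rightD)
    then have "fst a \<le> S" "fst w z \<le> S" using bound[OF i(1)] IH(2) by auto
    then show ?thesis using aw(2) by (cases a; cases w) auto
  qed
  ultimately show ?case using IH(1) i(2) c(2) by simp
qed

lemma typed_tiling_complete:
  assumes T: "t < T" and acc: "accepts_in M x t"
  shows "\<exists>h v. typed_tiling T x h v"
proof -
  define W where "W = width T x"
  have W: "2 * T < W" "T + length x < W" "0 < W" by (simp_all add: W_def width_def)
  obtain C where C: "C 0 = init M x" "fst (C t) = accept M" "\<And>\<rho>. \<rho> < t \<Longrightarrow> step M (C \<rho>) (C (Suc \<rho>))"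
    using acc unfolding accepts_in_def relpowp_fun_conv by blast
  have "\<exists>i \<in> instrs M. src i = fst (C \<rho>) \<and> rds i = map read (snd (C \<rho>)) \<and> tgt i = fst (C (Suc \<rho>)) \<and>
      snd (C (Suc \<rho>)) = map2 act (acs i) (snd (C \<rho>))" if "\<rho> < t" for \<rho>
    using C(3)[OF that] by (cases "C \<rho>"; cases "C (Suc \<rho>)") (force simp: step_def)
  then obtain ins where ins: "\<And>\<rho>. \<rho> < t \<Longrightarrow> ins \<rho> \<in> instrs M \<and> src (ins \<rho>) = fst (C \<rho>) \<and>
      rds (ins \<rho>) = map read (snd (C \<rho>)) \<and> tgt (ins \<rho>) = fst (C (Suc \<rho>)) \<and>
      snd (C (Suc \<rho>)) = map2 act (acs (ins \<rho>)) (snd (C \<rho>))"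
    by metis
  have bdd: "length (snd (C \<rho>)) = tapes M" "u \<in> set (snd (C \<rho>)) \<Longrightarrow> fst u z \<le> S" if "\<rho> \<le> t" for \<rho> u z
  proof -
    have "(step M ^^ \<rho>) (init M x) (C \<rho>)"
      unfolding relpowp_fun_conv using C that by (intro exI[of _ C]) auto
    from reachable_bounded[OF this]
    show "length (snd (C \<rho>)) = tapes M" "u \<in> set (snd (C \<rho>)) \<Longrightarrow> fst u z \<le> S" by auto
  qed
  have view_le: "view p (snd (C \<rho>) ! j) \<le> S" if "\<rho> \<le> t" "j < tapes M" for \<rho> p j
    using bdd[OF that(1)] that(2) by (simp add: view_def)
  have views_words: "views p (snd (C \<rho>)) \<in> words" if "\<rho> \<le> t" for \<rho> p
    using bdd[OF that] by (auto simp: words_def views_def view_def)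
  \<comment> \<open>\<open>min \<rho> t\<close> freezes the configuration once it is
    accepting.\<close>
  define V where "V \<rho> c = (if c = 0 then Hash else
    Cell (c = T + 1) (views (int c - 1 - int T) (snd (C (min \<rho> t)))))" for \<rho> c
  \<comment> \<open>The symbol crossing the left border of column \<open>c\<close>: it comes from
    column \<open>c\<close> if the head moves right, from column \<open>c - 1\<close> if it moves
    left. For \<open>Stay\<close> any symbol fits, and 0 is taken.\<close>
  define carry where "carry \<rho> c = map (\<lambda>j. let a = acs (ins \<rho>) ! j; u = snd (C \<rho>) ! j; p = int c - 1 - int T
    in case snd a of Right \<Rightarrow> written a p u | Left \<Rightarrow> written a (p - 1) u | Stay \<Rightarrow> 0) [0..<tapes M]" for \<rho> c
  \<comment> \<open>\<open>Hr\<close> serves the borders inside and at the end of a row;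
    \<open>Hl\<close> also covers column 0, whose left border belongs to the previous row.\<close>
  define Hr where "Hr row c = (case row of 0 \<Rightarrow> if c \<le> T + 1 then I0 else I1
    | Suc \<rho> \<Rightarrow> if \<rho> < t then Run (ins \<rho>) (carry \<rho> c) else Fin)" for row c
  define Hl where "Hl row c = (if c = 0 then if row = 0 then I0 else Hr (row - 1) W else Hr row c)" for row c
  have carry_words: "carry \<rho> c \<in> words" if "\<rho> < t" for \<rho> c
  proof -
    have "written (acs (ins \<rho>) ! j) p (snd (C \<rho>) ! j) \<le> S" if "j < tapes M" for j p
    proof -
      have "acs (ins \<rho>) ! j \<in> set (acs (ins \<rho>))"
        using that ins[OF \<open>\<rho> < t\<close>] acs_length by auto
      then show ?thesis
        using bound[of "ins \<rho>"] ins[OF \<open>\<rho> < t\<close>] view_le[of \<rho> j p] that \<open>\<rho> < t\<close>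
        by (auto simp: written_def)
    qed
    then show ?thesis by (auto simp: words_def carry_def Let_def split: dir.splits)
  qed
  have hash: "hash_tile (Hl (Suc \<rho>) 0) (Hr (Suc \<rho>) (Suc 0))" if "\<rho> \<le> t" for \<rho>
  proof -
    have "row_state (Hl (Suc \<rho>) 0) (fst (C \<rho>))"
    proof (cases \<rho>)
      case 0
      have "fst (C 0) = start M" using C(1) by (simp add: init_def)
      then show ?thesis using 0 W T by (simp add: Hl_def Hr_def row_state_def)
    next
      case (Suc \<rho>')
      then show ?thesis using that ins[of \<rho>'] carry_words[of \<rho>' W] by (auto simp: Hl_def Hr_def row_state_def)
    qed
    then show ?thesis
      using that ins[of \<rho>] carry_words[of \<rho> "Suc 0"] C(2) unfolding hash_tile_def Hr_def
      by (cases "\<rho> = t") auto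
  qed
  have cell: "cell_tile (Hr (Suc \<rho>) c) (V \<rho> c) (Hr (Suc \<rho>) (Suc c)) (V (Suc \<rho>) c)" if "\<rho> < t" "1 \<le> c" for \<rho> c
  proof -
    let ?i = "ins \<rho>" and ?ts = "snd (C \<rho>)" and ?ts' = "snd (C (Suc \<rho>))" and ?p = "int c - 1 - int T"
    note i = ins[OF that(1)]
    have m: "min \<rho> t = \<rho>" "min (Suc \<rho>) t = Suc \<rho>" using that by auto
    have hm: "c = T + 1 \<longleftrightarrow> ?p = 0" by auto
    have len: "length ?ts = tapes M" "length (acs ?i) = tapes M" using bdd[of \<rho>] acs_length i that by auto
    have ow: "overwrite ?i (c = T + 1) (views ?p ?ts) ! j = written (acs ?i ! j) ?p (?ts ! j)" if "j < tapes M" for j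
      using that len by (auto simp: overwrite_def written_def views_def)
    have "shift (snd (acs ?i ! j)) (carry \<rho> c ! j) (overwrite ?i (c = T + 1) (views ?p ?ts) ! j) (carry \<rho> (Suc c) ! j)
        (views ?p ?ts' ! j)" if j: "j < tapes M" for j
    proof -
      have "views ?p ?ts' ! j = written (acs ?i ! j) (?p + displacement (snd (acs ?i ! j))) (?ts ! j)"
        using views_step[OF len(1) _ j, of ?i] i by simp
      then show ?thesis
        using j unfolding ow[OF j]
        by (cases "snd (acs ?i ! j)") (simp_all add: carry_def Let_def algebra_simps)
    qed
    moreover have "c = T + 1 \<longrightarrow> views ?p ?ts = rds ?i" using i by (auto simp: map_read)
    ultimately show ?thesis
      using that i views_words[of \<rho> ?p] views_words[of "Suc \<rho>" ?p] carry_words[of \<rho>]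
      unfolding cell_tile_def Hr_def V_def m by (intro bexI[of _ ?i]) auto
  qed
  have V_letters: "V \<rho> c \<in> letters" for \<rho> c
    using views_words[of "min \<rho> t"] by (auto simp: V_def letters_def)
  have step_tiles: "step_tile (Hl (Suc \<rho>) c) (V \<rho> c) (Hr (Suc \<rho>) (Suc c)) (V (Suc \<rho>) c)" for \<rho> c
  proof -
    consider "\<rho> < t" "c = 0" | "\<rho> < t" "c \<ge> 1" | "\<rho> = t" "c = 0" | "\<rho> > t" "c = 0" | "\<rho> \<ge> t" "c \<ge> 1" by linarith
    then show ?thesis
    proof cases
      case 1
      then show ?thesis using hash[of \<rho>] by (simp add: step_tile_def V_def)
    next
      case 2
      then show ?thesis using cell[of \<rho> c] by (simp add: step_tile_def Hl_def)
    next
      case 3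
      then show ?thesis using hash[of \<rho>] by (simp add: step_tile_def V_def)
    next
      case 4
      then obtain \<rho>' where "\<rho> = Suc \<rho>'" by (cases \<rho>) auto
      then show ?thesis using 4 V_letters[of \<rho> c] by (simp add: step_tile_def V_def Hl_def Hr_def)
    next
      case 5
      then have "V (Suc \<rho>) c = V \<rho> c" by (simp add: V_def min_def)
      then show ?thesis using 5 V_letters[of \<rho> c] by (simp add: step_tile_def Hl_def Hr_def)
    qed
  qed
  define K where "K = 2 + (T + 2) * W"
  \<comment> \<open>For \<open>m \<ge> 2\<close> this is the right colour of item
    \<open>m - 1\<close>, which lies in row \<open>(m - 2) div W\<close>.\<close>
  define h where "h m = (if m = 0 \<or> m = K then None else if m = 1 then Some I0
    else Some (Hr ((m - 2) div W) ((m - 2) mod W + 1)))" for m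
  define v where "v m = (if m = 0 \<or> T < (m - 1) div W then None else Some (V ((m - 1) div W) ((m - 1) mod W)))" for m
  have lt: "1 + row * W + c < K - 1" if "row \<le> T + 1" "c < W" for row c
  proof -
    have "row * W + c < Suc row * W" using that by simp
    also have "\<dots> \<le> (T + 2) * W" using that by (intro mult_right_mono) auto
    finally show ?thesis by (simp add: K_def)
  qed
  have hr: "h (Suc (1 + row * W + c)) = Some (Hr row (Suc c))" if "row \<le> T + 1" "c < W" for row c
    using lt[OF that] that by (simp add: h_def)
  have hl: "h (1 + row * W + c) = Some (Hl row c)" if "row \<le> T + 1" "c < W" for row c
  proof (cases c)
    case 0
    show ?thesis
    proof (cases row)
      case 0
      then show ?thesis using \<open>c = 0\<close> by (simp add: h_def Hl_def K_def)
    next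
      case (Suc r)
      have e: "1 + row * W + c = Suc (1 + r * W + (W - 1))" "Suc (W - 1) = W" using Suc \<open>c = 0\<close> W by simp_all
      have "r \<le> T + 1" "W - 1 < W" using Suc W that by simp_all
      from hr[OF this] have "h (1 + row * W + c) = Some (Hr r W)" unfolding e .
      then show ?thesis using Suc \<open>c = 0\<close> by (simp add: Hl_def)
    qed
  next
    case (Suc c')
    then have "1 + row * W + c = Suc (1 + row * W + c')" by simp
    then show ?thesis using hr[of row c'] Suc that by (simp add: Hl_def)
  qed
  have vv: "v (1 + row * W + c) = (if row \<le> T then Some (V row c) else None)" if "c < W" for row c
    using that by (simp add: v_def)
  have "typed_tiling T x h v"
    unfolding typed_tiling_def length_items W_def[symmetric] K_def[symmetric]
  proof (intro allI impI)
    fix m assume m: "m < K"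
    let ?up = "if W \<le> m then v (m - W) else None"
    consider "m = 0" | "m = K - 1" | row c where "row \<le> T + 1" "c < W" "m = 1 + row * W + c"
    proof -
      have "row \<le> T + 1" if "row = (m - 1) div W" "m \<noteq> 0" "m \<noteq> K - 1" for row
      proof -
        have "m - 1 < (T + 2) * W" using that m by (simp add: K_def)
        then have "row < T + 2" unfolding that(1) by (simp add: less_mult_imp_div_less)
        then show ?thesis by simp
      qed
      moreover have "(m - 1) mod W < W" using W by simp
      moreover have "m = 1 + (m - 1) div W * W + (m - 1) mod W" if "m \<noteq> 0" using that by simp
      ultimately show ?thesis using that by metis
    qed
    then show "(h m, ?up, h (Suc m), v m) \<in> tiles (items T x ! m)"
    proof cases
      case 1
      then show ?thesis using W by (simp add: items_0 tiles_def h_def v_def K_def)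
    next
      case 2
      have e: "K - 1 = 1 + (T + 2) * W + 0" "K - 1 = Suc (1 + (T + 1) * W + (W - 1))" "K - 1 - W = 1 + (T + 1) * W + 0"
        "Suc (K - 1) = K"
        using W by (simp_all add: K_def)
      have "v (K - 1) = None" unfolding e(1) using vv[of 0 "T + 2"] W by simp
      moreover have "h (K - 1) = Some Fin" unfolding e(2) using hr[of "T + 1" "W - 1"] W T by (simp add: Hr_def)
      moreover have "v (K - 1 - W) = None" unfolding e(3) using vv[of 0 "T + 1"] W by simp
      moreover have "h (Suc (K - 1)) = None" unfolding e(4) by (simp add: h_def)
      moreover have "items T x ! (K - 1) = 9" using items_last[of T x] e(1) by (simp add: W_def)
      ultimately show ?thesis unfolding 2 by (simp add: tiles_def)
    next
      case (3 row c)
      show ?thesis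
      proof (cases row)
        case 0
        have "?up = None" using 0 3 by (cases "m = W") (auto simp: v_def)
        moreover have "h m = Some (Hl 0 c)" "h (Suc m) = Some (Hr 0 (Suc c))" "v m = Some (V 0 c)"
          using hl[of 0 c] hr[of 0 c] vv[of c 0] 3 0 by auto
        moreover have "items T x ! m = (if c = 0 then 5 else if c \<le> T then 4
            else if c \<le> T + length x then bit_sym (x ! (c - T - 1)) else 3)"
          using items_init[of c T x] 3 0 by (simp add: W_def)
        moreover have "V 0 c = (if c = 0 then Hash else cell0 (c = T + 1)
            (if T < c \<and> c \<le> T + length x then bit_sym (x ! (c - T - 1)) else 0))"
        proof -
          obtain q ts where i: "init M x = (q, ts)" by force
          have p: "0 \<le> int c - 1 - int T \<and> nat (int c - 1 - int T) < length x \<longleftrightarrow> T < c \<and> c \<le> T + length x"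
            "nat (int c - 1 - int T) = c - T - 1" by auto
          have "T < c \<and> c - Suc T < length x \<longleftrightarrow> T < c \<and> c \<le> T + length x" by auto
          then show ?thesis using init_views(3)[OF i, of "int c - 1 - int T"] i C(1) unfolding p
            by (simp add: V_def cell0_def)
        qed
        ultimately show ?thesis by (auto simp: tiles_def Hl_def Hr_def bit_sym_def)
      next
        case (Suc \<rho>)
        have up: "W \<le> m" "m - W = 1 + \<rho> * W + c" using 3 Suc by auto
        have it: "items T x ! m = (if row \<le> T then 7 else 8)"
          using items_row[of c T x row] 3 Suc by (simp add: W_def)
        have hv: "h m = Some (Hl row c)" "h (Suc m) = Some (Hr row (Suc c))"
          "?up = Some (V \<rho> c)" "v m = (if row \<le> T then Some (V row c) else None)"
          using hl[of row c] hr[of row c] vv[of c \<rho>] vv[of c row] 3 up Suc by auto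
        show ?thesis
        proof (cases "row \<le> T")
          case True
          then show ?thesis unfolding it hv using step_tiles[of \<rho> c] Suc by (auto simp: tiles_def)
        next
          case False
          then have "\<rho> = T" using 3 Suc by simp
          moreover have "Hl (Suc T) c = Fin" using T by (cases T) (auto simp: Hl_def Hr_def)
          ultimately show ?thesis unfolding it hv using False Suc T V_letters by (simp add: tiles_def Hr_def)
        qed
      qed
    qed
  qed
  then show ?thesis by blast
qed

end

section \<open>The reduction\<close>

definition poly_bounded :: "(nat \<Rightarrow> nat) \<Rightarrow> bool" where
  "poly_bounded f \<longleftrightarrow> (\<exists>p :: nat poly. \<forall>n. f n \<le> poly p n)"

lemma poly_bounded_const: "poly_bounded (\<lambda>_. c)"
  unfolding poly_bounded_def by (rule exI[of _ "[:c:]"]) simp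

lemma poly_bounded_id: "poly_bounded (\<lambda>n. n)"
  unfolding poly_bounded_def by (rule exI[of _ "[:0, 1:]"]) simp

lemma poly_bounded_add: "poly_bounded f \<Longrightarrow> poly_bounded g \<Longrightarrow> poly_bounded (\<lambda>n. f n + g n)"
  unfolding poly_bounded_def by (metis add_mono poly_add)

lemma poly_bounded_mult: "poly_bounded f \<Longrightarrow> poly_bounded g \<Longrightarrow> poly_bounded (\<lambda>n. f n * g n)"
  unfolding poly_bounded_def by (metis mult_le_mono poly_mult)

lemma poly_bounded_power: "poly_bounded f \<Longrightarrow> poly_bounded (\<lambda>n. f n ^ k)"
  by (induction k) (auto intro: poly_bounded_const poly_bounded_mult)

lemma poly_bounded_sum: "(\<And>j. j < k \<Longrightarrow> poly_bounded (F j)) \<Longrightarrow> poly_bounded (\<lambda>n. \<Sum>j<k. F j n)"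
  for k :: nat
  by (induction k) (auto intro: poly_bounded_const poly_bounded_add)

lemmas poly_bounded_intros =
  poly_bounded_const poly_bounded_id poly_bounded_add poly_bounded_mult poly_bounded_power poly_bounded_sum

text \<open>Powers of \<open>n + 2\<close> are easy to compute in unary by nested loops. As the base
  is at least 2, constants are absorbed by a larger exponent; the summand 1 makes the time bound
  strict.\<close>

lemma poly_less_power: "\<exists>k. \<forall>n. poly p n + 1 \<le> (n + 2) ^ k" for p :: "nat poly"
proof (induction p)
  case 0
  show ?case by (rule exI[of _ 0]) simp
next
  case (pCons a p)
  then obtain k where k: "\<And>n. poly p n + 1 \<le> (n + 2) ^ k" by auto
  have "poly (pCons a p) n + 1 \<le> (n + 2) ^ (a + k + 2)" for n
  proof -
    have "a + 1 \<le> 2 ^ a" by (induction a) auto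
    also have "(2::nat) ^ a \<le> (n + 2) ^ a" by (intro power_mono) auto
    also have "\<dots> \<le> (n + 2) ^ (a + k + 1)" by (intro power_increasing) auto
    finally have 1: "a + 1 \<le> (n + 2) ^ (a + k + 1)" .
    have "n * poly p n \<le> (n + 2) * (n + 2) ^ k" using k[of n] by (intro mult_le_mono) auto
    also have "\<dots> = (n + 2) ^ (k + 1)" by simp
    also have "\<dots> \<le> (n + 2) ^ (a + k + 1)" by (intro power_increasing) auto
    finally have 2: "n * poly p n \<le> (n + 2) ^ (a + k + 1)" .
    have "poly (pCons a p) n + 1 \<le> 2 * (n + 2) ^ (a + k + 1)" using 1 2 by simp
    also have "\<dots> \<le> (n + 2) * (n + 2) ^ (a + k + 1)" by (intro mult_right_mono) auto
    finally show ?thesis by simp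
  qed
  then show ?case by blast
qed

section \<open>The program of the reduction and its running time\<close>

lemma emits_run:
  assumes "emits r c \<sigma> w T" "\<sigma> r = []"
  shows "run c \<sigma> (\<sigma>(r := rev w)) T"
proof -
  have "\<sigma>(r := []) = \<sigma>" using assms(2) by (metis fun_upd_triv)
  moreover have "run c (\<sigma>(r := [])) (\<sigma>(r := rev w @ [])) T" using assms(1) unfolding emits_def by blast
  ultimately show ?thesis by simp
qed

lemma emits_foreach_pushes:
  assumes "i \<noteq> j" "i \<noteq> r" "j \<noteq> r" "\<sigma> i = xs" "\<sigma> j = []" "\<And>a. a \<in> set xs \<Longrightarrow> 1 \<le> a \<and> a \<le> 9"
    and "\<And>a. a \<in> set xs \<Longrightarrow> length (g a) \<le> L"
  shows "emits r (foreach i j 9 (\<lambda>a. pushes r (g a))) \<sigma> (concat (map g xs)) (length xs * (2 * L + 32) + 2)"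
proof -
  have "emits r (foreach i j 9 (\<lambda>a. pushes r (g a))) \<sigma> (concat (map (\<lambda>k. g (xs ! k)) [0..<length xs]))
      (length xs * (2 * L + 2 * 9 + 14) + 2)"
  proof (rule emits_foreach[OF assms(1-5)])
    fix k assume "k < length xs"
    then have "length (g (xs ! k)) * 2 \<le> 2 * L" using assms(7)[of "xs ! k"] by simp
    then show "emits r (pushes r (g (xs ! k))) (\<sigma>(i := drop (Suc k) xs, j := rev (take k xs))) (g (xs ! k)) (2 * L)"
      by (rule emits_mono[OF emits_pushes])
  qed (use assms(6) in auto)
  moreover have "map (\<lambda>k. g (xs ! k)) [0..<length xs] = map g (map ((!) xs) [0..<length xs])"
    by (simp only: map_map comp_def)
  moreover have "2 * L + 2 * 9 + 14 = 2 * L + 32" by simp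
  ultimately show ?thesis by (simp only: map_nth)
qed

lemma emits_foreach_replicate:
  assumes "i \<noteq> j" "i \<noteq> r" "j \<noteq> r" "\<sigma> i = xs" "\<sigma> j = []" "\<And>a. a \<in> set xs \<Longrightarrow> 1 \<le> a \<and> a \<le> 9"
  shows "emits r (foreach i j 9 (\<lambda>_. pushes r w)) \<sigma> (concat (replicate (length xs) w))
    (length xs * (2 * length w + 32) + 2)"
  using emits_foreach_pushes[of i j r \<sigma> xs "\<lambda>_. w" "length w"] assms by (simp add: map_replicate_const)

fun word :: "piece \<Rightarrow> bool list" where
  "word (Const w) = w" | "word (PerItem w) = w" | "word (PerWidth w) = w"

fun piece_com :: "piece \<Rightarrow> com" where
  "piece_com (Const w) = pushes 7 (map bit_sym w)"
| "piece_com (PerItem w) = foreach 2 3 9 (\<lambda>_. pushes 7 (map bit_sym w))"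
| "piece_com (PerWidth w) = foreach 5 3 9 (\<lambda>_. pushes 7 (map bit_sym w))"

lemma emits_piece:
  assumes "length (\<sigma> 2) = m" "length (\<sigma> 5) = W" "\<sigma> 3 = []" "\<And>a. a \<in> set (\<sigma> 2) \<union> set (\<sigma> 5) \<Longrightarrow> 1 \<le> a \<and> a \<le> 9"
  shows "emits 7 (piece_com p) \<sigma> (map bit_sym (expand m W p)) ((m + W + 1) * (2 * length (word p) + 34))"
proof (cases p)
  case (Const w)
  then show ?thesis using emits_pushes[of 7 "map bit_sym w" \<sigma>]
    by (auto elim!: emits_mono)
next
  case (PerItem w)
  have "emits 7 (piece_com p) \<sigma> (concat (replicate m (map bit_sym w))) (m * (2 * length w + 32) + 2)"
    using emits_foreach_replicate[of 2 3 7 \<sigma> "\<sigma> 2" "map bit_sym w"] assms PerItem by simp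
  then show ?thesis using PerItem by (auto elim!: emits_mono simp: map_concat algebra_simps)
next
  case (PerWidth w)
  have "emits 7 (piece_com p) \<sigma> (concat (replicate W (map bit_sym w))) (W * (2 * length w + 32) + 2)"
    using emits_foreach_replicate[of 5 3 7 \<sigma> "\<sigma> 5" "map bit_sym w"] assms PerWidth by simp
  then show ?thesis using PerWidth by (auto elim!: emits_mono simp: map_concat algebra_simps)
qed

definition total_word :: "piece list \<Rightarrow> nat" where
  "total_word ps = sum_list (map (\<lambda>p. length (word p)) ps)"

lemma emits_pieces:
  assumes "length (\<sigma> 2) = m" "length (\<sigma> 5) = W" "\<sigma> 3 = []" "\<And>a. a \<in> set (\<sigma> 2) \<union> set (\<sigma> 5) \<Longrightarrow> 1 \<le> a \<and> a \<le> 9"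
  shows "emits 7 (seqs (map piece_com ps)) \<sigma> (map bit_sym (expands m W ps))
    (length ps * ((m + W + 1) * (2 * total_word ps + 34)))"
proof -
  have "emits 7 (seqs (map piece_com ps)) \<sigma> (concat (map (\<lambda>p. map bit_sym (expand m W p)) ps))
    (length ps * ((m + W + 1) * (2 * total_word ps + 34)))"
  proof (rule emits_seqs)
    fix p assume "p \<in> set ps"
    then have "length (word p) \<le> total_word ps"
      unfolding total_word_def by (intro member_le_sum_list) auto
    then have "(m + W + 1) * (2 * length (word p) + 34) \<le> (m + W + 1) * (2 * total_word ps + 34)"
      by (intro mult_le_mono) auto
    moreover have "emits 7 (piece_com p) \<sigma> (map bit_sym (expand m W p)) ((m + W + 1) * (2 * length (word p) + 34))"
      using assms by (rule emits_piece)
    ultimately show "emits 7 (piece_com p) \<sigma> (map bit_sym (expand m W p)) ((m + W + 1) * (2 * total_word ps + 34))"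
      using emits_mono by blast
  qed
  then show ?thesis by (simp add: expands_def map_concat comp_def)
qed

definition items_output :: "(nat \<Rightarrow> piece list) \<Rightarrow> nat \<Rightarrow> bool list \<Rightarrow> bool list" where
  "items_output PL T x = concat (map (\<lambda>m. expands m (width T x) (PL (items T x ! m))) [0..<length (items T x)])"

text \<open>Stack 0 holds the input and finally the output, stack 1 the reversed input, 5 the width and \<open>9 + j\<close>
  the number \<open>(n + 2) ^ j\<close> in unary, 6 the items, 7 the reversed output, 8 the number \<open>n + 2\<close>; 2 and 3
  are auxiliary. While the outer loop treats item \<open>m\<close>, stack 2 holds the \<open>m\<close> items before it, so a loop
  over stack 2 is executed \<open>m\<close> times.\<close>

definition power_com :: "nat \<Rightarrow> com" where
  "power_com k = seqs (map (\<lambda>j. foreach 8 2 9 (\<lambda>_. foreach (9 + j) 3 9 (\<lambda>_. pushes (10 + j) [1]))) [0..<k])"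

definition width_com :: "nat \<Rightarrow> com" where
  "width_com u = pushes 5 [1] ;; foreach u 2 9 (\<lambda>_. pushes 5 [1]) ;;
     foreach 0 2 9 (\<lambda>_. pushes 5 [1]) ;; foreach u 2 9 (\<lambda>_. pushes 5 [1])"

definition items_com :: "nat \<Rightarrow> com" where
  "items_com u = pushes 6 [9] ;; foreach 5 2 9 (\<lambda>_. pushes 6 [8]) ;;
     foreach u 2 9 (\<lambda>_. foreach 5 3 9 (\<lambda>_. pushes 6 [7])) ;;
     foreach u 2 9 (\<lambda>_. pushes 6 [3]) ;; foreach 1 2 9 (\<lambda>a. pushes 6 [a]) ;;
     foreach u 2 9 (\<lambda>_. pushes 6 [4]) ;; pushes 6 [5, 6]"

definition reduction_com :: "(nat \<Rightarrow> piece list) \<Rightarrow> nat \<Rightarrow> com" where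
  "reduction_com PL k = foreach 0 2 9 (\<lambda>a. pushes 1 [a]) ;;
     (pushes 8 [1, 1] ;; foreach 0 2 9 (\<lambda>_. pushes 8 [1])) ;; pushes 9 [1] ;; power_com k ;;
     width_com (9 + k) ;; items_com (9 + k) ;; foreach 6 2 9 (\<lambda>a. seqs (map piece_com (PL a))) ;;
     Loop 0 (Pop 0) ;; foreach 7 2 9 (\<lambda>a. pushes 0 [a])"

lemma run_clear: "0 \<notin> set (\<sigma> i) \<Longrightarrow> run (Loop i (Pop i)) \<sigma> (\<sigma>(i := [])) (length (\<sigma> i) * 3 + 1)"
proof (induction "\<sigma> i" arbitrary: \<sigma>)
  case Nil
  then have "\<sigma>(i := []) = \<sigma>" by (metis fun_upd_triv)
  then show ?case using run_Loop_end[of \<sigma> i "Pop i"] Nil by (simp add: run_mono)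
next
  case (Cons a xs)
  have "run (Loop i (Pop i)) (\<sigma>(i := xs)) (\<sigma>(i := [])) (length xs * 3 + 1)"
    using Cons(1)[of "\<sigma>(i := xs)"] Cons(2,3) by (metis fun_upd_same fun_upd_upd list.set_intros(2))
  moreover have "run (Pop i) \<sigma> (\<sigma>(i := xs)) 1" using run_Pop[of i \<sigma>] Cons(2) by (metis list.sel(3))
  moreover have "topsym (\<sigma> i) \<noteq> 0" using Cons(2,3) by (metis list.distinct(1) list.sel(1) list.set_intros(1) topsym_def)
  ultimately have "run (Loop i (Pop i)) \<sigma> (\<sigma>(i := [])) (1 + (length xs * 3 + 1) + 2)"
    by (intro run_Loop_step[of \<sigma> i])
  then show ?case using Cons(2)[symmetric] by (simp add: run_mono)
qed

text \<open>Stage \<open>j\<close> multiplies by \<open>L\<close>: for each symbol of stack 8 it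
  appends a copy of stack \<open>9 + j\<close> to stack \<open>10 + j\<close>.\<close>

lemma run_power:
  assumes "\<sigma> 8 = replicate L 1" "\<sigma> 2 = []" "\<sigma> 3 = []" "\<sigma> 9 = [1]" "\<And>i. i > 9 \<Longrightarrow> \<sigma> i = []"
  shows "run (power_com k) \<sigma> (\<lambda>i. if 9 \<le> i \<and> i \<le> 9 + k then replicate (L ^ (i - 9)) 1 else \<sigma> i)
    (\<Sum>j<k. L * (L ^ j * 34 + 34) + 2)"
proof -
  let ?st = "\<lambda>j i. if 9 \<le> i \<and> i \<le> 9 + j then replicate (L ^ (i - 9)) 1 else \<sigma> i"
  let ?c = "\<lambda>j. foreach 8 2 9 (\<lambda>_. foreach (9 + j) 3 9 (\<lambda>_. pushes (10 + j) [1]))"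
  have step: "run (?c j) (?st j) (?st (Suc j)) (L * (L ^ j * 34 + 34) + 2)" for j
  proof -
    have "emits (10 + j) (?c j) (?st j)
        (concat (map (\<lambda>_. concat (replicate (L ^ j) [1])) [0..<length (replicate L (1::nat))]))
        (length (replicate L (1::nat)) * ((L ^ j * 34 + 2) + 2 * 9 + 14) + 2)"
    proof (intro emits_foreach)
      fix l assume "l < length (replicate L (1::nat))"
      show "emits (10 + j) (foreach (9 + j) 3 9 (\<lambda>_. pushes (10 + j) [1]))
         ((?st j)(8 := drop (Suc l) (replicate L 1), 2 := rev (take l (replicate L 1))))
         (concat (replicate (L ^ j) [1])) (L ^ j * 34 + 2)"
        using emits_foreach_replicate[of "9 + j" 3 "10 + j" "(?st j)(8 := drop (Suc l) (replicate L 1), 2 := rev (take l (replicate L 1)))"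
            "replicate (L ^ j) 1" "[1]"] assms by auto
    qed (use assms in auto)
    then have "emits (10 + j) (?c j) (?st j) (replicate (L ^ Suc j) 1) (L * (L ^ j * 34 + 34) + 2)"
      by (simp add: concat_replicate_single concat_replicate_replicate map_replicate_const mult.commute add.commute)
    from emits_run[OF this] have "run (?c j) (?st j) ((?st j)(10 + j := replicate (L ^ Suc j) 1)) (L * (L ^ j * 34 + 34) + 2)"
      using assms(5)[of "10 + j"] by simp
    moreover have "(?st j)(10 + j := replicate (L ^ Suc j) 1) = ?st (Suc j)"
    proof
      fix i
      show "((?st j)(10 + j := replicate (L ^ Suc j) 1)) i = ?st (Suc j) i"
        by (cases "i = 10 + j") (auto simp: le_Suc_eq)
    qed
    ultimately show ?thesis by simp
  qed
  have "run (seqs (map ?c [i..<i + d])) (?st i) (?st (i + d)) (\<Sum>j\<in>{i..<i + d}. L * (L ^ j * 34 + 34) + 2)" for i d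
  proof (induction d arbitrary: i)
    case 0
    show ?case by (simp add: seqs_def run_Skip)
  next
    case (Suc d)
    have "run (?c i ;; seqs (map ?c [Suc i..<Suc i + d])) (?st i) (?st (Suc i + d))
      (L * (L ^ i * 34 + 34) + 2 + (\<Sum>j\<in>{Suc i..<Suc i + d}. L * (L ^ j * 34 + 34) + 2))"
      by (rule run_Seq[OF step Suc])
    moreover have "[i..<i + Suc d] = i # [Suc i..<Suc i + d]" by (simp add: upt_conv_Cons del: upt_Suc)
    moreover have "(\<Sum>j\<in>{i..<i + Suc d}. L * (L ^ j * 34 + 34) + 2) =
       L * (L ^ i * 34 + 34) + 2 + (\<Sum>j\<in>{Suc i..<Suc i + d}. L * (L ^ j * 34 + 34) + 2)"
      by (subst sum.atLeast_Suc_lessThan) auto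
    ultimately show ?case by (simp add: seqs_def)
  qed
  from this[of 0 k] have "run (power_com k) (?st 0) (?st k) (\<Sum>j<k. L * (L ^ j * 34 + 34) + 2)"
    by (simp add: power_com_def atLeast0LessThan)
  moreover have "?st 0 = \<sigma>"
  proof
    fix i show "?st 0 i = \<sigma> i" by (cases "i = 9") (use assms(4) in auto)
  qed
  ultimately show ?thesis by simp
qed

text \<open>Per symbol, 2 steps for pushing one symbol and \<open>2 * 9 + 14\<close> for the
  traversal with nine possible symbols.\<close>

definition loop_time :: "nat \<Rightarrow> nat" where
  "loop_time l = l * 34 + 2"

definition emission_time :: "nat \<Rightarrow> nat \<Rightarrow> nat \<Rightarrow> nat" where
  "emission_time D W K = K * ((K + W + 1) * D + 32) + 2"

text \<open>Nested like the sequential compositions in \<open>reduction_com\<close>, so that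
  \<open>run_Seq\<close> yields it literally.\<close>

definition reduction_time :: "nat \<Rightarrow> nat \<Rightarrow> nat \<Rightarrow> nat" where
  "reduction_time D k n = (let L = n + 2; T = L ^ k; W = 1 + T + n + T; K = 2 + (T + 2) * W in
     loop_time n + ((4 + loop_time n) + (2 + ((\<Sum>j<k. L * (L ^ j * 34 + 34) + 2) +
     ((2 + (loop_time T + (loop_time n + loop_time T))) +
     ((2 + (loop_time W + ((T * (loop_time W + 32) + 2) + (loop_time T + (loop_time n + (loop_time T + 4)))))) +
     (emission_time D W K + ((n * 3 + 1) + loop_time (emission_time D W K)))))))))"

lemma poly_bounded_reduction_time: "poly_bounded (reduction_time D k)"
  unfolding reduction_time_def Let_def loop_time_def emission_time_def
  by (intro poly_bounded_intros)

lemma bit_sym_range: "a \<in> set (map bit_sym x) \<Longrightarrow> 1 \<le> a \<and> a \<le> 9"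
  by (auto simp: bit_sym_def)

lemma items_range: "a \<in> set (items T x) \<Longrightarrow> 1 \<le> a \<and> a \<le> 9"
  by (auto simp: items_def bit_sym_def)

lemma emits_foreach_count:
  assumes "i \<noteq> j" "i \<noteq> r" "j \<noteq> r" "\<sigma> i = xs" "\<sigma> j = []" "\<And>a. a \<in> set xs \<Longrightarrow> 1 \<le> a \<and> a \<le> 9"
  shows "emits r (foreach i j 9 (\<lambda>_. pushes r [c])) \<sigma> (replicate (length xs) c) (loop_time (length xs))"
  using emits_foreach_replicate[of i j r \<sigma> xs "[c]", OF assms]
  by (simp add: loop_time_def concat_replicate_single)

lemma emits_foreach_copy:
  assumes "i \<noteq> j" "i \<noteq> r" "j \<noteq> r" "\<sigma> i = xs" "\<sigma> j = []" "\<And>a. a \<in> set xs \<Longrightarrow> 1 \<le> a \<and> a \<le> 9"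
  shows "emits r (foreach i j 9 (\<lambda>a. pushes r [a])) \<sigma> xs (loop_time (length xs))"
  using emits_foreach_pushes[of i j r \<sigma> xs "\<lambda>a. [a]" 1, OF assms]
  by (simp add: loop_time_def)

lemma emits_symbols: "length w * 2 = T \<Longrightarrow> emits r (pushes r w) \<sigma> w T"
  using emits_pushes by blast

lemma emits_width:
  assumes "u > 8" "\<sigma> u = replicate T 1" "\<sigma> 0 = map bit_sym x" "\<sigma> 2 = []"
  shows "emits 5 (width_com u) \<sigma> (replicate (width T x) 1)
    (2 + (loop_time T + (loop_time (length x) + loop_time T)))"
proof -
  have U: "emits 5 (foreach u 2 9 (\<lambda>_. pushes 5 [1])) \<sigma> (replicate T 1) (loop_time T)"
    using emits_foreach_count[of u 2 5 \<sigma> "replicate T 1" 1] assms by simp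
  have X: "emits 5 (foreach 0 2 9 (\<lambda>_. pushes 5 [1])) \<sigma> (replicate (length x) 1) (loop_time (length x))"
    using emits_foreach_count[of 0 2 5 \<sigma> "map bit_sym x" 1] assms bit_sym_range by simp
  have "emits 5 (width_com u) \<sigma> ([1] @ replicate T 1 @ replicate (length x) 1 @ replicate T 1)
      (2 + (loop_time T + (loop_time (length x) + loop_time T)))"
    unfolding width_com_def by (intro emits_Seq U X emits_symbols) simp
  moreover have "[1] @ replicate T 1 @ replicate (length x) 1 @ replicate T 1 = replicate (width T x) (1::nat)"
    by (simp add: width_def replicate_add)
  ultimately show ?thesis by simp
qed

text \<open>The first item has to end up on top, so the list is emitted backwards; the reversed
  input on stack 1 serves this purpose.\<close>

lemma emits_items:
  assumes "u > 8" "\<sigma> u = replicate T 1" "\<sigma> 1 = rev (map bit_sym x)" "\<sigma> 2 = []" "\<sigma> 3 = []"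
    and W: "\<sigma> 5 = replicate (width T x) 1"
  shows "emits 6 (items_com u) \<sigma> (rev (items T x))
    (2 + (loop_time (width T x) + ((T * (loop_time (width T x) + 32) + 2) + (loop_time T + (loop_time (length x) + (loop_time T + 4))))))"
proof -
  let ?W = "width T x"
  have E: "emits 6 (pushes 6 [9]) \<sigma> [9] 2" "emits 6 (pushes 6 [5, 6]) \<sigma> [5, 6] 4"
    by (intro emits_symbols; simp)+
  have F: "emits 6 (foreach 5 2 9 (\<lambda>_. pushes 6 [8])) \<sigma> (replicate ?W 8) (loop_time ?W)"
    using emits_foreach_count[of 5 2 6 \<sigma> "replicate ?W 1" 8] assms by simp
  have B: "emits 6 (foreach u 2 9 (\<lambda>_. pushes 6 [a])) \<sigma> (replicate T a) (loop_time T)" for a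
    using emits_foreach_count[of u 2 6 \<sigma> "replicate T 1" a] assms by simp
  have X: "emits 6 (foreach 1 2 9 (\<lambda>a. pushes 6 [a])) \<sigma> (rev (map bit_sym x)) (loop_time (length x))"
    using emits_foreach_copy[of 1 2 6 \<sigma> "rev (map bit_sym x)"] assms bit_sym_range[of _ x] by simp
  have G: "emits 6 (foreach u 2 9 (\<lambda>_. foreach 5 3 9 (\<lambda>_. pushes 6 [7]))) \<sigma> (replicate (T * ?W) 7)
      (T * (loop_time ?W + 32) + 2)"
  proof -
    have "emits 6 (foreach u 2 9 (\<lambda>_. foreach 5 3 9 (\<lambda>_. pushes 6 [7]))) \<sigma>
       (concat (map (\<lambda>_. replicate ?W 7) [0..<length (replicate T (1::nat))]))
       (length (replicate T (1::nat)) * (loop_time ?W + 2 * 9 + 14) + 2)"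
    proof (intro emits_foreach)
      fix l
      let ?\<sigma> = "\<sigma>(u := drop (Suc l) (replicate T 1), 2 := rev (take l (replicate T 1)))"
      show "emits 6 (foreach 5 3 9 (\<lambda>_. pushes 6 [7])) ?\<sigma> (replicate ?W 7) (loop_time ?W)"
        using emits_foreach_count[of 5 3 6 ?\<sigma> "replicate ?W 1" 7] assms by simp
    qed (use assms in auto)
    then show ?thesis by (simp add: map_replicate_const concat_replicate_replicate mult.commute add.commute)
  qed
  have "emits 6 (items_com u) \<sigma> ([9] @ replicate ?W 8 @ replicate (T * ?W) 7 @ replicate T 3 @ rev (map bit_sym x) @ replicate T 4 @ [5, 6])
    (2 + (loop_time ?W + ((T * (loop_time ?W + 32) + 2) + (loop_time T + (loop_time (length x) + (loop_time T + 4))))))"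
    unfolding items_com_def by (intro emits_Seq E F G B X)
  moreover have "[9] @ replicate ?W 8 @ replicate (T * ?W) 7 @ replicate T 3 @ rev (map bit_sym x) @ replicate T 4 @ [5, 6] = rev (items T x)"
    by (simp add: items_def)
  ultimately show ?thesis by simp
qed

lemma emits_output:
  assumes D: "\<And>a. 1 \<le> a \<Longrightarrow> a \<le> 9 \<Longrightarrow> length (PL a) * (2 * total_word (PL a) + 34) \<le> D"
    and \<sigma>: "\<sigma> 6 = items T x" "\<sigma> 2 = []" "\<sigma> 3 = []" "\<sigma> 5 = replicate (width T x) 1"
  shows "emits 7 (foreach 6 2 9 (\<lambda>a. seqs (map piece_com (PL a)))) \<sigma>
    (map bit_sym (items_output PL T x)) (emission_time D (width T x) (length (items T x)))"
proof -
  let ?W = "width T x" and ?K = "length (items T x)"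
  have "emits 7 (foreach 6 2 9 (\<lambda>a. seqs (map piece_com (PL a)))) \<sigma>
    (concat (map (\<lambda>m. map bit_sym (expands m ?W (PL (items T x ! m)))) [0..<?K])) (?K * ((?K + ?W + 1) * D + 2 * 9 + 14) + 2)"
  proof (intro emits_foreach)
    fix m assume m: "m < ?K"
    let ?\<sigma> = "\<sigma>(6 := drop (Suc m) (items T x), 2 := rev (take m (items T x)))"
    let ?ps = "PL (items T x ! m)"
    have "1 \<le> a \<and> a \<le> 9" if "a \<in> set (?\<sigma> 2) \<union> set (?\<sigma> 5)" for a
      using that items_range[of a T x] \<sigma> by (auto dest: in_set_takeD)
    then have "emits 7 (seqs (map piece_com ?ps)) ?\<sigma> (map bit_sym (expands m ?W ?ps))
      (length ?ps * ((m + ?W + 1) * (2 * total_word ?ps + 34)))"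
      using m \<sigma> by (intro emits_pieces) auto
    moreover have "length ?ps * ((m + ?W + 1) * (2 * total_word ?ps + 34)) \<le> (?K + ?W + 1) * D"
    proof -
      have "length ?ps * ((m + ?W + 1) * (2 * total_word ?ps + 34)) = (m + ?W + 1) * (length ?ps * (2 * total_word ?ps + 34))"
        by (simp only: mult_ac)
      also have "\<dots> \<le> (?K + ?W + 1) * D"
        using m items_range[of "items T x ! m" T x] by (intro mult_le_mono D) auto
      finally show ?thesis .
    qed
    ultimately show "emits 7 (seqs (map piece_com ?ps)) ?\<sigma> (map bit_sym (expands m ?W ?ps)) ((?K + ?W + 1) * D)"
      using emits_mono by blast
  qed (use \<sigma> items_range in auto)
  then show ?thesis by (simp add: emission_time_def items_output_def map_concat comp_def ac_simps)
qed

lemma run_reduction: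
  assumes D: "\<And>a. 1 \<le> a \<Longrightarrow> a \<le> 9 \<Longrightarrow> length (PL a) * (2 * total_word (PL a) + 34) \<le> D"
  shows "\<exists>\<sigma>. run (reduction_com PL k) (input_store x) \<sigma> (reduction_time D k (length x)) \<and>
    \<sigma> 0 = map bit_sym (items_output PL ((length x + 2) ^ k) x)"
proof -
  define L where "L = length x + 2"
  define T where "T = L ^ k"
  define W where "W = width T x"
  define K where "K = length (items T x)"
  define out where "out = map bit_sym (items_output PL T x)"
  define s0 where "s0 = input_store x"
  have s0: "s0 0 = map bit_sym x" "i > 0 \<Longrightarrow> s0 i = []" for i by (simp_all add: s0_def input_store_def)
  define s1 where "s1 = s0(1 := rev (map bit_sym x))"
  define s2 where "s2 = s1(8 := replicate L 1)"
  define s3 where "s3 = s2(9 := [1])"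
  define s4 where "s4 = (\<lambda>i. if 9 \<le> i \<and> i \<le> 9 + k then replicate (L ^ (i - 9)) 1 else s3 i)"
  define s5 where "s5 = s4(5 := replicate W 1)"
  define s6 where "s6 = s5(6 := items T x)"
  define s7 where "s7 = s6(7 := rev out)"
  define s8 where "s8 = s7(0 := [])"
  define s9 where "s9 = s8(0 := out)"
  have 1: "run (foreach 0 2 9 (\<lambda>a. pushes 1 [a])) s0 s1 (loop_time (length x))"
    unfolding s1_def using s0 emits_foreach_copy[of 0 2 1 s0 "map bit_sym x"] bit_sym_range[of _ x]
    by (intro emits_run) auto
  have 2: "run (pushes 8 [1, 1] ;; foreach 0 2 9 (\<lambda>_. pushes 8 [1])) s1 s2 (4 + loop_time (length x))"
  proof -
    have "emits 8 (foreach 0 2 9 (\<lambda>_. pushes 8 [1])) s1 (replicate (length x) 1) (loop_time (length x))"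
      using emits_foreach_count[of 0 2 8 s1 "map bit_sym x" 1] s0 bit_sym_range[of _ x] by (simp add: s1_def)
    then have "emits 8 (pushes 8 [1, 1] ;; foreach 0 2 9 (\<lambda>_. pushes 8 [1])) s1 ([1, 1] @ replicate (length x) 1) (4 + loop_time (length x))"
      by (intro emits_Seq emits_symbols) auto
    moreover have "[1, 1] @ replicate (length x) 1 = replicate L (1::nat)" by (simp add: L_def)
    ultimately have "emits 8 (pushes 8 [1, 1] ;; foreach 0 2 9 (\<lambda>_. pushes 8 [1])) s1 (replicate L 1) (4 + loop_time (length x))"
      by simp
    from emits_run[OF this] show ?thesis using s0 by (simp add: s2_def s1_def)
  qed
  have 3: "run (pushes 9 [1]) s2 s3 2"
    using emits_run[OF emits_symbols[of "[1]" 2 9 s2]] s0 by (simp add: s3_def s2_def s1_def)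
  have 4: "run (power_com k) s3 s4 (\<Sum>j<k. L * (L ^ j * 34 + 34) + 2)"
    unfolding s4_def using s0 by (intro run_power) (simp_all add: s3_def s2_def s1_def)
  have s4: "s4 (9 + k) = replicate T 1" "s4 0 = map bit_sym x" "s4 1 = rev (map bit_sym x)"
    "i \<in> {2, 3, 5, 6, 7} \<Longrightarrow> s4 i = []" for i
    using s0 by (auto simp: s4_def T_def s3_def s2_def s1_def)
  have 5: "run (width_com (9 + k)) s4 s5 (2 + (loop_time T + (loop_time (length x) + loop_time T)))"
    using emits_run[OF emits_width[of "9 + k" s4 T x]] s4 by (simp add: s5_def W_def)
  have 6: "run (items_com (9 + k)) s5 s6 (2 + (loop_time W + ((T * (loop_time W + 32) + 2) + (loop_time T + (loop_time (length x) + (loop_time T + 4))))))"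
    using emits_run[OF emits_items[of "9 + k" s5 T x]] s4 by (simp add: s5_def s6_def W_def)
  have em: "emits 7 (foreach 6 2 9 (\<lambda>a. seqs (map piece_com (PL a)))) s6 out (emission_time D W K)"
    unfolding out_def W_def K_def using D s4 by (intro emits_output) (simp_all add: s6_def s5_def W_def)
  then have 7: "run (foreach 6 2 9 (\<lambda>a. seqs (map piece_com (PL a)))) s6 s7 (emission_time D W K)"
    unfolding s7_def using s4 by (intro emits_run) (simp_all add: s6_def s5_def)
  have 8: "run (Loop 0 (Pop 0)) s7 s8 (length x * 3 + 1)"
  proof -
    have "s7 0 = map bit_sym x" using s4 by (simp add: s7_def s6_def s5_def)
    moreover then have "0 \<notin> set (s7 0)" by (auto simp: bit_sym_def)
    ultimately show ?thesis using run_clear[of s7 0] unfolding s8_def by simp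
  qed
  \<comment> \<open>Stack 7 holds the output reversed, and copying reverses it once more.\<close>
  have 9: "run (foreach 7 2 9 (\<lambda>a. pushes 0 [a])) s8 s9 (loop_time (emission_time D W K))"
  proof -
    have "emits 0 (foreach 7 2 9 (\<lambda>a. pushes 0 [a])) s8 (rev out) (loop_time (length (rev out)))"
      using s4 bit_sym_range by (intro emits_foreach_copy) (auto simp: s8_def s7_def s6_def s5_def out_def)
    moreover have "loop_time (length (rev out)) \<le> loop_time (emission_time D W K)"
      using emits_length[OF em] by (simp add: loop_time_def)
    ultimately have "emits 0 (foreach 7 2 9 (\<lambda>a. pushes 0 [a])) s8 (rev out) (loop_time (emission_time D W K))"
      using emits_mono by blast
    from emits_run[OF this] show ?thesis by (simp add: s9_def s8_def)
  qed
  have "reduction_time D k (length x) = loop_time (length x) + ((4 + loop_time (length x)) + (2 + ((\<Sum>j<k. L * (L ^ j * 34 + 34) + 2) +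
     ((2 + (loop_time T + (loop_time (length x) + loop_time T))) +
     ((2 + (loop_time W + ((T * (loop_time W + 32) + 2) + (loop_time T + (loop_time (length x) + (loop_time T + 4)))))) +
     (emission_time D W K + ((length x * 3 + 1) + loop_time (emission_time D W K))))))))"
    unfolding reduction_time_def Let_def K_def length_items W_def width_def T_def L_def ..
  moreover have "run (reduction_com PL k) s0 s9 \<dots>"
    unfolding reduction_com_def by (intro run_Seq[OF 1] run_Seq[OF 2] run_Seq[OF 3] run_Seq[OF 4] run_Seq[OF 5]
        run_Seq[OF 6] run_Seq[OF 7] run_Seq[OF 8] 9)
  moreover have "s9 0 = out" by (simp add: s9_def)
  ultimately show ?thesis unfolding s0_def out_def T_def L_def by metis
qed

lemma poly_time_items_output: "poly_time_computable (\<lambda>x. items_output PL ((length x + 2) ^ k) x)"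
proof -
  \<comment> \<open>Only the nine entries \<open>PL 1\<close> to \<open>PL 9\<close> occur, so the
    cost of printing them has a bound independent of the input.\<close>
  define D where "D = (\<Sum>a\<in>{1..9}. length (PL a) * (2 * total_word (PL a) + 34))"
  have D: "length (PL a) * (2 * total_word (PL a) + 34) \<le> D" if "1 \<le> a" "a \<le> 9" for a
    unfolding D_def using that by (intro member_le_sum) auto
  obtain p where p: "\<And>n. reduction_time D k n \<le> poly p n"
    using poly_bounded_reduction_time unfolding poly_bounded_def by blast
  show ?thesis
  proof (rule poly_time_computableI)
    fix x
    obtain \<sigma> where "run (reduction_com PL k) (input_store x) \<sigma> (reduction_time D k (length x))"
      "\<sigma> 0 = map bit_sym (items_output PL ((length x + 2) ^ k) x)"
      using run_reduction[of PL D, OF D] by blast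
    then show "\<exists>t \<le> poly p (length x). \<exists>\<sigma>. exec (reduction_com PL k) (input_store x) t \<sigma> \<and>
        \<sigma> 0 = map bit_sym (items_output PL ((length x + 2) ^ k) x)"
      unfolding run_def using p order_trans by blast
  qed
qed

section \<open>Numbering of the tiles and printing of the weights\<close>

fun opt_index :: "'a::countable option \<Rightarrow> nat" where
  "opt_index None = 0"
| "opt_index (Some c) = Suc (to_nat c)"

lemma opt_index_inject [simp]: "opt_index u = opt_index v \<longleftrightarrow> u = v"
  by (cases u; cases v) auto

lemma opt_index_0 [simp]: "opt_index u = 0 \<longleftrightarrow> u = None"
  by (cases u) auto

fun tile_index :: "ttile \<Rightarrow> tile" where
  "tile_index (l, t, r, d) = (opt_index l, opt_index t, opt_index r, opt_index d)"

lemma distinct_concat_map: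
  "distinct xs \<Longrightarrow> (\<And>x. x \<in> set xs \<Longrightarrow> distinct (f x)) \<Longrightarrow>
    (\<And>x y. x \<in> set xs \<Longrightarrow> y \<in> set xs \<Longrightarrow> x \<noteq> y \<Longrightarrow> set (f x) \<inter> set (f y) = {}) \<Longrightarrow>
    distinct (concat (map f xs))"
proof (induction xs)
  case (Cons a xs)
  have "set (f a) \<inter> set (f y) = {}" if "y \<in> set xs" for y
    using Cons.prems(1) that by (intro Cons.prems(3)) auto
  then have "set (f a) \<inter> set (concat (map f xs)) = {}" by auto
  moreover have "distinct (concat (map f xs))" using Cons by simp
  ultimately show ?case using Cons.prems(2)[of a] by simp
qed simp

text \<open>The bits of the odd factor of the weight without its lowest 1. The five lowest digits
  have \<open>5 * b\<close> bits, of which one is split off, hence the padding to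
  \<open>5 * b - 1\<close>. The case without a letter is separate because the word must end with
  \<open>True\<close>.\<close>

definition weight_pieces :: "nat \<Rightarrow> bool \<Rightarrow> tile \<Rightarrow> piece list" where
  "weight_pieces b out \<tau> =
     (if out then
        (let \<alpha> = tag \<tau> + rgt \<tau> * (2 ^ b) ^ 4 in
         if btm \<tau> = 0 then [Const (binary (\<alpha> div 2))]
         else [Const (pad (5 * b - 1) (\<alpha> div 2)), PerWidth (replicate (3 * b) False), Const (binary (btm \<tau>))])
      else [Const (binary ((tag \<tau> + lft \<tau> * 2 ^ b + tp \<tau> * (2 ^ b) ^ 5) div 2))])"

lemma weight_pieces:
  fixes b m W :: nat and \<tau> :: tile and out :: bool
  assumes b: "tag \<tau> < 2 ^ b" "rgt \<tau> < 2 ^ b"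
  defines "r \<equiv> expands m W (weight_pieces b out \<tau>)"
  shows "r \<noteq> []" "last r" "weight (2 ^ b) W out m \<tau> = 2 ^ (3 * b * m) * (1 + 2 * val r)"
proof -
  have "b \<noteq> 0" using b(1) by (cases b) (auto simp: tag_def)
  then obtain c where c: "b = Suc c" by (cases b) auto
  have odd: "odd (tag \<tau>)" "tag \<tau> \<ge> 3" by (simp_all add: tag_def)
  have B: "(2::nat) ^ (3 * b * m) = (2 ^ b) ^ (3 * m)" by (simp add: power_mult[symmetric] ac_simps)
  have half: "1 + 2 * (\<alpha> div 2) = \<alpha>" "\<alpha> div 2 > 0" if "odd \<alpha>" "\<alpha> \<ge> 3" for \<alpha> :: nat
    using that by presburger+
  have "r \<noteq> [] \<and> last r \<and> weight (2 ^ b) W out m \<tau> = 2 ^ (3 * b * m) * (1 + 2 * val r)"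
  proof (cases out)
    case False
    define \<beta> where "\<beta> = tag \<tau> + lft \<tau> * 2 ^ b + tp \<tau> * (2 ^ b) ^ 5"
    have "odd \<beta>" "\<beta> \<ge> 3" using odd by (auto simp: \<beta>_def c)
    note h = half[OF this]
    have "r = binary (\<beta> div 2)" using False by (simp add: r_def weight_pieces_def \<beta>_def)
    with h last_binary[OF h(2)] show ?thesis
      using False by (simp add: val_binary weight_def B \<beta>_def add.assoc)
  next
    case True
    define \<alpha> where "\<alpha> = tag \<tau> + rgt \<tau> * (2 ^ b) ^ 4"
    have "odd \<alpha>" "\<alpha> \<ge> 3" using odd by (auto simp: \<alpha>_def c)
    note h = half[OF this]
    show ?thesis
    proof (cases "btm \<tau> = 0")
      case True
      have "r = binary (\<alpha> div 2)" using \<open>out\<close> True by (simp add: r_def weight_pieces_def \<alpha>_def)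
      with h last_binary[OF h(2)] True \<open>out\<close> show ?thesis
        by (simp add: val_binary weight_def B \<alpha>_def)
    next
      case False
      have r: "r = pad (5 * b - 1) (\<alpha> div 2) @ replicate (3 * b * W) False @ binary (btm \<tau>)"
        using \<open>out\<close> False by (simp add: r_def weight_pieces_def \<alpha>_def concat_replicate_replicate)
      have "\<alpha> < 2 ^ (5 * b)"
      proof -
        have "rgt \<tau> + 1 \<le> 2 ^ b" using b by simp
        then have "(rgt \<tau> + 1) * (2 ^ b) ^ 4 \<le> 2 ^ b * (2 ^ b) ^ 4" by (intro mult_right_mono) auto
        moreover have "tag \<tau> < (2 ^ b) ^ 4"
          using b(1) power_increasing[of 1 4 "2 ^ b :: nat"] by (simp add: less_le_trans)
        moreover have "(2::nat) ^ b * (2 ^ b) ^ 4 = 2 ^ (5 * b)"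
          by (simp add: power_mult[symmetric] power_add[symmetric])
        ultimately show ?thesis by (simp add: \<alpha>_def)
      qed
      moreover have e: "5 * b = Suc (5 * b - 1)" using c by simp
      ultimately have "\<alpha> < 2 * 2 ^ (5 * b - 1)" by (metis power_Suc)
      then have "\<alpha> div 2 < 2 ^ (5 * b - 1)" by (simp add: less_mult_imp_div_less mult.commute)
      then have v: "val r = \<alpha> div 2 + 2 ^ (5 * b - 1) * (2 ^ (3 * b * W) * btm \<tau>)"
        unfolding r by (simp add: val_append val_pad length_pad val_replicate_False val_binary)
      have "1 + 2 * val r = \<alpha> + 2 ^ Suc (5 * b - 1) * (2 ^ (3 * b * W) * btm \<tau>)"
        using h(1) unfolding v by simp
      also have "2 ^ Suc (5 * b - 1) * (2 ^ (3 * b * W) * btm \<tau>) = btm \<tau> * (2 ^ b) ^ (5 + 3 * W)"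
        unfolding e[symmetric] by (simp add: power_mult[symmetric] power_add[symmetric] algebra_simps)
      finally have "weight (2 ^ b) W out m \<tau> = 2 ^ (3 * b * m) * (1 + 2 * val r)"
        using \<open>out\<close> by (simp add: weight_def B \<alpha>_def)
      moreover have "r \<noteq> []" "last r" using last_binary[of "btm \<tau>"] False unfolding r by auto
      ultimately show ?thesis by blast
    qed
  qed
  then show "r \<noteq> []" "last r" "weight (2 ^ b) W out m \<tau> = 2 ^ (3 * b * m) * (1 + 2 * val r)" by auto
qed

lemma items_not_6: "0 < m \<Longrightarrow> m < length (items T x) \<Longrightarrow> items T x ! m \<noteq> 6"
proof -
  assume "0 < m" "m < length (items T x)"
  then have "items T x ! m \<in> set (tl (items T x))"
    by (metis One_nat_def Suc_pred length_tl nth_mem nth_tl less_diff_conv Suc_eq_plus1)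
  then show ?thesis by (auto simp: items_def bit_sym_def)
qed

lemma items_not_9: "Suc m < length (items T x) \<Longrightarrow> items T x ! m \<noteq> 9"
proof -
  assume "Suc m < length (items T x)"
  then have "items T x ! m \<in> set (butlast (items T x))"
    by (metis length_butlast less_diff_conv nth_butlast nth_mem Suc_eq_plus1)
  then show ?thesis by (auto simp: items_def bit_sym_def butlast_append split: if_splits dest: in_set_butlastD)
qed

lemma items_end: "m < length (items T x) \<Longrightarrow> length (items T x) \<le> m + width T x \<Longrightarrow> items T x ! m \<in> {8, 9}"
proof -
  assume m: "m < length (items T x)" "length (items T x) \<le> m + width T x"
  define A where "A = [6] @ ([5] @ replicate T 4 @ map bit_sym x @ replicate T 3) @ replicate (T * width T x) 7"
  have "items T x = A @ (replicate (width T x) 8 @ [9])" by (simp add: items_def A_def)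
  moreover then have "length A \<le> m" using m by simp
  ultimately have "items T x ! m = (replicate (width T x) 8 @ [9]) ! (m - length A)"
    "m - length A < length (replicate (width T x) (8::nat) @ [9])"
    using m by (auto simp: nth_append)
  then show ?thesis by (metis (no_types, lifting) in_set_replicate insert_iff nth_mem set_append Un_iff empty_set list.simps(15))
qed

lemma encode_mats_concat: "encode_mats (concat Ass) = concat (map encode_mats Ass)"
  by (induction Ass) (simp_all add: encode_mats_def)

section \<open>Correctness of the generators\<close>

context simulation
begin

definition ntiles :: "nat \<Rightarrow> tile set" where
  "ntiles a = tile_index ` tiles a"

lemma finite_ntiles: "finite (ntiles a)"
  by (simp add: ntiles_def finite_tiles)

definition valid_base :: "nat \<Rightarrow> bool" where
  "valid_base b \<longleftrightarrow> (\<forall>a. \<forall>\<tau> \<in> ntiles a. tag \<tau> < 2 ^ b \<and> 2 * lft \<tau> < 2 ^ b \<and> 2 * tp \<tau> < 2 ^ b \<and>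
     2 * rgt \<tau> < 2 ^ b \<and> 2 * btm \<tau> < 2 ^ b)"

text \<open>Only the symbols 1 to 9 have tiles, finitely many each, so one base serves all inputs;
  the maximum \<open>b\<close> itself can be the exponent since \<open>b < 2 ^ b\<close>.\<close>

lemma ex_valid_base: "\<exists>b. valid_base b"
proof -
  let ?g = "\<lambda>\<tau>. tag \<tau> + 2 * lft \<tau> + 2 * tp \<tau> + 2 * rgt \<tau> + 2 * btm \<tau>"
  define U where "U = (\<Union>a\<in>{1..9}. ntiles a)"
  define b where "b = Max (?g ` U)"
  have fin: "finite (?g ` U)" by (simp add: U_def finite_ntiles)
  have "?g \<tau> < 2 ^ b" if \<tau>: "\<tau> \<in> ntiles a" for a \<tau>
  proof -
    have "a \<in> {1..9}" using \<tau> by (auto simp: ntiles_def tiles_def split: if_splits)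
    with \<tau> have "\<tau> \<in> U" unfolding U_def by blast
    then have "?g \<tau> \<in> ?g ` U" by (rule imageI)
    then have "?g \<tau> \<le> b" unfolding b_def by (rule Max_ge[OF fin])
    also have "b < 2 ^ b" by (rule less_exp)
    finally show ?thesis .
  qed
  then have "tag \<tau> < 2 ^ b \<and> 2 * lft \<tau> < 2 ^ b \<and> 2 * tp \<tau> < 2 ^ b \<and> 2 * rgt \<tau> < 2 ^ b \<and> 2 * btm \<tau> < 2 ^ b"
    if "\<tau> \<in> ntiles a" for a \<tau>
  proof -
    from \<open>\<And>a \<tau>. \<tau> \<in> ntiles a \<Longrightarrow> ?g \<tau> < 2 ^ b\<close>[OF that] show ?thesis by linarith
  qed
  then show ?thesis unfolding valid_base_def by blast
qed

lemma tile_system_items: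
  assumes b: "valid_base b"
  shows "tile_system (length (items T x)) (width T x) (2 ^ b) (\<lambda>m. ntiles (items T x ! m))"
proof
  let ?K = "length (items T x)"
  show "2 \<le> ?K" by (simp add: length_items)
  show "(2::nat) ^ b > 0" by simp
  fix m \<tau> assume m: "m < ?K" and \<tau>: "\<tau> \<in> ntiles (items T x ! m)"
  let ?a = "items T x ! m"
  have "lft \<tau> = 0 \<longleftrightarrow> ?a = 6" "rgt \<tau> = 0 \<longleftrightarrow> ?a = 9"
    using \<tau> by (auto simp: ntiles_def tiles_def split: if_splits)
  moreover have "?a = 6 \<longleftrightarrow> m = 0" using items_not_6[of m T x] items_0[of T x] m by auto
  moreover have "?a = 9 \<longleftrightarrow> m = ?K - 1"
  proof
    assume "?a = 9"
    then have "\<not> Suc m < ?K" using items_not_9[of m T x] by blast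
    then show "m = ?K - 1" using m by linarith
  next
    have "?K - 1 = 1 + (T + 2) * width T x" by (simp only: length_items)
    moreover assume "m = ?K - 1"
    ultimately show "?a = 9" using items_last[of T x] by simp
  qed
  ultimately show "lft \<tau> = 0 \<longleftrightarrow> m = 0" "rgt \<tau> = 0 \<longleftrightarrow> m = ?K - 1" by auto
  show "tag \<tau> < 2 ^ b \<and> 2 * lft \<tau> < 2 ^ b \<and> 2 * tp \<tau> < 2 ^ b \<and> 2 * rgt \<tau> < 2 ^ b \<and> 2 * btm \<tau> < 2 ^ b"
    using b \<tau> unfolding valid_base_def by blast
next
  fix m \<tau> assume "m < length (items T x)" "length (items T x) \<le> m + width T x" "\<tau> \<in> ntiles (items T x ! m)"
  with items_end[of m T x] show "btm \<tau> = 0"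
    by (auto simp: ntiles_def tiles_def)
qed

text \<open>\<open>opt_index\<close> is injective and gives 0 only to \<open>None\<close>, so
  equality of numbers in a tiling is equality of colours and letters.\<close>

lemma tiling_iff_typed:
  assumes "tile_system (length (items T x)) (width T x) B (\<lambda>m. ntiles (items T x ! m))"
  shows "(\<exists>\<tau>. tile_system.tiling (length (items T x)) (width T x) (\<lambda>m. ntiles (items T x ! m)) \<tau>) \<longleftrightarrow>
    (\<exists>h v. typed_tiling T x h v)"
proof -
  interpret tile_system "length (items T x)" "width T x" B "\<lambda>m. ntiles (items T x ! m)" by fact
  let ?K = "length (items T x)" and ?W = "width T x"
  show ?thesis
  proof
    assume "\<exists>\<tau>. tiling \<tau>"
    then obtain \<tau> where \<tau>: "tiling \<tau>" by blast
    have "\<exists>l t r d. (l, t, r, d) \<in> tiles (items T x ! m) \<and> \<tau> m = (opt_index l, opt_index t, opt_index r, opt_index d)" if "m < ?K" for m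
    proof -
      have "\<tau> m \<in> ntiles (items T x ! m)" using \<tau> that unfolding tiling_def by blast
      then show ?thesis unfolding ntiles_def by force
    qed
    then obtain l t r d where q: "\<And>m. m < ?K \<Longrightarrow> (l m, t m, r m, d m) \<in> tiles (items T x ! m) \<and>
        \<tau> m = (opt_index (l m), opt_index (t m), opt_index (r m), opt_index (d m))" by metis
    define h where "h m = (if m < ?K then l m else r (m - 1))" for m
    have "h (Suc m) = r m" if "m < ?K" for m
    proof (cases "Suc m < ?K")
      case True
      then have "rgt (\<tau> m) = lft (\<tau> (Suc m))" using \<tau> by (simp add: tiling_def)
      then show ?thesis using q[of m] q[of "Suc m"] True by (simp add: h_def)
    qed (simp add: h_def)
    moreover have "t m = (if ?W \<le> m then d (m - ?W) else None)" if "m < ?K" for m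
    proof -
      have "tp (\<tau> m) = (if ?W \<le> m then btm (\<tau> (m - ?W)) else 0)" using \<tau> that by (simp add: tiling_def)
      then show ?thesis using q[of m] q[of "m - ?W"] that by (auto split: if_splits)
    qed
    moreover have "h m = l m" if "m < ?K" for m using that by (simp add: h_def)
    ultimately have "typed_tiling T x h d"
      unfolding typed_tiling_def using q by auto
    then show "\<exists>h v. typed_tiling T x h v" by blast
  next
    assume "\<exists>h v. typed_tiling T x h v"
    then obtain h v where hv: "typed_tiling T x h v" by blast
    define \<tau> where "\<tau> m = tile_index (h m, if ?W \<le> m then v (m - ?W) else None, h (Suc m), v m)" for m
    have "tiling \<tau>"
      unfolding tiling_def
    proof (intro conjI allI impI)
      fix m assume "m < ?K"
      then show "\<tau> m \<in> ntiles (items T x ! m)"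
        using hv unfolding typed_tiling_def \<tau>_def ntiles_def by blast
    qed (auto simp: \<tau>_def)
    then show "\<exists>\<tau>. tiling \<tau>" by blast
  qed
qed

lemma accepts_iff_tiling: "T \<ge> 1 \<Longrightarrow> (\<exists>t < T. accepts_in M x t) \<longleftrightarrow> (\<exists>h v. typed_tiling T x h v)"
  using typed_tiling_sound typed_tiling_complete by blast

definition tile_list :: "nat \<Rightarrow> tile list" where
  "tile_list a = (SOME ts. set ts = ntiles a \<and> distinct ts)"

lemma tile_list: "set (tile_list a) = ntiles a" "distinct (tile_list a)"
  using someI_ex[OF finite_distinct_list[OF finite_ntiles[of a]]] by (simp_all add: tile_list_def)

definition generators :: "nat \<Rightarrow> nat \<Rightarrow> bool list \<Rightarrow> mat2 list" where
  "generators b T x = concat (map (\<lambda>m. concat (map (\<lambda>\<tau>.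
     [edge m (weight (2 ^ b) (width T x) True m \<tau>), edge m (weight (2 ^ b) (width T x) False m \<tau>)])
     (tile_list (items T x ! m)))) [0..<length (items T x)])"

definition generator_pieces :: "nat \<Rightarrow> nat \<Rightarrow> piece list" where
  "generator_pieces b a = concat (map (\<lambda>\<tau>.
     edge_pieces (3 * b) (weight_pieces b True \<tau>) @ edge_pieces (3 * b) (weight_pieces b False \<tau>)) (tile_list a))"

lemma items_output_generators:
  assumes b: "valid_base b"
  shows "items_output (generator_pieces b) T x = encode_mats (generators b T x)"
proof -
  let ?W = "width T x"
  have e: "expands m ?W (edge_pieces (3 * b) (weight_pieces b out \<tau>)) = encode_mat (edge m (weight (2 ^ b) ?W out m \<tau>))"
    if "\<tau> \<in> ntiles a" for m out \<tau> a
  proof -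
    have "tag \<tau> < 2 ^ b" "rgt \<tau> < 2 ^ b" using b that unfolding valid_base_def by fastforce+
    note w = weight_pieces[OF this, where m = m and W = "?W" and out = out]
    show ?thesis using expands_edge_pieces[OF refl w(1,2), of "3 * b"] w(3) by simp
  qed
  have "expands m ?W (generator_pieces b a) = encode_mats (concat (map (\<lambda>\<tau>.
     [edge m (weight (2 ^ b) ?W True m \<tau>), edge m (weight (2 ^ b) ?W False m \<tau>)]) (tile_list a)))" for m a
  proof -
    have "expands m ?W (concat (map (\<lambda>\<tau>. edge_pieces (3 * b) (weight_pieces b True \<tau>) @ edge_pieces (3 * b) (weight_pieces b False \<tau>)) ts)) =
      encode_mats (concat (map (\<lambda>\<tau>. [edge m (weight (2 ^ b) ?W True m \<tau>), edge m (weight (2 ^ b) ?W False m \<tau>)]) ts))"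
      if "set ts \<subseteq> ntiles a" for ts
      using that by (induction ts) (auto simp: e encode_mats_def)
    then show ?thesis unfolding generator_pieces_def using tile_list(1)[of a] by blast
  qed
  then show ?thesis
    by (simp only: items_output_def generators_def encode_mats_concat map_map comp_def)
qed

lemma generators_language:
  assumes b: "valid_base b"
  shows "encode_mats (generators b T x) \<in> SL2Z_nonfreeness \<longleftrightarrow> (\<exists>h v. typed_tiling T x h v)"
proof -
  let ?K = "length (items T x)" and ?W = "width T x"
  let ?f = "\<lambda>m \<tau>. [edge m (weight (2 ^ b) ?W True m \<tau>), edge m (weight (2 ^ b) ?W False m \<tau>)]"
  note ts = tile_system_items[OF b, of T x]
  interpret tile_system ?K ?W "2 ^ b" "\<lambda>m. ntiles (items T x ! m)" by (rule ts)
  have set: "set (generators b T x) = case_prod edge ` edges"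
  proof
    show "set (generators b T x) \<subseteq> case_prod edge ` edges"
      unfolding generators_def edges_def by (auto simp: tile_list(1)) blast+
    show "case_prod edge ` edges \<subseteq> set (generators b T x)"
    proof
      fix A assume "A \<in> case_prod edge ` edges"
      then obtain m out \<tau> where "m < ?K" "\<tau> \<in> ntiles (items T x ! m)" "A = edge m (weight (2 ^ b) ?W out m \<tau>)"
        unfolding edges_def by auto
      then show "A \<in> set (generators b T x)"
        unfolding generators_def by (cases out) (force simp: tile_list(1))+
    qed
  qed
  \<comment> \<open>The language demands a list without repetitions, so different items, tiles or
    flags must give different matrices.\<close>
  have inj: "m = m' \<and> \<tau> = \<tau>' \<and> out = out'"
    if "edge m (weight (2 ^ b) ?W out m \<tau>) = edge m' (weight (2 ^ b) ?W out' m' \<tau>')"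
      "m < ?K" "\<tau> \<in> ntiles (items T x ! m)" "\<tau>' \<in> ntiles (items T x ! m')" for m m' \<tau> \<tau>' out out'
  proof -
    have "m = m' \<and> weight (2 ^ b) ?W out m \<tau> = weight (2 ^ b) ?W out' m' \<tau>'"
      using that(1) by (subst (asm) edge_inject[OF weight_pos])
    then show ?thesis using weight_inject[of m \<tau> \<tau>' out out'] that by auto
  qed
  have "distinct (generators b T x)"
    unfolding generators_def
  proof (intro distinct_concat_map)
    fix m assume m: "m \<in> set [0..<?K]"
    fix \<tau> assume \<tau>: "\<tau> \<in> set (tile_list (items T x ! m))"
    show "distinct (?f m \<tau>)"
      using inj[of m True \<tau> m False \<tau>] m \<tau> by (auto simp: tile_list(1))
    fix \<tau>' assume "\<tau>' \<in> set (tile_list (items T x ! m))" "\<tau> \<noteq> \<tau>'"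
    then show "set (?f m \<tau>) \<inter> set (?f m \<tau>') = {}"
      using inj[of m _ \<tau> m _ \<tau>'] inj[of m _ \<tau>' m _ \<tau>] m \<tau> by (auto simp: tile_list(1))
  next
    fix m m' assume m: "m \<in> set [0..<?K]" "m' \<in> set [0..<?K]" "m \<noteq> m'"
    show "set (concat (map (?f m) (tile_list (items T x ! m)))) \<inter> set (concat (map (?f m') (tile_list (items T x ! m')))) = {}"
      using inj[of m _ _ m'] inj[of m' _ _ m] m by (auto simp: tile_list(1))
  qed (simp_all add: tile_list(2))
  moreover have "set (generators b T x) \<subseteq> SL2Z" unfolding set using edge_SL2Z by auto
  ultimately have "encode_mats (generators b T x) \<in> SL2Z_nonfreeness \<longleftrightarrow> \<not> free_over (set (generators b T x))"
    unfolding SL2Z_nonfreeness_def using injD[OF inj_encode_mats] by blast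
  also have "\<dots> \<longleftrightarrow> (\<exists>\<tau>. tiling \<tau>)" unfolding set by (rule not_free_iff_tiling)
  also have "\<dots> \<longleftrightarrow> (\<exists>h v. typed_tiling T x h v)" by (rule tiling_iff_typed[OF ts])
  finally show ?thesis .
qed

end

lemma ex_symbol_bound: "wf_tm M \<Longrightarrow> \<exists>S. simulation M S"
proof -
  assume wf: "wf_tm M"
  let ?U = "\<Union>i\<in>instrs M. set (rds i) \<union> fst ` set (acs i)"
  have fin: "finite ?U" using wf by (auto simp: wf_tm_def)
  define S where "S = Max (insert 2 ?U)"
  have "s \<le> S" if "s \<in> insert 2 ?U" for s unfolding S_def using fin that by (intro Max_ge) auto
  then have "simulation M S" using wf by unfold_locales auto
  then show ?thesis by blast
qed

theorem theorem2: "NP_hard SL2Z_nonfreeness"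
  unfolding NP_hard_def
proof
  fix A assume "A \<in> NP"
  then obtain M and p :: "nat poly" where M: "wf_tm M" "A = {x. \<exists>t. accepts_in M x t}"
    "\<And>x. x \<in> A \<Longrightarrow> \<exists>t \<le> poly p (length x). accepts_in M x t"
    unfolding NP_def by blast
  obtain S where "simulation M S" using ex_symbol_bound[OF M(1)] by blast
  then interpret simulation M S .
  obtain b where b: "valid_base b"
    using ex_valid_base by blast
  obtain k where k: "\<And>n. poly p n + 1 \<le> (n + 2) ^ k" using poly_less_power by blast
  define f where "f x = items_output (generator_pieces b) ((length x + 2) ^ k) x" for x
  have "poly_time_computable f" unfolding f_def by (rule poly_time_items_output)
  moreover have "x \<in> A \<longleftrightarrow> f x \<in> SL2Z_nonfreeness" for x
  proof -
    let ?T = "(length x + 2) ^ k"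
    \<comment> \<open>The time bound is used only from left to right; conversely, acceptance at any
      time suffices for membership.\<close>
    have "x \<in> A \<longleftrightarrow> (\<exists>t < ?T. accepts_in M x t)"
    proof
      assume "x \<in> A"
      then obtain t where "t \<le> poly p (length x)" "accepts_in M x t" using M(3) by blast
      moreover from this have "t < ?T" using k[of "length x"] by linarith
      ultimately show "\<exists>t < ?T. accepts_in M x t" by blast
    qed (use M(2) in blast)
    also have "\<dots> \<longleftrightarrow> (\<exists>h v. typed_tiling ?T x h v)"
      by (rule accepts_iff_tiling) simp
    also have "\<dots> \<longleftrightarrow> f x \<in> SL2Z_nonfreeness"
      unfolding f_def items_output_generators[OF b] by (rule generators_language[OF b, symmetric])
    finally show ?thesis .
  qed
  ultimately show "poly_reducible A SL2Z_nonfreeness"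
    unfolding poly_reducible_def by blast
qed

end
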